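(* Consider the $N$-converter system described in the context, in which each network line consists of a resistor and an inductor and all lines have the same R/X ratio $\epsilon$, so that $\mathbf{Y}_{\rm grid}(s)=\mathbf{B}_{\rm r}\otimes F_\epsilon(s)$. Let $\widetilde{\mathbf{Y}}_{\mathrm{C},i}(s)=\mathbf{Y}_{\mathrm{C},i}(s)F_\epsilon^{-1}(s)$ for $i\in\{1,\dots,N\}$, and let $$\mathrm{gSCR}=\lambda_1(\mathbf{S}^{-1}\mathbf{B}_{\rm r})=\underline\sigma(\mathbf{S}^{-\frac12}\mathbf{B}_{\rm r}\mathbf{S}^{-\frac12}),$$ where $\lambda_1$ denotes the smallest eigenvalue. Suppose that the open-loop systems $e^{J\vartheta}\mathbf{Y}_{\rm C}^N(s)e^{-J\vartheta}(I_N\otimes F_\epsilon^{-1}(s))$ and $\widetilde{\mathbf{Y}}_{\rm grid}^{-1}(s)$ are stable (i.e., belong to $\mathcal{RH}_\infty^{2N\times 2N}$), where $$\widetilde{\mathbf{Y}}_{\rm grid}(s)=(\mathbf{S}^{-\frac12}\otimes I_2)\mathbf{Y}_{\rm grid}(s)(\mathbf{S}^{-\frac12}\otimes F_\epsilon^{-1}(s)),$$ and that for each $\omega\in[0,\infty]$ at least one of the following two conditions holds: (i) (decentralized gain condition) $\max_i\ \overline\sigma(\widetilde{\mathbf{Y}}_{\mathrm{C},i}(j\omega))<\mathrm{gSCR}$; (ii) (decentralized phase condition) all of the following hold: a) $\max_i\ \overline\phi(\widetilde{\mathbf{Y}}_{\mathrm{C},i}(j\omega))<\pi$; b) $\min_i\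 \underline\phi(\widetilde{\mathbf{Y}}_{\mathrm{C},i}(j\omega))>-\pi$; c) $\max_i\ \overline\phi(\widetilde{\mathbf{Y}}_{\mathrm{C},i}(j\omega))-\min_i\ \underline\phi(\widetilde{\mathbf{Y}}_{\mathrm{C},i}(j\omega))<\pi$. Then the multi-converter system is stable, i.e., the feedback interconnection $$\big[e^{J\vartheta}\,\mathbf{Y}_{\rm C}^N(s)\,e^{-J\vartheta}(I_N\otimes F_\epsilon^{-1}(s))\big]\ \#\ \widetilde{\mathbf{Y}}_{\rm grid}^{-1}(s)$$ is stable.
   Context: **Gains and phases.** For $A\in\mathbb{C}^{n\times n}$, $\overline\sigma(A)$ and $\underline\sigma(A)$ are its largest and smallest singular values. The numerical range is $W(A)=\{x^*Ax: x\in\mathbb{C}^n,\ \|x\|=1\}$. $A$ is sectorial if $0\notin W(A)$. A sectorial $A$ can be written $A=T^*\Delta T$ with $T$ nonsingular and $\Delta$ diagonal unitary; $\Delta$ is unique up to permutation and its diagonal entries lie on an arc of the unit circle of length less than $\pi$. The phases of $A$, $\overline\phi(A)=\phi_1(A)\ge\dots\ge\phi_n(A)=\underline\phi(A)$, are the arguments of the diagonal entries of $\Delta$, chosen as real numbers so that $\overline\phi(A)-\underline\phi(A)<\pi$ (they are determined up to adding a common integer multiple of $2\pi$; for each matrix and each frequency some such choice is fixed). If $A$ is not sectorial, set $\overline\phi(A)=+\infty$, $\underline\phi(A)=-\infty$, so a phase condition involving $A$ fails. **Feedback stability.** $\mathcal{RH}_\infty^{m\times m}$ is the set of $m\times m$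 real rational proper stable transfer function matrices. The feedback interconnection $G\#H$ is stable if $$G\#H=\begin{bmatrix}(I+HG)^{-1}&(I+HG)^{-1}H\\ G(I+HG)^{-1}&G(I+HG)^{-1}H\end{bmatrix}\in\mathcal{RH}_\infty^{2m\times 2m}.$$ **Converters.** $N\ge1$ converters; the $i$-th has small-signal admittance $\mathbf{Y}_{\mathrm{C},i}(s)$, a $2\times2$ real rational transfer matrix. $\mathbf{Y}_{\rm C}^N(s)=\mathrm{diag}(\mathbf{Y}_{\mathrm{C},1}(s),\dots,\mathbf{Y}_{\mathrm{C},N}(s))$; $\mathbf{S}=\mathrm{diag}\{S_1,\dots,S_N\}$ with capacity ratios $S_i>0$; for angles $\theta_i\in\mathbb{R}$, $e^{J\theta_i}=\begin{bmatrix}\cos\theta_i&-\sin\theta_i\\ \sin\theta_i&\cos\theta_i\end{bmatrix}$ and $e^{\pm J\vartheta}=\mathrm{diag}\{e^{\pm J\theta_1},\dots,e^{\pm J\theta_N}\}$. With $\mathbf I,\mathbf U$ the stacked $dq$ current and voltage perturbations, the converters satisfy $-\mathbf I=(\mathbf S\otimes I_2)e^{J\vartheta}\mathbf{Y}_{\rm C}^N(s)e^{-J\vartheta}\mathbf U$. **Network.** There are nodes $1,\dots,M$ ($M\ge N$; nodes $1,\dots,N$ are converter nodes, the others interior) and a grounded node $M+1$. The line between nodes $i\ne j$ has susceptance $B_{ij}=B_{ji}\ge0$ (zero if there is no line) and $2\times2$ admittance $Y_{ij}(s)=B_{ij}F_\epsilon(s)$, where, with nominal frequency $\omega_0>0$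 and R/X ratio $\epsilon\ge0$, $$F_\epsilon(s)=\begin{bmatrix}s/\omega_0+\epsilon&-1\\1&s/\omega_0+\epsilon\end{bmatrix}^{-1}.$$ The grounded Laplacian $\mathbf{B}\in\mathbb{R}^{M\times M}$ has entries $\mathbf{B}_{ij}=-B_{ij}$ for $i\neq j$ and $\mathbf{B}_{ii}=\sum_{j\in\{1,\dots,M+1\},\,j\ne i}B_{ij}$. Partition $\mathbf{B}=\begin{bmatrix}\mathbf{B}_1&\mathbf{B}_2\\ \mathbf{B}_3&\mathbf{B}_4\end{bmatrix}$ with $\mathbf{B}_1\in\mathbb{R}^{N\times N}$, and let $\mathbf{B}_{\rm r}=\mathbf{B}_1-\mathbf{B}_2\mathbf{B}_4^{-1}\mathbf{B}_3$ (Kron reduction); $\mathbf{B}_4$ and $\mathbf{B}_{\rm r}$ are assumed invertible. The network satisfies $\mathbf I=\mathbf{Y}_{\rm grid}(s)\mathbf U$ with $\mathbf{Y}_{\rm grid}(s)=\mathbf{B}_{\rm r}\otimes F_\epsilon(s)$. **Closed loop.** The closed loop $[(\mathbf S\otimes I_2)e^{J\vartheta}\mathbf{Y}_{\rm C}^N e^{-J\vartheta}]\#\mathbf{Y}_{\rm grid}^{-1}$ of converters and network is represented by the re-scaled interconnection $[e^{J\vartheta}\mathbf{Y}_{\rm C}^N e^{-J\vartheta}(I_N\otimes F_\epsilon^{-1})]\#\widetilde{\mathbf{Y}}_{\rm grid}^{-1}$, and stability of the multi-converter system means stability of this re-scaled interconnection. Values at $\omega=\infty$ are limits of proper transfer matrices.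 *)

theory Defs
  imports
    Complex_Main
    "HOL-Library.Extended_Real"
    "HOL-Computational_Algebra.Computational_Algebra"
    "HOL-Computational_Algebra.Field_as_Ring"
    "Jordan_Normal_Form.Matrix"
    "Jordan_Normal_Form.Gauss_Jordan_Elimination"
    "Jordan_Normal_Form.Char_Poly"
    "Jordan_Normal_Form.Schur_Decomposition"
begin

section \<open>Matrices\<close>

text \<open>Only meaningful for invertible matrices, see the lemma below.\<close>

definition mat_inv :: "'a::field mat \<Rightarrow> 'a mat" where
  "mat_inv A = the (mat_inverse A)"

lemma mat_inv:
  fixes A :: "'a::field mat"
  assumes A: "A \<in> carrier_mat n n" and inv: "invertible_mat A"
  shows "mat_inv A \<in> carrier_mat n n" "A * mat_inv A = 1\<^sub>m n" "mat_inv A * A = 1\<^sub>m n"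
proof -
  obtain B where B: "A * B = 1\<^sub>m n" "B * A = 1\<^sub>m (dim_row B)"
    using A inv unfolding invertible_mat_def inverts_mat_def by auto
  from arg_cong[OF B(1), of dim_col] arg_cong[OF B(2), of dim_col] A
  have "B \<in> carrier_mat n n" by auto
  with A B have "A \<in> Units (ring_mat TYPE('a) n ())"
    unfolding Units_def ring_mat_def by auto
  with mat_inverse(1)[OF A, of "()"] obtain C where C: "mat_inverse A = Some C"
    by (cases "mat_inverse A") auto
  with mat_inverse(2)[OF A C]
  show "mat_inv A \<in> carrier_mat n n" "A * mat_inv A = 1\<^sub>m n" "mat_inv A * A = 1\<^sub>m n"
    by (auto simp: mat_inv_def)
qed

definition kron :: "'a::times mat \<Rightarrow> 'a mat \<Rightarrow> 'a mat" where
  "kron A B = mat (dim_row A * dim_row B) (dim_col A * dim_col B)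
     (\<lambda>(i, j). A $$ (i div dim_row B, j div dim_col B) * B $$ (i mod dim_row B, j mod dim_col B))"

text \<open>For real matrices all of whose eigenvalues are real.\<close>

definition smallest_eigenvalue :: "real mat \<Rightarrow> real" where
  "smallest_eigenvalue A = Min {x. eigenvalue A x}"

section \<open>Gains and phases\<close>

text \<open>Used for square matrices only.\<close>

definition singular_values :: "complex mat \<Rightarrow> real set" where
  "singular_values A = {x. x \<ge> 0 \<and> eigenvalue (mat_adjoint A * A) (complex_of_real (x\<^sup>2))}"

definition sigma_max :: "complex mat \<Rightarrow> real" where
  "sigma_max A = Max (singular_values A)"

definition sigma_min :: "complex mat \<Rightarrow> real" where
  "sigma_min A = Min (singular_values A)"

definition numerical_range :: "complex mat \<Rightarrow> complex set" where
  "numerical_range A = {(A *\<^sub>v x) \<bullet>c x | x. x \<in> carrier_vec (dim_row A) \<and> x \<bullet>c x = 1}"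

definition sectorial :: "complex mat \<Rightarrow> bool" where
  "sectorial A \<longleftrightarrow> 0 \<notin> numerical_range A"

text \<open>A relation and not a function, because the phases of a sectorial matrix are determined only
  up to a common integer multiple of \<open>2 * pi\<close>.\<close>

definition is_phases :: "complex mat \<Rightarrow> real list \<Rightarrow> bool" where
  "is_phases A ph \<longleftrightarrow>
     length ph = dim_row A \<and> sorted_wrt (\<ge>) ph \<and> hd ph - last ph < pi \<and>
     (\<exists>T \<in> carrier_mat (dim_row A) (dim_row A). invertible_mat T \<and>
        A = mat_adjoint T * mat_diag (dim_row A) (\<lambda>k. cis (ph ! k)) * T)"

text \<open>The list \<open>ph\<close> is the fixed choice of phases; it is ignored when \<open>A\<close> is not sectorial.\<close>

definition max_phase :: "complex mat \<Rightarrow> real list \<Rightarrow> ereal" where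
  "max_phase A ph = (if sectorial A then ereal (hd ph) else \<infinity>)"

definition min_phase :: "complex mat \<Rightarrow> real list \<Rightarrow> ereal" where
  "min_phase A ph = (if sectorial A then ereal (last ph) else - \<infinity>)"

section \<open>Transfer functions\<close>

type_synonym tf = "real poly fract"

definition tf_s :: tf where
  "tf_s = to_fract [:0, 1:]"

definition tf_const :: "real \<Rightarrow> tf" where
  "tf_const c = to_fract [:c:]"

text \<open>\<^const>\<open>quot_of_fract\<close> yields coprime numerator and denominator, so the poles of \<open>R\<close> are exactly
  the roots of the denominator.\<close>

definition tf_eval :: "tf \<Rightarrow> complex \<Rightarrow> complex" where
  "tf_eval R s = poly (map_poly complex_of_real (fst (quot_of_fract R))) s /
                 poly (map_poly complex_of_real (snd (quot_of_fract R))) s"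

definition tf_proper :: "tf \<Rightarrow> bool" where
  "tf_proper R \<longleftrightarrow> degree (fst (quot_of_fract R)) \<le> degree (snd (quot_of_fract R))"

definition tf_stable :: "tf \<Rightarrow> bool" where
  "tf_stable R \<longleftrightarrow>
     (\<forall>s. poly (map_poly complex_of_real (snd (quot_of_fract R))) s = 0 \<longrightarrow> Re s < 0)"

definition RH_inf :: "nat \<Rightarrow> tf mat set" where
  "RH_inf m = {R \<in> carrier_mat m m. \<forall>i<m. \<forall>j<m. tf_proper (R $$ (i, j)) \<and> tf_stable (R $$ (i, j))}"

text \<open>The value at \<open>j\<omega>\<close> for \<open>\<omega> \<in> [0, \<infinity>]\<close>.\<close>

definition freq_resp :: "tf mat \<Rightarrow> ereal \<Rightarrow> complex mat" where
  "freq_resp R w =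
     (if w = \<infinity> then map_mat (\<lambda>r. Lim at_top (\<lambda>x. tf_eval r (\<i> * complex_of_real x))) R
      else map_mat (\<lambda>r. tf_eval r (\<i> * complex_of_real (real_of_ereal w))) R)"

section \<open>Feedback interconnection\<close>

definition feedback :: "tf mat \<Rightarrow> tf mat \<Rightarrow> tf mat" where
  "feedback G H = (let L = mat_inv (1\<^sub>m (dim_row G) + H * G)
     in four_block_mat L (L * H) (G * L) (G * L * H))"

definition feedback_stable :: "tf mat \<Rightarrow> tf mat \<Rightarrow> bool" where
  "feedback_stable G H \<longleftrightarrow>
     invertible_mat (1\<^sub>m (dim_row G) + H * G) \<and> feedback G H \<in> RH_inf (2 * dim_row G)"

section \<open>Converters and network\<close>

definition rotation :: "real \<Rightarrow> tf mat" where
  "rotation t = map_mat tf_const (mat_of_rows_list 2 [[cos t, - sin t], [sin t, cos t]])"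

definition line_dynamics :: "real \<Rightarrow> real \<Rightarrow> tf mat" where
  "line_dynamics w0 eps = mat_inv (mat_of_rows_list 2
     [[tf_s / tf_const w0 + tf_const eps, - 1], [1, tf_s / tf_const w0 + tf_const eps]])"

text \<open>Nodes are numbered from \<open>0\<close>; the grounded node has index \<open>M\<close>.\<close>

definition grounded_laplacian :: "nat \<Rightarrow> (nat \<Rightarrow> nat \<Rightarrow> real) \<Rightarrow> real mat" where
  "grounded_laplacian M b =
     mat M M (\<lambda>(i, j). if i = j then (\<Sum>k \<in> {..M} - {i}. b i k) else - b i j)"

end

theory Submission
  imports Defs
begin

text \<open>Since all lines share the same dynamics, \<open>Ygrid'\<close> is the constant matrix \<open>K \<otimes> I\<close> with the positive
  definite \<open>K = S\<^sup>-\<^sup>1\<^sup>/\<^sup>2 Br S\<^sup>-\<^sup>1\<^sup>/\<^sup>2\<close>, and since rotations commute with the line impedance, \<open>G\<close> is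
  a unitary conjugate of the block diagonal matrix of the \<open>YC' i\<close>. A kernel vector \<open>v\<close> of
  \<open>K \<otimes> I + t G(j\<omega>)\<close> with \<open>t \<in> [0, 1]\<close> would give \<open>v\<^sup>* (K \<otimes> I) v = - t v\<^sup>* G(j\<omega>) v\<close>, where the left
  side is at least \<open>gSCR |v|\<^sup>2 > 0\<close>. The gain condition makes the right side too small, and the phase
  condition puts \<open>v\<^sup>* G(j\<omega>) v\<close> in an open half plane that misses the negative real axis. So
  \<open>det (K \<otimes> I + t G)\<close> has no zeros on the imaginary axis or at infinity for any \<open>t\<close>; by continuity in \<open>t\<close>
  its zeros stay in the open left half plane up to \<open>t = 1\<close>, so that \<open>(I + H G)\<^sup>-\<^sup>1\<close> is stable.\<close>

section \<open>Hurwitz polynomials\<close>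

definition hurwitz :: "complex poly \<Rightarrow> bool" where
  "hurwitz p \<longleftrightarrow> (\<forall>s. poly p s = 0 \<longrightarrow> Re s < 0)"

lemma norm_diff_ge_of_Re_neg:
  fixes r z :: complex
  assumes "Re r < 0" "0 \<le> Re z"
  shows "inverse (1 + (1 + norm r) / (- Re r)) * (1 + norm z) \<le> norm (z - r)"
proof -
  define d where "d = - Re r"
  have d: "0 < d" using assms by (simp add: d_def)
  have "d \<le> \<bar>Re (z - r)\<bar>" using assms by (simp add: d_def)
  then have n1: "d \<le> norm (z - r)" using abs_Re_le_cmod[of "z - r"] by linarith
  have "1 + norm r \<le> norm (z - r) * ((1 + norm r) / d)"
  proof -
    have "d * ((1 + norm r) / d) \<le> norm (z - r) * ((1 + norm r) / d)"
      using n1 d by (intro mult_right_mono) auto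
    then show ?thesis using d by simp
  qed
  moreover have "norm z \<le> norm (z - r) + norm r" by (metis norm_triangle_sub add.commute)
  ultimately have "1 + norm z \<le> norm (z - r) * (1 + (1 + norm r) / d)"
    by (simp add: algebra_simps)
  moreover have "0 < 1 + (1 + norm r) / d" using d by (simp add: add_pos_nonneg)
  ultimately show ?thesis unfolding d_def[symmetric] by (simp add: field_simps)
qed

lemma hurwitz_factorization:
  fixes p :: "complex poly"
  assumes "hurwitz p" "p \<noteq> 0"
  obtains root where "\<And>i. i < degree p \<Longrightarrow> Re (root i) < 0"
    "\<And>z. norm (poly p z) = norm (lead_coeff p) * (\<Prod>i<degree p. norm (z - root i))"
proof -
  obtain root where r: "Polynomial.smult (lead_coeff p) (\<Prod>i<degree p. [:- root i, 1:]) = p"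
    by (rule complex_poly_decompose')
  have e: "poly p z = lead_coeff p * (\<Prod>i<degree p. z - root i)" for z
    by (subst r[symmetric]) (simp add: poly_prod)
  have "Re (root i) < 0" if "i < degree p" for i
  proof -
    have "poly p (root i) = 0" using that by (auto simp: e intro!: prod_zero)
    then show ?thesis using assms(1) by (simp add: hurwitz_def)
  qed
  moreover have "norm (poly p z) = norm (lead_coeff p) * (\<Prod>i<degree p. norm (z - root i))" for z
    by (subst e) (simp add: norm_mult prod_norm)
  ultimately show ?thesis using that by blast
qed

lemma hurwitz_growth:
  assumes "hurwitz p" "p \<noteq> 0"
  obtains c where "0 < c" "\<And>z. 0 \<le> Re z \<Longrightarrow> c * (1 + norm z) ^ degree p \<le> norm (poly p z)"
proof -
  obtain root where r: "\<And>i. i < degree p \<Longrightarrow> Re (root i) < 0"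
    "\<And>z. norm (poly p z) = norm (lead_coeff p) * (\<Prod>i<degree p. norm (z - root i))"
    by (rule hurwitz_factorization[OF assms]) blast
  define e where "e i = inverse (1 + (1 + norm (root i)) / (- Re (root i)))" for i
  have e: "0 < e i" if "i < degree p" for i
    unfolding e_def using r(1)[OF that]
    by (intro positive_imp_inverse_positive add_pos_nonneg divide_nonneg_nonneg) auto
  define c where "c = norm (lead_coeff p) * (\<Prod>i<degree p. e i)"
  have c: "0 < c" unfolding c_def using assms(2) e by (intro mult_pos_pos prod_pos) auto
  have "c * (1 + norm z) ^ degree p \<le> norm (poly p z)" if z: "0 \<le> Re z" for z
  proof -
    have "c * (1 + norm z) ^ degree p = norm (lead_coeff p) * (\<Prod>i<degree p. e i * (1 + norm z))"
      by (simp add: c_def prod.distrib)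
    also have "\<dots> \<le> norm (poly p z)" unfolding r(2)
    proof (intro mult_left_mono prod_mono conjI)
      fix i assume i: "i \<in> {..<degree p}"
      then show "0 \<le> e i * (1 + norm z)" using e[of i] by (simp add: less_imp_le)
      show "e i * (1 + norm z) \<le> norm (z - root i)"
        unfolding e_def using norm_diff_ge_of_Re_neg[OF r(1) z] i by auto
    qed auto
    finally show ?thesis .
  qed
  with c that show ?thesis by blast
qed

lemma hurwitz_norm_ge:
  assumes "hurwitz p" "p \<noteq> 0" "0 \<le> Re z"
  shows "norm (lead_coeff p) * Re z ^ degree p \<le> norm (poly p z)"
proof -
  obtain root where r: "\<And>i. i < degree p \<Longrightarrow> Re (root i) < 0"
    "\<And>z. norm (poly p z) = norm (lead_coeff p) * (\<Prod>i<degree p. norm (z - root i))"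
    by (rule hurwitz_factorization[OF assms(1,2)]) blast
  have "Re z ^ degree p = (\<Prod>i<degree p. Re z)" by simp
  also have "\<dots> \<le> (\<Prod>i<degree p. norm (z - root i))"
  proof (intro prod_mono conjI assms(3))
    fix i assume "i \<in> {..<degree p}"
    then have "Re z \<le> Re (z - root i)" using r(1)[of i] by simp
    also have "\<dots> \<le> norm (z - root i)" by (rule complex_Re_le_cmod)
    finally show "Re z \<le> norm (z - root i)" .
  qed
  finally show ?thesis unfolding r(2) by (intro mult_left_mono) auto
qed

text \<open>Hurwitz polynomials of degree \<open>D\<close> form an open set because on the closed right half plane they
  are bounded below by a multiple of \<open>(1 + |z|) ^ D\<close>; no root can escape the left half plane
  through infinity because the degree is constant, nor through the imaginary axis by assumption.\<close>

lemma hurwitz_homotopy: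
  fixes P :: "real \<Rightarrow> complex poly"
  assumes deg: "\<And>t. t \<in> {0..1} \<Longrightarrow> degree (P t) = D"
    and nz: "\<And>t. t \<in> {0..1} \<Longrightarrow> P t \<noteq> 0"
    and cont: "\<And>k. continuous_on {0..1} (\<lambda>t. coeff (P t) k)"
    and axis: "\<And>t s. t \<in> {0..1} \<Longrightarrow> Re s = 0 \<Longrightarrow> poly (P t) s \<noteq> 0"
    and start: "hurwitz (P 0)"
  shows "hurwitz (P 1)"
proof -
  have lim: "((\<lambda>u. coeff (P u) k) \<longlongrightarrow> coeff (P t) k) (at t within {0..1})" if "t \<in> {0..1}" for t k
    using cont[of k] that by (simp add: continuous_on_def)
  have alt: "poly (P t) z = (\<Sum>k\<le>D. coeff (P t) k * z ^ k)" if "t \<in> {0..1}" for t z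
    using deg[OF that] by (simp add: poly_altdef)
  have ev_in: "\<forall>\<^sub>F u in at t within {0..1}. u \<in> {0..1}" for t :: real
    by (simp add: eventually_at_topological) auto
  have "eventually (\<lambda>u. hurwitz (P t) = hurwitz (P u)) (at t within {0..1})" if t: "t \<in> {0..1}" for t
  proof (cases "hurwitz (P t)")
    case True
    obtain c where c: "0 < c" "\<And>z. 0 \<le> Re z \<Longrightarrow> c * (1 + norm z) ^ D \<le> norm (poly (P t) z)"
      using hurwitz_growth[OF True nz[OF t]] deg[OF t] by metis
    have "\<forall>\<^sub>F u in at t within {0..1}. \<forall>k\<in>{..D}. norm (coeff (P u) k - coeff (P t) k) < c / (D + 1)"
    proof (intro eventually_ball_finite ballI)
      fix k
      show "\<forall>\<^sub>F u in at t within {0..1}. norm (coeff (P u) k - coeff (P t) k) < c / (D + 1)"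
        using tendstoD[OF lim[OF t, of k], of "c / (D + 1)"] c by (simp add: dist_norm)
    qed simp
    then show ?thesis using ev_in
    proof eventually_elim
      case (elim u)
      have "hurwitz (P u)" unfolding hurwitz_def
      proof (intro allI impI, rule ccontr)
        fix z assume z: "poly (P u) z = 0" "\<not> Re z < 0"
        have "norm (poly (P t) z) = norm (\<Sum>k\<le>D. (coeff (P u) k - coeff (P t) k) * z ^ k)"
          using z alt[OF t, of z] alt[OF elim(2), of z]
          by (simp add: left_diff_distrib sum_subtractf norm_minus_commute)
        also have "\<dots> \<le> (\<Sum>k\<le>D. norm ((coeff (P u) k - coeff (P t) k) * z ^ k))"
          by (rule norm_sum)
        also have "\<dots> < (\<Sum>k\<le>D. c / (D + 1) * (1 + norm z) ^ D)"
        proof (intro sum_strict_mono)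
          fix k assume k: "k \<in> {..D}"
          have "norm z ^ k \<le> (1 + norm z) ^ k" by (intro power_mono) auto
          also have "\<dots> \<le> (1 + norm z) ^ D" using k by (intro power_increasing) auto
          finally have zk: "norm z ^ k \<le> (1 + norm z) ^ D" .
          have "norm ((coeff (P u) k - coeff (P t) k) * z ^ k)
              = norm (coeff (P u) k - coeff (P t) k) * norm z ^ k"
            by (simp add: norm_mult norm_power)
          also have "\<dots> \<le> norm (coeff (P u) k - coeff (P t) k) * (1 + norm z) ^ D"
            using zk by (intro mult_left_mono) auto
          also have "\<dots> < c / (D + 1) * (1 + norm z) ^ D"
            using elim(1) k by (intro mult_strict_right_mono zero_less_power add_pos_nonneg) auto
          finally show "norm ((coeff (P u) k - coeff (P t) k) * z ^ k) < c / (D + 1) * (1 + norm z) ^ D" .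
        qed auto
        also have "\<dots> = c * (1 + norm z) ^ D" by (simp add: field_simps)
        finally show False using c(2)[of z] z(2) by simp
      qed
      with True show ?case by simp
    qed
  next
    case False
    then obtain z where z: "poly (P t) z = 0" "0 < Re z"
      unfolding hurwitz_def using axis[OF t] by (metis linorder_neqE_linordered_idom)
    have "((\<lambda>u. norm (coeff (P u) D) * Re z ^ D - norm (\<Sum>k\<le>D. coeff (P u) k * z ^ k))
        \<longlongrightarrow> norm (coeff (P t) D) * Re z ^ D - norm (\<Sum>k\<le>D. coeff (P t) k * z ^ k)) (at t within {0..1})"
      by (intro tendsto_intros lim t)
    moreover have "0 < norm (coeff (P t) D) * Re z ^ D - norm (\<Sum>k\<le>D. coeff (P t) k * z ^ k)"
      using z alt[OF t, of z] deg[OF t] nz[OF t] by auto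
    ultimately have "\<forall>\<^sub>F u in at t within {0..1}.
        0 < norm (coeff (P u) D) * Re z ^ D - norm (\<Sum>k\<le>D. coeff (P u) k * z ^ k)"
      by (rule order_tendstoD)
    then show ?thesis using ev_in
    proof eventually_elim
      case (elim u)
      have "\<not> hurwitz (P u)"
        using hurwitz_norm_ge[of "P u" z] nz[OF elim(2)] deg[OF elim(2)] alt[OF elim(2), of z] elim(1) z(2)
        by auto
      with False show ?case by simp
    qed
  qed
  then have "hurwitz (P 0) = hurwitz (P 1)"
    by (intro connected_local_const[of "{0..1::real}" 0 1 "\<lambda>t. hurwitz (P t)"]) auto
  with start show ?thesis by simp
qed

section \<open>Proper stable transfer functions\<close>

abbreviation cpoly :: "real poly \<Rightarrow> complex poly" where
  "cpoly \<equiv> map_poly complex_of_real"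

lemma cpoly_mult: "cpoly (p * q) = cpoly p * cpoly q"
  by (rule poly_eqI) (simp add: coeff_map_poly coeff_mult)

lemma cpoly_pCons [simp]: "cpoly (pCons a p) = pCons (complex_of_real a) (cpoly p)"
  by (rule poly_eqI) (simp add: coeff_map_poly coeff_pCons split: nat.split)

lemma cpoly_add: "cpoly (p + q) = cpoly p + cpoly q"
  by (rule of_real_hom.map_poly_hom_add)

lemma cpoly_cnj: "poly (cpoly p) (cnj s) = cnj (poly (cpoly p) s)"
  by (induction p) auto

lemma hurwitz_mult: "hurwitz (p * q) \<longleftrightarrow> hurwitz p \<and> hurwitz q"
  by (auto simp: hurwitz_def)

lemma hurwitz_nonzero: "hurwitz (cpoly q) \<Longrightarrow> q \<noteq> 0"
  by (auto simp: hurwitz_def dest: spec[of _ 0])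

lemma quot_of_fract_cancel:
  fixes p q :: "real poly"
  assumes "q \<noteq> 0" and r: "r = to_fract p / to_fract q"
  obtains g where "g \<noteq> 0" "p = fst (quot_of_fract r) * g" "q = snd (quot_of_fract r) * g"
proof -
  define a b where "a = fst (quot_of_fract r)" and "b = snd (quot_of_fract r)"
  have b0: "b \<noteq> 0" by (simp add: b_def)
  have "Fraction_Field.Fract a b = Fraction_Field.Fract p q"
    using r by (simp add: a_def b_def Fract_conv_to_fract[of p q])
  then have e: "a * q = p * b" using b0 assms(1) by (simp add: eq_fract)
  have "coprime b a" using coprime_quot_of_fract[of r] by (simp add: a_def b_def coprime_commute)
  moreover have "b dvd a * q" using e by simp
  ultimately have "b dvd q" by (metis coprime_dvd_mult_right_iff)
  then obtain g where g: "q = b * g" by (elim dvdE)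
  then have "g \<noteq> 0" using assms(1) by auto
  moreover have "p = a * g" using e b0 unfolding g by (metis mult.assoc mult.commute mult_right_cancel)
  ultimately show ?thesis using that g unfolding a_def b_def by blast
qed

lemma tf_eval_quotient:
  assumes "poly (cpoly q) s \<noteq> 0"
  shows "tf_eval (to_fract p / to_fract q) s = poly (cpoly p) s / poly (cpoly q) s"
proof -
  have "q \<noteq> 0" using assms by auto
  then obtain g where g: "g \<noteq> 0"
    "p = fst (quot_of_fract (to_fract p / to_fract q)) * g"
    "q = snd (quot_of_fract (to_fract p / to_fract q)) * g"
    by (rule quot_of_fract_cancel[OF _ refl])
  have "poly (cpoly g) s \<noteq> 0" using assms by (subst (asm) g(3)) (simp add: cpoly_mult)
  then show ?thesis
    by (subst (2) g(2), subst (3) g(3)) (simp add: tf_eval_def cpoly_mult)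
qed

definition RH :: "tf set" where
  "RH = {r. tf_proper r \<and> tf_stable r}"

definition RH_quotient :: "real poly \<Rightarrow> real poly \<Rightarrow> bool" where
  "RH_quotient p q \<longleftrightarrow> hurwitz (cpoly q) \<and> degree p \<le> degree q"

lemma RH_iff: "r \<in> RH \<longleftrightarrow> (\<exists>p q. RH_quotient p q \<and> r = to_fract p / to_fract q)"
proof
  assume "r \<in> RH"
  moreover have "r = to_fract (fst (quot_of_fract r)) / to_fract (snd (quot_of_fract r))"
    by (simp add: Fract_conv_to_fract[symmetric])
  ultimately show "\<exists>p q. RH_quotient p q \<and> r = to_fract p / to_fract q"
    by (auto simp: RH_def RH_quotient_def tf_proper_def tf_stable_def hurwitz_def)
next
  assume "\<exists>p q. RH_quotient p q \<and> r = to_fract p / to_fract q"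
  then obtain p q where pq: "RH_quotient p q" and r: "r = to_fract p / to_fract q" by blast
  have q: "q \<noteq> 0" using pq by (auto simp: RH_quotient_def hurwitz_nonzero)
  define a b where "a = fst (quot_of_fract r)" and "b = snd (quot_of_fract r)"
  obtain g where g: "g \<noteq> 0" "p = a * g" "q = b * g"
    unfolding a_def b_def by (rule quot_of_fract_cancel[OF q r])
  have "degree a \<le> degree b"
  proof (cases "a = 0")
    case False
    moreover have "b \<noteq> 0" using g q by auto
    ultimately show ?thesis using pq g by (simp add: RH_quotient_def degree_mult_eq)
  qed simp
  moreover have "hurwitz (cpoly b)" using pq g by (simp add: RH_quotient_def cpoly_mult hurwitz_mult)
  ultimately show "r \<in> RH"
    by (simp add: RH_def tf_proper_def tf_stable_def hurwitz_def a_def b_def)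
qed

lemma RH_quotientI: "RH_quotient p q \<Longrightarrow> to_fract p / to_fract q \<in> RH"
  by (auto simp: RH_iff)

lemma RH_const [simp]: "tf_const c \<in> RH"
  using RH_quotientI[of "[:c:]" 1] by (simp add: tf_const_def RH_quotient_def hurwitz_def)

lemma tf_const_simps [simp]: "tf_const 0 = 0" "tf_const 1 = 1"
  "tf_const (a + b) = tf_const a + tf_const b" "tf_const (a * b) = tf_const a * tf_const b"
  "tf_const (- a) = - tf_const a"
  by (simp_all add: tf_const_def one_pCons[symmetric] flip: to_fract_add to_fract_mult to_fract_uminus)

lemma RH_0 [simp]: "0 \<in> RH" and RH_1 [simp]: "1 \<in> RH"
  using RH_const[of 0] RH_const[of 1] by simp_all

lemma RH_mult [simp]: assumes "r \<in> RH" "s \<in> RH" shows "r * s \<in> RH"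
proof -
  obtain p q p' q' where a: "RH_quotient p q" "r = to_fract p / to_fract q"
    "RH_quotient p' q'" "s = to_fract p' / to_fract q'" using assms RH_iff by meson
  have "RH_quotient (p * p') (q * q')"
    using a degree_mult_le[of p p'] hurwitz_nonzero[of q] hurwitz_nonzero[of q']
    by (auto simp: RH_quotient_def cpoly_mult hurwitz_mult degree_mult_eq)
  from RH_quotientI[OF this] show ?thesis using a by simp
qed

lemma RH_add [simp]: assumes "r \<in> RH" "s \<in> RH" shows "r + s \<in> RH"
proof -
  obtain p q p' q' where a: "RH_quotient p q" "r = to_fract p / to_fract q"
    "RH_quotient p' q'" "s = to_fract p' / to_fract q'" using assms RH_iff by meson
  have nz: "q \<noteq> 0" "q' \<noteq> 0" using a hurwitz_nonzero by (auto simp: RH_quotient_def)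
  have "degree (p * q' + p' * q) \<le> degree (q * q')"
    using a degree_mult_le[of p q'] degree_mult_le[of p' q] nz
    by (intro degree_add_le) (auto simp: RH_quotient_def degree_mult_eq)
  then have "RH_quotient (p * q' + p' * q) (q * q')"
    using a by (auto simp: RH_quotient_def cpoly_mult hurwitz_mult)
  from RH_quotientI[OF this] show ?thesis using a nz by (simp add: add_frac_eq)
qed

lemma RH_uminus [simp]: assumes "r \<in> RH" shows "- r \<in> RH"
proof -
  have "tf_const (-1) * r \<in> RH" using assms by (intro RH_mult RH_const)
  then show ?thesis by simp
qed

lemma RH_sum [intro]: "(\<And>i. i \<in> A \<Longrightarrow> f i \<in> RH) \<Longrightarrow> sum f A \<in> RH"
  by (induction A rule: infinite_finite_induct) auto

lemma RH_prod [intro]: "(\<And>i. i \<in> A \<Longrightarrow> f i \<in> RH) \<Longrightarrow> prod f A \<in> RH"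
  by (induction A rule: infinite_finite_induct) auto

lemma RH_common_denominator:
  assumes "finite A" "A \<subseteq> RH"
  obtains q where "hurwitz (cpoly q)" "\<And>r. r \<in> A \<Longrightarrow> \<exists>p. degree p \<le> degree q \<and> r = to_fract p / to_fract q"
proof -
  have "\<exists>q. hurwitz (cpoly q) \<and> (\<forall>r\<in>A. \<exists>p. degree p \<le> degree q \<and> r = to_fract p / to_fract q)"
    using assms
  proof (induction A)
    case empty
    show ?case by (intro exI[of _ 1]) (simp add: hurwitz_def)
  next
    case (insert s A)
    then obtain q where q: "hurwitz (cpoly q)" "\<And>r. r \<in> A \<Longrightarrow> \<exists>p. degree p \<le> degree q \<and> r = to_fract p / to_fract q"
      by auto
    obtain u v where uv: "RH_quotient u v" "s = to_fract u / to_fract v" using insert RH_iff by auto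
    have nz: "q \<noteq> 0" "v \<noteq> 0" using q uv hurwitz_nonzero by (auto simp: RH_quotient_def)
    have "\<exists>p. degree p \<le> degree (q * v) \<and> r = to_fract p / to_fract (q * v)" if "r \<in> insert s A" for r
    proof (cases "r = s")
      case True
      have "degree (u * q) \<le> degree (q * v)"
        using degree_mult_le[of u q] uv nz by (simp add: RH_quotient_def degree_mult_eq)
      then show ?thesis using uv nz True by (intro exI[of _ "u * q"]) simp
    next
      case False
      then have "r \<in> A" using that by simp
      from q(2)[OF this] obtain p where p: "degree p \<le> degree q" "r = to_fract p / to_fract q"
        by (elim exE conjE)
      have "degree (p * v) \<le> degree (q * v)"
        using degree_mult_le[of p v] p nz by (simp add: degree_mult_eq)
      then show ?thesis using p nz by (intro exI[of _ "p * v"]) simp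
    qed
    moreover have "hurwitz (cpoly (q * v))" using q uv by (simp add: cpoly_mult hurwitz_mult RH_quotient_def)
    ultimately show ?case by blast
  qed
  then show ?thesis using that by blast
qed

definition tf_at :: "ereal \<Rightarrow> tf \<Rightarrow> complex" where
  "tf_at w r = (if w = \<infinity> then Lim at_top (\<lambda>x. tf_eval r (\<i> * complex_of_real x))
                else tf_eval r (\<i> * complex_of_real (real_of_ereal w)))"

lemma freq_resp_eq: "freq_resp R w = map_mat (tf_at w) R"
  by (auto simp: freq_resp_def tf_at_def)

lemma tendsto_poly_over_power:
  assumes "degree p \<le> n"
  shows "((\<lambda>x. poly (cpoly p) (\<i> * complex_of_real x) / (\<i> * complex_of_real x) ^ n)
    \<longlongrightarrow> complex_of_real (coeff p n)) at_top"
  using assms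
proof (induction n arbitrary: p)
  case 0
  then obtain a where "p = [:a:]" by (metis degree_eq_zeroE le_zero_eq)
  then show ?case by simp
next
  case (Suc n)
  obtain a p' where p: "p = pCons a p'" by (cases p)
  have p': "degree p' \<le> n" using Suc.prems unfolding p by (cases "p' = 0") auto
  have l: "((\<lambda>x. complex_of_real a / \<i> ^ Suc n * complex_of_real (inverse (x ^ Suc n))) \<longlongrightarrow>
      complex_of_real a / \<i> ^ Suc n * complex_of_real 0) at_top"
    by (intro tendsto_intros tendsto_inverse_0_at_top filterlim_pow_at_top filterlim_ident) simp
  have "((\<lambda>x. complex_of_real a / \<i> ^ Suc n * complex_of_real (inverse (x ^ Suc n))
        + poly (cpoly p') (\<i> * complex_of_real x) / (\<i> * complex_of_real x) ^ n)
      \<longlongrightarrow> complex_of_real (coeff p (Suc n))) at_top"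
    using tendsto_add[OF l Suc.IH[OF p']] by (simp add: p)
  then show ?case
  proof (rule Lim_transform_eventually)
    show "\<forall>\<^sub>F x in at_top. complex_of_real a / \<i> ^ Suc n * complex_of_real (inverse (x ^ Suc n))
        + poly (cpoly p') (\<i> * complex_of_real x) / (\<i> * complex_of_real x) ^ n
        = poly (cpoly p) (\<i> * complex_of_real x) / (\<i> * complex_of_real x) ^ Suc n"
      using eventually_gt_at_top[of 0]
    proof eventually_elim
      case (elim x)
      then show ?case by (simp add: p add_divide_distrib power_mult_distrib inverse_eq_divide map_poly_pCons)
    qed
  qed
qed

lemma poly_hurwitz_nonzero: "hurwitz q \<Longrightarrow> 0 \<le> Re s \<Longrightarrow> poly q s \<noteq> 0"
  by (auto simp: hurwitz_def)

lemma tendsto_tf_eval_quotient: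
  assumes "RH_quotient p q"
  shows "((\<lambda>x. tf_eval (to_fract p / to_fract q) (\<i> * complex_of_real x))
    \<longlongrightarrow> complex_of_real (coeff p (degree q) / lead_coeff q)) at_top"
proof -
  have nz: "q \<noteq> 0" using assms hurwitz_nonzero by (auto simp: RH_quotient_def)
  have "((\<lambda>x. (poly (cpoly p) (\<i> * complex_of_real x) / (\<i> * complex_of_real x) ^ degree q) /
       (poly (cpoly q) (\<i> * complex_of_real x) / (\<i> * complex_of_real x) ^ degree q))
    \<longlongrightarrow> complex_of_real (coeff p (degree q)) / complex_of_real (lead_coeff q)) at_top"
    using assms nz by (intro tendsto_divide tendsto_poly_over_power) (auto simp: RH_quotient_def)
  then have "((\<lambda>x. (poly (cpoly p) (\<i> * complex_of_real x) / (\<i> * complex_of_real x) ^ degree q) /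
       (poly (cpoly q) (\<i> * complex_of_real x) / (\<i> * complex_of_real x) ^ degree q))
    \<longlongrightarrow> complex_of_real (coeff p (degree q) / lead_coeff q)) at_top" by simp
  then show ?thesis
  proof (rule Lim_transform_eventually)
    show "\<forall>\<^sub>F x in at_top. (poly (cpoly p) (\<i> * complex_of_real x) / (\<i> * complex_of_real x) ^ degree q) /
       (poly (cpoly q) (\<i> * complex_of_real x) / (\<i> * complex_of_real x) ^ degree q)
       = tf_eval (to_fract p / to_fract q) (\<i> * complex_of_real x)"
      using eventually_gt_at_top[of 0]
    proof eventually_elim
      case (elim x)
      have "poly (cpoly q) (\<i> * complex_of_real x) \<noteq> 0"
        using assms by (intro poly_hurwitz_nonzero) (auto simp: RH_quotient_def)
      then show ?case using elim by (simp add: tf_eval_quotient)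
    qed
  qed
qed

lemma tf_at_quotient:
  assumes "RH_quotient p q"
  shows "tf_at w (to_fract p / to_fract q) =
    (if w = \<infinity> then complex_of_real (coeff p (degree q) / lead_coeff q)
     else poly (cpoly p) (\<i> * complex_of_real (real_of_ereal w))
        / poly (cpoly q) (\<i> * complex_of_real (real_of_ereal w)))"
proof (cases "w = \<infinity>")
  case True
  then show ?thesis
    using tendsto_Lim[OF _ tendsto_tf_eval_quotient[OF assms]] by (simp add: tf_at_def)
next
  case False
  have "poly (cpoly q) (\<i> * complex_of_real (real_of_ereal w)) \<noteq> 0"
    using assms by (intro poly_hurwitz_nonzero) (auto simp: RH_quotient_def)
  with False show ?thesis by (simp add: tf_at_def tf_eval_quotient)
qed

lemma coeff_mult_degree_le:
  assumes "degree p \<le> m" "degree q \<le> n"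
  shows "coeff (p * q) (m + n) = coeff p m * coeff q n"
proof -
  have "coeff p i * coeff q (m + n - i) = 0" if "i \<le> m + n" "i \<noteq> m" for i
  proof (cases "i < m")
    case True
    then have "degree q < m + n - i" using assms by simp
    then show ?thesis by (simp add: coeff_eq_0)
  next
    case False
    then have "degree p < i" using assms that by simp
    then show ?thesis by (simp add: coeff_eq_0)
  qed
  then have "(\<Sum>i\<le>m + n. coeff p i * coeff q (m + n - i)) = (\<Sum>i\<in>{m}. coeff p i * coeff q (m + n - i))"
    by (intro sum.mono_neutral_right) auto
  then show ?thesis by (simp add: coeff_mult)
qed

lemma tf_at_const [simp]: "tf_at w (tf_const c) = complex_of_real c"
  using tf_at_quotient[of "[:c:]" 1 w] by (simp add: tf_const_def RH_quotient_def hurwitz_def)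

lemma tf_at_0 [simp]: "tf_at w 0 = 0" and tf_at_1 [simp]: "tf_at w 1 = 1"
  using tf_at_const[of w 0] tf_at_const[of w 1] by simp_all

lemma
  assumes "r \<in> RH" "s \<in> RH"
  shows tf_at_mult: "tf_at w (r * s) = tf_at w r * tf_at w s"
    and tf_at_add: "tf_at w (r + s) = tf_at w r + tf_at w s"
proof -
  obtain p q p' q' where a: "RH_quotient p q" "r = to_fract p / to_fract q"
    "RH_quotient p' q'" "s = to_fract p' / to_fract q'" using assms RH_iff by meson
  have nz: "q \<noteq> 0" "q' \<noteq> 0" using a hurwitz_nonzero by (auto simp: RH_quotient_def)
  have deg: "degree (q * q') = degree q + degree q'" using nz by (simp add: degree_mult_eq)
  have d: "degree p \<le> degree q" "degree p' \<le> degree q'" using a by (auto simp: RH_quotient_def)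
  have h: "hurwitz (cpoly (q * q'))" using a by (simp add: cpoly_mult hurwitz_mult RH_quotient_def)
  have m: "RH_quotient (p * p') (q * q')"
    using degree_mult_le[of p p'] d h by (auto simp: RH_quotient_def deg)
  have "degree (p * q' + p' * q) \<le> degree (q * q')"
    unfolding deg using degree_mult_le[of p q'] degree_mult_le[of p' q] d by (intro degree_add_le) auto
  then have ad: "RH_quotient (p * q' + p' * q) (q * q')" using h by (simp add: RH_quotient_def)
  have n0: "poly (cpoly q) (\<i> * complex_of_real x) \<noteq> 0" "poly (cpoly q') (\<i> * complex_of_real x) \<noteq> 0" for x
    using a by (intro poly_hurwitz_nonzero; simp add: RH_quotient_def)+
  have rs: "r * s = to_fract (p * p') / to_fract (q * q')"
    "r + s = to_fract (p * q' + p' * q) / to_fract (q * q')" using a nz by (simp_all add: add_frac_eq)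
  have c1: "coeff (p * p') (degree q + degree q') = coeff p (degree q) * coeff p' (degree q')"
    "coeff (q * q') (degree q + degree q') = lead_coeff q * lead_coeff q'"
    "coeff (p * q') (degree q + degree q') = coeff p (degree q) * lead_coeff q'"
    "coeff (p' * q) (degree q + degree q') = lead_coeff q * coeff p' (degree q')"
    using d coeff_mult_degree_le[of p "degree q" p' "degree q'"] coeff_mult_degree_le[of q "degree q" q' "degree q'"]
     coeff_mult_degree_le[of p "degree q" q' "degree q'"] coeff_mult_degree_le[of q "degree q" p' "degree q'"]
    by (auto simp: mult.commute)
  show "tf_at w (r * s) = tf_at w r * tf_at w s"
    unfolding rs tf_at_quotient[OF m]
    unfolding a tf_at_quotient[OF a(1)] tf_at_quotient[OF a(3)] deg c1 by (simp add: cpoly_mult)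
  have frac: "(x * b' + b * x') / (b * b') = x / b + x' / b'" if "b \<noteq> 0" "b' \<noteq> 0"
    for x x' b b' :: real using that by (simp add: add_frac_eq mult.commute)
  show "tf_at w (r + s) = tf_at w r + tf_at w s"
  proof (cases "w = \<infinity>")
    case True
    have "tf_at w (r + s) = complex_of_real (coeff p (degree q) / lead_coeff q
        + coeff p' (degree q') / lead_coeff q')"
      unfolding rs tf_at_quotient[OF ad] deg c1 coeff_add
      using frac[of "lead_coeff q" "lead_coeff q'"] nz True by simp
    then show ?thesis
      unfolding a tf_at_quotient[OF a(1)] tf_at_quotient[OF a(3)] using True by simp
  next
    case False
    then show ?thesis
      unfolding rs tf_at_quotient[OF ad]
      unfolding a tf_at_quotient[OF a(1)] tf_at_quotient[OF a(3)]
      using n0 by (simp add: cpoly_mult cpoly_add add_frac_eq)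
  qed
qed

lemma tf_at_sum:
  "(\<And>i. i \<in> A \<Longrightarrow> f i \<in> RH) \<Longrightarrow> tf_at w (sum f A) = (\<Sum>i\<in>A. tf_at w (f i))"
  by (induction A rule: infinite_finite_induct) (auto simp: tf_at_add RH_sum)

definition RH_mat :: "tf mat \<Rightarrow> bool" where
  "RH_mat R \<longleftrightarrow> (\<forall>i<dim_row R. \<forall>j<dim_col R. R $$ (i, j) \<in> RH)"

lemma RH_inf_iff: "R \<in> RH_inf m \<longleftrightarrow> R \<in> carrier_mat m m \<and> RH_mat R"
  by (auto simp: RH_inf_def RH_def RH_mat_def)

lemma RH_mat_mult:
  assumes "A \<in> carrier_mat a b" "B \<in> carrier_mat b c" "RH_mat A" "RH_mat B"
  shows "RH_mat (A * B)"
  unfolding RH_mat_def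
proof (intro allI impI)
  fix i j assume "i < dim_row (A * B)" "j < dim_col (A * B)"
  then have ij: "i < a" "j < c" using assms by auto
  have "(A * B) $$ (i, j) = (\<Sum>k = 0..<b. A $$ (i, k) * B $$ (k, j))"
    using assms(1,2) ij by (simp add: scalar_prod_def)
  also have "\<dots> \<in> RH"
    using assms ij by (intro RH_sum RH_mult) (simp_all add: RH_mat_def)
  finally show "(A * B) $$ (i, j) \<in> RH" .
qed

lemma RH_mat_const [simp]: "RH_mat (map_mat tf_const A)"
  by (simp add: RH_mat_def)

lemma tf_at_mat_mult:
  assumes "A \<in> carrier_mat a b" "B \<in> carrier_mat b c" "RH_mat A" "RH_mat B"
  shows "map_mat (tf_at w) (A * B) = map_mat (tf_at w) A * map_mat (tf_at w) B"
proof (rule eq_matI)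
  fix i j assume "i < dim_row (map_mat (tf_at w) A * map_mat (tf_at w) B)"
    "j < dim_col (map_mat (tf_at w) A * map_mat (tf_at w) B)"
  then have ij: "i < a" "j < c" using assms(1,2) by auto
  then have "tf_at w (\<Sum>k = 0..<b. A $$ (i, k) * B $$ (k, j))
      = (\<Sum>k = 0..<b. tf_at w (A $$ (i, k)) * tf_at w (B $$ (k, j)))"
    using assms by (subst tf_at_sum) (simp_all add: RH_mat_def tf_at_mult)
  then show "map_mat (tf_at w) (A * B) $$ (i, j) = (map_mat (tf_at w) A * map_mat (tf_at w) B) $$ (i, j)"
    using assms(1,2) ij by (simp add: scalar_prod_def)
qed (use assms(1,2) in auto)

section \<open>Inverse matrices\<close>

lemma det_nonzero_imp_inverse:
  fixes A :: "'a::field mat"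
  assumes A: "A \<in> carrier_mat n n" and d: "det A \<noteq> 0"
  defines "B \<equiv> inverse (det A) \<cdot>\<^sub>m adj_mat A"
  shows "B \<in> carrier_mat n n" "A * B = 1\<^sub>m n" "B * A = 1\<^sub>m n"
proof -
  show B: "B \<in> carrier_mat n n" using adj_mat(1)[OF A] by (simp add: B_def)
  have "A * B = inverse (det A) \<cdot>\<^sub>m (A * adj_mat A)"
    unfolding B_def by (rule mult_smult_distrib[OF A adj_mat(1)[OF A]])
  also have "\<dots> = 1\<^sub>m n"
    by (rule eq_matI) (use d in \<open>auto simp: adj_mat(2)[OF A]\<close>)
  finally show "A * B = 1\<^sub>m n" .
  have "B * A = inverse (det A) \<cdot>\<^sub>m (adj_mat A * A)"
    unfolding B_def by (rule mult_smult_assoc_mat[OF adj_mat(1)[OF A] A])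
  also have "\<dots> = 1\<^sub>m n"
    by (rule eq_matI) (use d in \<open>auto simp: adj_mat(3)[OF A]\<close>)
  finally show "B * A = 1\<^sub>m n" .
qed

lemma invertible_matI:
  assumes "A \<in> carrier_mat n n" "B \<in> carrier_mat n n" "A * B = 1\<^sub>m n" "B * A = 1\<^sub>m n"
  shows "invertible_mat A"
  using assms unfolding invertible_mat_def inverts_mat_def by auto

lemma mat_inv_eqI:
  fixes A :: "'a::field mat"
  assumes A: "A \<in> carrier_mat n n" and B: "B \<in> carrier_mat n n" and AB: "A * B = 1\<^sub>m n" "B * A = 1\<^sub>m n"
  shows "mat_inv A = B"
proof -
  note i = mat_inv[OF A invertible_matI[OF A B AB]]
  have "mat_inv A = mat_inv A * (A * B)" using i AB by simp
  also have "\<dots> = mat_inv A * A * B" by (rule assoc_mult_mat[OF i(1) A B, symmetric])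
  also have "\<dots> = B" using i B by simp
  finally show ?thesis .
qed

lemma invertible_imp_det_nonzero:
  fixes A :: "'a::field mat"
  assumes A: "A \<in> carrier_mat n n" and inv: "invertible_mat A"
  shows "det A \<noteq> 0"
proof -
  note i = mat_inv[OF A inv]
  have "det A * det (mat_inv A) = 1" using det_mult[OF A i(1)] i(2) by simp
  then show ?thesis by auto
qed

section \<open>Hermitian forms\<close>

definition sqn :: "complex vec \<Rightarrow> real" where
  "sqn x = (\<Sum>i<dim_vec x. (cmod (x $ i))\<^sup>2)"

lemma sqn_nonneg: "0 \<le> sqn x"
  by (simp add: sqn_def sum_nonneg)

lemma sqn_eq_0_iff: "x \<in> carrier_vec n \<Longrightarrow> sqn x = 0 \<longleftrightarrow> x = 0\<^sub>v n"
  by (auto simp: sqn_def sum_nonneg_eq_0_iff)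

lemma sqn_pos: "x \<in> carrier_vec n \<Longrightarrow> x \<noteq> 0\<^sub>v n \<Longrightarrow> 0 < sqn x"
  using sqn_nonneg[of x] sqn_eq_0_iff[of x n] by linarith

lemma mult_mat_vec_nth:
  "A \<in> carrier_mat n m \<Longrightarrow> x \<in> carrier_vec m \<Longrightarrow> i < n \<Longrightarrow> (A *\<^sub>v x) $ i = (\<Sum>j<m. A $$ (i, j) * x $ j)"
  by (auto simp: scalar_prod_def atLeast0LessThan intro!: sum.cong)

lemma cscalar_prod_sum:
  fixes x y :: "complex vec"
  shows "y \<in> carrier_vec n \<Longrightarrow> x \<bullet>c y = (\<Sum>i<n. x $ i * cnj (y $ i))"
  by (auto simp: scalar_prod_def atLeast0LessThan intro!: sum.cong)

lemma cscalar_prod_self: "x \<bullet>c x = complex_of_real (sqn x)"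
  by (simp add: cscalar_prod_sum[of x "dim_vec x"] sqn_def complex_norm_square del: of_real_power)

lemma cscalar_prod_commute:
  fixes x y :: "complex vec"
  shows "x \<in> carrier_vec n \<Longrightarrow> y \<in> carrier_vec n \<Longrightarrow> y \<bullet>c x = cnj (x \<bullet>c y)"
  by (simp add: cscalar_prod_sum[of _ n] mult.commute)

lemma norm_cscalar_prod_le:
  assumes "x \<in> carrier_vec n" "y \<in> carrier_vec n" "0 < s"
  shows "2 * s * cmod (x \<bullet>c y) \<le> sqn x + s\<^sup>2 * sqn y"
proof -
  have "2 * s * cmod (x \<bullet>c y) \<le> 2 * s * (\<Sum>i<n. cmod (x $ i * cnj (y $ i)))"
    using assms by (intro mult_left_mono) (simp_all add: cscalar_prod_sum norm_sum)
  also have "\<dots> = (\<Sum>i<n. 2 * s * cmod (x $ i * cnj (y $ i)))" by (rule sum_distrib_left)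
  also have "\<dots> \<le> (\<Sum>i<n. (cmod (x $ i))\<^sup>2 + s\<^sup>2 * (cmod (y $ i))\<^sup>2)"
  proof (rule sum_mono)
    fix i
    have "0 \<le> (cmod (x $ i) - s * cmod (y $ i))\<^sup>2" by simp
    also have "\<dots> = (cmod (x $ i))\<^sup>2 + s\<^sup>2 * (cmod (y $ i))\<^sup>2 - 2 * s * (cmod (x $ i) * cmod (y $ i))"
      by (simp add: power2_diff power_mult_distrib)
    finally show "2 * s * cmod (x $ i * cnj (y $ i)) \<le> (cmod (x $ i))\<^sup>2 + s\<^sup>2 * (cmod (y $ i))\<^sup>2"
      by (simp add: norm_mult)
  qed
  also have "\<dots> = sqn x + s\<^sup>2 * sqn y"
    using assms by (simp add: sqn_def sum.distrib sum_distrib_left)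
  finally show ?thesis .
qed

lemma sqn_mult_le:
  assumes A: "A \<in> carrier_mat n m"
  obtains C where "0 < C" "\<And>x. x \<in> carrier_vec m \<Longrightarrow> sqn (A *\<^sub>v x) \<le> C * sqn x"
proof -
  define C where "C = 1 + (\<Sum>i<n. (\<Sum>j<m. cmod (A $$ (i, j)))\<^sup>2)"
  have C: "0 < C" unfolding C_def by (intro add_pos_nonneg sum_nonneg) auto
  have "sqn (A *\<^sub>v x) \<le> C * sqn x" if x: "x \<in> carrier_vec m" for x
  proof -
    have xj: "cmod (x $ j) \<le> sqrt (sqn x)" if "j < m" for j
    proof (rule real_le_rsqrt)
      show "(cmod (x $ j))\<^sup>2 \<le> sqn x"
        unfolding sqn_def using x that by (intro member_le_sum) auto
    qed
    have "sqn (A *\<^sub>v x) = (\<Sum>i<n. (cmod (\<Sum>j<m. A $$ (i, j) * x $ j))\<^sup>2)"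
      using A x by (simp add: sqn_def mult_mat_vec_nth del: index_mult_mat_vec)
    also have "\<dots> \<le> (\<Sum>i<n. ((\<Sum>j<m. cmod (A $$ (i, j))) * sqrt (sqn x))\<^sup>2)"
    proof (intro sum_mono power_mono)
      fix i
      have "cmod (\<Sum>j<m. A $$ (i, j) * x $ j) \<le> (\<Sum>j<m. cmod (A $$ (i, j)) * cmod (x $ j))"
        by (rule order_trans[OF norm_sum]) (simp add: norm_mult)
      also have "\<dots> \<le> (\<Sum>j<m. cmod (A $$ (i, j)) * sqrt (sqn x))"
        using xj by (intro sum_mono mult_left_mono) auto
      finally show "cmod (\<Sum>j<m. A $$ (i, j) * x $ j) \<le> (\<Sum>j<m. cmod (A $$ (i, j))) * sqrt (sqn x)"
        by (simp add: sum_distrib_right)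
    qed auto
    also have "\<dots> = (\<Sum>i<n. (\<Sum>j<m. cmod (A $$ (i, j)))\<^sup>2) * sqn x"
      by (simp add: power_mult_distrib sqn_nonneg flip: sum_distrib_right)
    also have "\<dots> \<le> C * sqn x" using sqn_nonneg[of x] by (simp add: C_def distrib_right)
    finally show ?thesis .
  qed
  with C that show ?thesis by blast
qed

lemma mat_adjoint_dim [simp]:
  "dim_row (mat_adjoint A) = dim_col A" "dim_col (mat_adjoint A) = dim_row A"
  by (auto simp: mat_adjoint_def)

lemma mat_adjoint_carrier [simp]: "A \<in> carrier_mat n m \<Longrightarrow> mat_adjoint A \<in> carrier_mat m n"
  by (metis carrier_matD carrier_matI mat_adjoint_dim)

lemma mat_adjoint_index [simp]:
  "i < dim_col A \<Longrightarrow> j < dim_row A \<Longrightarrow> mat_adjoint A $$ (i, j) = conjugate (A $$ (j, i))"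
  by (simp add: mat_adjoint_def mat_of_rows_index)

lemma mat_adjoint_adjoint [simp]: "mat_adjoint (mat_adjoint A) = A"
  by (rule eq_matI) auto

lemma cscalar_prod_adjoint:
  fixes A :: "complex mat"
  assumes A: "A \<in> carrier_mat n m" and x: "x \<in> carrier_vec m" and y: "y \<in> carrier_vec n"
  shows "(A *\<^sub>v x) \<bullet>c y = x \<bullet>c (mat_adjoint A *\<^sub>v y)"
proof -
  have "(A *\<^sub>v x) \<bullet>c y = (\<Sum>i<n. \<Sum>j<m. A $$ (i, j) * x $ j * cnj (y $ i))"
    using A x y
    by (simp add: cscalar_prod_sum mult_mat_vec_nth sum_distrib_right del: index_mult_mat_vec)
  also have "\<dots> = (\<Sum>j<m. \<Sum>i<n. A $$ (i, j) * x $ j * cnj (y $ i))"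
    by (rule sum.swap)
  also have "\<dots> = (\<Sum>j<m. x $ j * cnj ((mat_adjoint A *\<^sub>v y) $ j))"
    using A y mult_mat_vec_nth[OF mat_adjoint_carrier[OF A] y]
    by (intro sum.cong) (auto simp: sum_distrib_left mult_ac simp del: index_mult_mat_vec)
  also have "\<dots> = x \<bullet>c (mat_adjoint A *\<^sub>v y)"
    using mult_mat_vec_carrier[OF mat_adjoint_carrier[OF A] y] by (rule cscalar_prod_sum[symmetric])
  finally show ?thesis .
qed

definition quad :: "complex mat \<Rightarrow> complex vec \<Rightarrow> real" where
  "quad A x = Re ((A *\<^sub>v x) \<bullet>c x)"

definition psd :: "complex mat \<Rightarrow> bool" where
  "psd A \<longleftrightarrow> mat_adjoint A = A \<and> (\<forall>x\<in>carrier_vec (dim_row A). 0 \<le> quad A x)"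

lemma quad_le:
  assumes A: "A \<in> carrier_mat n n"
  obtains C where "0 < C" "\<And>x. x \<in> carrier_vec n \<Longrightarrow> quad A x \<le> C * sqn x"
proof -
  obtain C where C: "0 < C" "\<And>x. x \<in> carrier_vec n \<Longrightarrow> sqn (A *\<^sub>v x) \<le> C * sqn x"
    using sqn_mult_le[OF A] by blast
  have "quad A x \<le> ((C + 1) / 2) * sqn x" if "x \<in> carrier_vec n" for x
  proof -
    have "quad A x \<le> cmod ((A *\<^sub>v x) \<bullet>c x)" unfolding quad_def by (rule complex_Re_le_cmod)
    also have "\<dots> \<le> (sqn (A *\<^sub>v x) + sqn x) / 2"
      using norm_cscalar_prod_le[of "A *\<^sub>v x" n x 1] A that by simp
    also have "\<dots> \<le> ((C + 1) / 2) * sqn x" using C(2)[OF that] by (simp add: field_simps)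
    finally show ?thesis .
  qed
  with C(1) that[of "(C + 1) / 2"] show ?thesis by simp
qed

text \<open>Evaluating the form at \<open>x - A x / C\<close> replaces the Cauchy-Schwarz inequality for \<open>A\<close>.\<close>

lemma psd_sqn_le_quad:
  assumes A: "A \<in> carrier_mat n n" and psd: "psd A"
  obtains C where "0 < C" "\<And>x. x \<in> carrier_vec n \<Longrightarrow> sqn (A *\<^sub>v x) \<le> C * quad A x"
proof -
  obtain C where C: "0 < C" "\<And>x. x \<in> carrier_vec n \<Longrightarrow> quad A x \<le> C * sqn x"
    using quad_le[OF A] by blast
  have "sqn (A *\<^sub>v x) \<le> C * quad A x" if x: "x \<in> carrier_vec n" for x
  proof -
    define y where "y = A *\<^sub>v x"
    have y: "y \<in> carrier_vec n" using A x by (simp add: y_def)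
    define z where "z = x - complex_of_real (1 / C) \<cdot>\<^sub>v y"
    have z: "z \<in> carrier_vec n" using x y by (simp add: z_def)
    have adj: "(A *\<^sub>v y) \<bullet>c x = complex_of_real (sqn y)"
      using cscalar_prod_adjoint[OF A y x] psd by (simp add: psd_def y_def[symmetric] cscalar_prod_self)
    have Az: "A *\<^sub>v z = y - complex_of_real (1 / C) \<cdot>\<^sub>v (A *\<^sub>v y)"
      unfolding z_def using A x y
      by (simp add: mult_minus_distrib_mat_vec mult_mat_vec[symmetric] y_def[symmetric])
    have "(A *\<^sub>v z) \<bullet>c z = (\<Sum>i<n. (y $ i - complex_of_real (1 / C) * (A *\<^sub>v y) $ i)
        * cnj (x $ i - complex_of_real (1 / C) * y $ i))"
      unfolding Az using A x y by (simp add: cscalar_prod_sum[of _ n] z_def del: index_mult_mat_vec)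
    also have "\<dots> = y \<bullet>c x - complex_of_real (1 / C) * (y \<bullet>c y)
        - complex_of_real (1 / C) * ((A *\<^sub>v y) \<bullet>c x) + complex_of_real (1 / C\<^sup>2) * ((A *\<^sub>v y) \<bullet>c y)"
      using A x y by (simp add: cscalar_prod_sum[of _ n] sum_distrib_left algebra_simps power2_eq_square
          sum.distrib sum_subtractf del: index_mult_mat_vec)
    finally have "quad A z = quad A x - 2 / C * sqn y + quad A y / C\<^sup>2"
      unfolding quad_def adj cscalar_prod_self y_def[symmetric] by simp
    moreover have "0 \<le> quad A z" using psd z A by (simp add: psd_def)
    moreover have "quad A y / C\<^sup>2 \<le> sqn y / C"
      using C(2)[OF y] C(1) by (simp add: field_simps power2_eq_square)
    ultimately have "sqn y / C \<le> quad A x" by simp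
    then show ?thesis using C(1) by (simp add: y_def field_simps)
  qed
  with C(1) that show ?thesis by blast
qed

lemma invertible_imp_sqn_le:
  assumes A: "A \<in> carrier_mat n n" and "det A \<noteq> 0"
  obtains C where "0 < C" "\<And>x. x \<in> carrier_vec n \<Longrightarrow> sqn x \<le> C * sqn (A *\<^sub>v x)"
proof -
  define B where "B = inverse (det A) \<cdot>\<^sub>m adj_mat A"
  have B: "B \<in> carrier_mat n n" and BA: "B * A = 1\<^sub>m n"
    unfolding B_def by (rule det_nonzero_imp_inverse[OF assms])+
  obtain C where C: "0 < C" "\<And>x. x \<in> carrier_vec n \<Longrightarrow> sqn (B *\<^sub>v x) \<le> C * sqn x"
    using sqn_mult_le[OF B] by blast
  have "sqn x \<le> C * sqn (A *\<^sub>v x)" if "x \<in> carrier_vec n" for x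
  proof -
    have "B *\<^sub>v (A *\<^sub>v x) = x" using assoc_mult_mat_vec[OF B A that] BA that by simp
    then show ?thesis using C(2)[of "A *\<^sub>v x"] A that by simp
  qed
  with C(1) that show ?thesis by blast
qed

lemma psd_invertible_coercive:
  assumes A: "A \<in> carrier_mat n n" and "psd A" "det A \<noteq> 0"
  obtains d where "0 < d" "\<And>x. x \<in> carrier_vec n \<Longrightarrow> d * sqn x \<le> quad A x"
proof -
  obtain C where C: "0 < C" "\<And>x. x \<in> carrier_vec n \<Longrightarrow> sqn (A *\<^sub>v x) \<le> C * quad A x"
    using psd_sqn_le_quad[OF assms(1,2)] by blast
  obtain E where E: "0 < E" "\<And>x. x \<in> carrier_vec n \<Longrightarrow> sqn x \<le> E * sqn (A *\<^sub>v x)"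
    using invertible_imp_sqn_le[OF assms(1,3)] by blast
  have "1 / (C * E) * sqn x \<le> quad A x" if "x \<in> carrier_vec n" for x
  proof -
    have "sqn x \<le> E * (C * quad A x)"
      using E(2)[OF that] mult_left_mono[OF C(2)[OF that], of E] E(1) by linarith
    then show ?thesis using C E by (simp add: field_simps)
  qed
  with C(1) E(1) that[of "1 / (C * E)"] show ?thesis by simp
qed

text \<open>The eigenvalue is the least \<open>t\<close> for which \<open>t - M\<close> is positive semidefinite: if \<open>t - M\<close> were
  invertible it would be coercive and \<open>t\<close> could be decreased.\<close>

lemma hermitian_max_eigenvalue:
  assumes M: "M \<in> carrier_mat n n" and herm: "mat_adjoint M = M" and n: "0 < n"
  obtains t :: real where "eigenvalue M (complex_of_real t)"
    "\<And>x. x \<in> carrier_vec n \<Longrightarrow> quad M x \<le> t * sqn x"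
proof -
  define T where "T = {t. \<forall>x\<in>carrier_vec n. quad M x \<le> t * sqn x}"
  obtain C where "0 < C" "\<And>x. x \<in> carrier_vec n \<Longrightarrow> quad M x \<le> C * sqn x"
    using quad_le[OF M] by blast
  then have ne: "C \<in> T" by (simp add: T_def)
  define e :: "complex vec" where "e = unit_vec n 0"
  have e: "e \<in> carrier_vec n" "e \<noteq> 0\<^sub>v n" using n by (auto simp: e_def)
  note se = sqn_pos[OF e]
  have lb: "quad M e / sqn e \<le> t" if "t \<in> T" for t
    using that e(1) se by (simp add: T_def field_simps)
  then have bdd: "bdd_below T" by (auto simp: bdd_below_def)
  define t where "t = Inf T"
  have tT: "quad M x \<le> t * sqn x" if x: "x \<in> carrier_vec n" for x
  proof (cases "sqn x = 0")
    case True
    then show ?thesis using ne x by (auto simp: T_def)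
  next
    case False
    then have sx: "0 < sqn x" using sqn_nonneg[of x] by linarith
    have "quad M x / sqn x \<le> t" unfolding t_def
      using ne x sx by (intro cInf_greatest) (auto simp: T_def field_simps)
    then show ?thesis using sx by (simp add: field_simps)
  qed
  define A where "A = complex_of_real t \<cdot>\<^sub>m 1\<^sub>m n - M"
  have A: "A \<in> carrier_mat n n" unfolding A_def using M by (rule minus_carrier_mat)
  have Ax: "A *\<^sub>v x = complex_of_real t \<cdot>\<^sub>v x - M *\<^sub>v x" if "x \<in> carrier_vec n" for x
    unfolding A_def using M that
    by (subst minus_mult_distrib_mat_vec[of _ n n]) (auto intro!: eq_vecI)
  have qA: "quad A x = t * sqn x - quad M x" if x: "x \<in> carrier_vec n" for x
  proof -
    have "(A *\<^sub>v x) \<bullet>c x = complex_of_real t * (x \<bullet>c x) - (M *\<^sub>v x) \<bullet>c x"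
      unfolding Ax[OF x] using M x
      by (simp add: cscalar_prod_sum[of _ n] sum_distrib_left left_diff_distrib sum_subtractf mult.assoc
          del: index_mult_mat_vec)
    then show ?thesis by (simp add: quad_def cscalar_prod_self)
  qed
  have cM: "cnj (M $$ (j, i)) = M $$ (i, j)" if "i < n" "j < n" for i j
    using arg_cong[OF herm, of "\<lambda>B. B $$ (i, j)"] M that by simp
  have "mat_adjoint A = A"
    by (rule eq_matI) (use M cM in \<open>auto simp: A_def\<close>)
  then have psdA: "psd A" using A qA tT by (simp add: psd_def)
  have "det A = 0"
  proof (rule ccontr)
    assume "det A \<noteq> 0"
    then obtain d where d: "0 < d" "\<And>x. x \<in> carrier_vec n \<Longrightarrow> d * sqn x \<le> quad A x"
      using psd_invertible_coercive[OF A psdA] by blast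
    have "t - d \<in> T" unfolding T_def
    proof (intro CollectI ballI)
      fix x :: "complex vec" assume x: "x \<in> carrier_vec n"
      show "quad M x \<le> (t - d) * sqn x"
        using d(2)[OF x] qA[OF x] by (simp add: left_diff_distrib)
    qed
    then have "t \<le> t - d" unfolding t_def using bdd by (rule cInf_lower)
    with d show False by simp
  qed
  then obtain v where v: "v \<in> carrier_vec n" "v \<noteq> 0\<^sub>v n" "A *\<^sub>v v = 0\<^sub>v n"
    using det_0_iff_vec_prod_zero[OF A] by blast
  have "M *\<^sub>v v = complex_of_real t \<cdot>\<^sub>v v"
  proof (rule eq_vecI)
    fix i assume "i < dim_vec (complex_of_real t \<cdot>\<^sub>v v)"
    then have i: "i < n" using v by simp
    have "(complex_of_real t \<cdot>\<^sub>v v - M *\<^sub>v v) $ i = 0" using v(3) Ax[OF v(1)] i by simp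
    then show "(M *\<^sub>v v) $ i = (complex_of_real t \<cdot>\<^sub>v v) $ i"
      using v M i by (simp del: index_mult_mat_vec)
  qed (use M v in auto)
  then have "eigenvalue M (complex_of_real t)"
    using v M by (auto simp: eigenvalue_def eigenvector_def)
  with tT that show ?thesis by blast
qed

section \<open>Determinants of stable transfer matrices\<close>

lemma cpoly_smult [simp]: "cpoly (Polynomial.smult a p) = Polynomial.smult (complex_of_real a) (cpoly p)"
  by (rule poly_eqI) (simp add: coeff_map_poly)

lemma comm_ring_hom_poly_cpoly: "comm_ring_hom (\<lambda>p. poly (cpoly p) s)"
  by unfold_locales (simp_all add: cpoly_add cpoly_mult)

lemma comm_ring_hom_to_fract: "comm_ring_hom (to_fract :: 'a::idom \<Rightarrow> 'a fract)"
  by unfold_locales simp_all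

lemma coeff_signof_mult: "coeff (signof \<pi> * p) k = signof \<pi> * coeff p k" for p :: "real poly"
  by (cases "sign \<pi> = 1") (auto simp: sign_def)

lemma coeff_prod_degree_le:
  fixes f :: "nat \<Rightarrow> real poly"
  assumes "\<And>i. i < n \<Longrightarrow> degree (f i) \<le> m"
  shows "degree (\<Prod>i = 0..<n. f i) \<le> n * m \<and>
    coeff (\<Prod>i = 0..<n. f i) (n * m) = (\<Prod>i = 0..<n. coeff (f i) m)"
  using assms
proof (induction n)
  case (Suc n)
  have IH: "degree (\<Prod>i = 0..<n. f i) \<le> n * m"
    "coeff (\<Prod>i = 0..<n. f i) (n * m) = (\<Prod>i = 0..<n. coeff (f i) m)" using Suc by auto
  have fn: "degree (f n) \<le> m" using Suc.prems by simp
  have "degree ((\<Prod>i = 0..<n. f i) * f n) \<le> n * m + m"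
    using degree_mult_le[of "\<Prod>i = 0..<n. f i" "f n"] IH(1) fn by linarith
  moreover have "coeff ((\<Prod>i = 0..<n. f i) * f n) (n * m + m) = (\<Prod>i = 0..<n. coeff (f i) m) * coeff (f n) m"
    using coeff_mult_degree_le[OF IH(1) fn] IH(2) by simp
  ultimately show ?case by (simp add: add.commute)
qed simp

lemma
  fixes A :: "real poly mat"
  assumes A: "A \<in> carrier_mat n n" and deg: "\<And>i j. i < n \<Longrightarrow> j < n \<Longrightarrow> degree (A $$ (i, j)) \<le> m"
  shows degree_det_le: "degree (det A) \<le> n * m"
    and coeff_det: "coeff (det A) (n * m) = det (map_mat (\<lambda>p. coeff p m) A)"
proof -
  have perm: "\<pi> i < n" if "\<pi> permutes {0..<n}" "i < n" for \<pi> i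
    using permutes_in_image[OF that(1), of i] that(2) by simp
  have *: "degree (\<Prod>i = 0..<n. A $$ (i, \<pi> i)) \<le> n * m \<and>
    coeff (\<Prod>i = 0..<n. A $$ (i, \<pi> i)) (n * m) = (\<Prod>i = 0..<n. coeff (A $$ (i, \<pi> i)) m)"
    if "\<pi> permutes {0..<n}" for \<pi>
    using deg perm[OF that] by (intro coeff_prod_degree_le) blast
  have fin: "finite {\<pi>. \<pi> permutes {0..<n}}" by (simp add: finite_permutations)
  show "degree (det A) \<le> n * m"
    unfolding det_def'[OF A]
  proof (intro degree_sum_le fin)
    fix \<pi> assume "\<pi> \<in> {\<pi>. \<pi> permutes {0..<n}}"
    then have "degree (\<Prod>i = 0..<n. A $$ (i, \<pi> i)) \<le> n * m" using * by blast
    then show "degree (signof \<pi> * (\<Prod>i = 0..<n. A $$ (i, \<pi> i))) \<le> n * m"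
      by (cases "sign \<pi> = 1") (auto simp: sign_def)
  qed
  have mA: "map_mat (\<lambda>p. coeff p m) A \<in> carrier_mat n n" using A by simp
  show "coeff (det A) (n * m) = det (map_mat (\<lambda>p. coeff p m) A)"
    unfolding det_def'[OF A] det_def'[OF mA] coeff_sum coeff_signof_mult
    using * perm A by (intro sum.cong refl) (auto intro!: prod.cong)
qed

lemma continuous_on_coeff_prod:
  fixes f :: "real \<Rightarrow> 'i \<Rightarrow> real poly"
  assumes "\<And>i k. i \<in> I \<Longrightarrow> continuous_on T (\<lambda>t. coeff (f t i) k)"
  shows "continuous_on T (\<lambda>t. coeff (\<Prod>i\<in>I. f t i) k)"
  using assms
proof (induction I arbitrary: k rule: infinite_finite_induct)
  case (insert i I)
  have "continuous_on T (\<lambda>t. \<Sum>l\<le>k. coeff (f t i) l * coeff (\<Prod>i\<in>I. f t i) (k - l))"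
    using insert by (intro continuous_intros) auto
  then show ?case using insert by (simp add: coeff_mult)
qed auto

lemma continuous_on_coeff_det:
  fixes A :: "real \<Rightarrow> real poly mat"
  assumes A: "\<And>t. A t \<in> carrier_mat n n"
    and c: "\<And>i j k. i < n \<Longrightarrow> j < n \<Longrightarrow> continuous_on T (\<lambda>t. coeff (A t $$ (i, j)) k)"
  shows "continuous_on T (\<lambda>t. coeff (det (A t)) k)"
proof -
  have "continuous_on T (\<lambda>t. \<Sum>\<pi> | \<pi> permutes {0..<n}.
      signof \<pi> * coeff (\<Prod>i = 0..<n. A t $$ (i, \<pi> i)) k)"
  proof (intro continuous_intros continuous_on_coeff_prod)
    fix \<pi> i k assume "\<pi> \<in> {\<pi>. \<pi> permutes {0..<n}}" "i \<in> {0..<n}"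
    then show "continuous_on T (\<lambda>t. coeff (A t $$ (i, \<pi> i)) k)"
      using permutes_in_image[of \<pi> "{0..<n}" i] by (intro c) auto
  qed
  then show ?thesis by (simp add: det_def'[OF A] coeff_sum coeff_signof_mult)
qed

text \<open>Clearing the common denominator \<open>q\<close> of \<open>G\<close> turns \<open>det (A + t G)\<close> into a family of polynomials
  whose degree is constant because of the condition at \<open>\<omega> = \<infinity>\<close>.\<close>

lemma det_inverse_in_RH:
  fixes A :: "real mat"
  assumes A: "A \<in> carrier_mat n n" and G: "G \<in> RH_inf n"
    and nonsing: "\<And>t w. 0 \<le> t \<Longrightarrow> t \<le> 1 \<Longrightarrow> 0 \<le> w \<Longrightarrow>
      det (map_mat complex_of_real A + complex_of_real t \<cdot>\<^sub>m freq_resp G w) \<noteq> 0"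
  shows "det (map_mat tf_const A + G) \<noteq> 0" "inverse (det (map_mat tf_const A + G)) \<in> RH"
proof -
  have Gc: "G \<in> carrier_mat n n" and GRH: "\<And>i j. i < n \<Longrightarrow> j < n \<Longrightarrow> G $$ (i, j) \<in> RH"
    using G by (auto simp: RH_inf_iff RH_mat_def)
  define E where "E = (\<lambda>(i, j). G $$ (i, j)) ` ({..<n} \<times> {..<n})"
  have "finite E" "E \<subseteq> RH" using GRH by (auto simp: E_def)
  then obtain q where q: "hurwitz (cpoly q)"
    and qE: "\<And>r. r \<in> E \<Longrightarrow> \<exists>p. degree p \<le> degree q \<and> r = to_fract p / to_fract q"
    by (rule RH_common_denominator) blast
  have q0: "q \<noteq> 0" using q by (rule hurwitz_nonzero)
  have "\<forall>i j. \<exists>p. i < n \<and> j < n \<longrightarrow> degree p \<le> degree q \<and> G $$ (i, j) = to_fract p / to_fract q"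
    using qE by (force simp: E_def)
  then obtain X where X: "\<And>i j. i < n \<Longrightarrow> j < n \<Longrightarrow> degree (X i j) \<le> degree q"
    "\<And>i j. i < n \<Longrightarrow> j < n \<Longrightarrow> G $$ (i, j) = to_fract (X i j) / to_fract q"
    by metis
  define m where "m = degree q"
  define M where "M t = mat n n (\<lambda>(i, j). [:A $$ (i, j):] * q + [:t:] * X i j)" for t
  have M: "M t \<in> carrier_mat n n" for t by (simp add: M_def)
  define P where "P t = det (M t)" for t
  have Xquot: "RH_quotient (X i j) q" if "i < n" "j < n" for i j
    using X(1)[OF that] q by (simp add: RH_quotient_def)
  have resp: "freq_resp G w $$ (i, j) = tf_at w (to_fract (X i j) / to_fract q)" if "i < n" "j < n" for i j w
    using that Gc X(2) by (simp add: freq_resp_eq)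
  have Gw: "freq_resp G w \<in> carrier_mat n n" for w using Gc by (simp add: freq_resp_eq)
  have P_eval: "poly (cpoly (P t)) s = det (map_mat (\<lambda>p. poly (cpoly p) s) (M t))" for t s
    unfolding P_def by (rule comm_ring_hom.hom_det[OF comm_ring_hom_poly_cpoly, symmetric])
  have P_axis: "poly (cpoly (P t)) (\<i> * complex_of_real x) \<noteq> 0" if t: "0 \<le> t" "t \<le> 1" and x: "0 \<le> x" for t x
  proof -
    define s where "s = \<i> * complex_of_real x"
    have qs: "poly (cpoly q) s \<noteq> 0" using q by (rule poly_hurwitz_nonzero) (simp add: s_def)
    have "map_mat (\<lambda>p. poly (cpoly p) s) (M t) = poly (cpoly q) s \<cdot>\<^sub>m
        (map_mat complex_of_real A + complex_of_real t \<cdot>\<^sub>m freq_resp G (ereal x))" (is "_ = _ \<cdot>\<^sub>m ?B")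
    proof (rule eq_matI)
      fix i j assume ij: "i < dim_row (poly (cpoly q) s \<cdot>\<^sub>m ?B)" "j < dim_col (poly (cpoly q) s \<cdot>\<^sub>m ?B)"
      then have ij: "i < n" "j < n" using Gw[of "ereal x"] by auto
      have "freq_resp G (ereal x) $$ (i, j) = poly (cpoly (X i j)) s / poly (cpoly q) s"
        using resp[OF ij] tf_at_quotient[OF Xquot[OF ij], of "ereal x"] by (simp add: s_def)
      then show "map_mat (\<lambda>p. poly (cpoly p) s) (M t) $$ (i, j) = (poly (cpoly q) s \<cdot>\<^sub>m ?B) $$ (i, j)"
        using ij A Gw[of "ereal x"] qs by (simp add: M_def cpoly_add distrib_left mult.commute)
    qed (use Gw[of "ereal x"] M in auto)
    then show ?thesis
      unfolding P_eval s_def[symmetric] using nonsing[OF t, of "ereal x"] x qs by simp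
  qed
  have deg_M: "degree (M t $$ (i, j)) \<le> m" if "i < n" "j < n" for t i j
  proof -
    have "degree ([:A $$ (i, j):] * q + [:t:] * X i j) \<le> m"
      using X(1)[OF that] degree_mult_le[of "[:A $$ (i, j):]" q] degree_mult_le[of "[:t:]" "X i j"]
      by (intro degree_add_le) (simp_all add: m_def)
    then show ?thesis using that by (simp add: M_def)
  qed
  have P_lead: "coeff (P t) (n * m) \<noteq> 0" if t: "0 \<le> t" "t \<le> 1" for t
  proof
    assume z: "coeff (P t) (n * m) = 0"
    have "map_mat complex_of_real (map_mat (\<lambda>p. coeff p m) (M t)) = complex_of_real (lead_coeff q) \<cdot>\<^sub>m
        (map_mat complex_of_real A + complex_of_real t \<cdot>\<^sub>m freq_resp G \<infinity>)" (is "_ = _ \<cdot>\<^sub>m ?B")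
    proof (rule eq_matI)
      fix i j assume "i < dim_row (complex_of_real (lead_coeff q) \<cdot>\<^sub>m ?B)"
        "j < dim_col (complex_of_real (lead_coeff q) \<cdot>\<^sub>m ?B)"
      then have ij: "i < n" "j < n" using Gw[of \<infinity>] by auto
      have "freq_resp G \<infinity> $$ (i, j) = complex_of_real (coeff (X i j) m / lead_coeff q)"
        using resp[OF ij] tf_at_quotient[OF Xquot[OF ij], of \<infinity>] by (simp add: m_def)
      then show "map_mat complex_of_real (map_mat (\<lambda>p. coeff p m) (M t)) $$ (i, j)
          = (complex_of_real (lead_coeff q) \<cdot>\<^sub>m ?B) $$ (i, j)"
        using ij A Gw[of \<infinity>] q0 by (simp add: M_def distrib_left m_def)
    qed (use Gw[of \<infinity>] M in auto)
    moreover have "det (map_mat complex_of_real (map_mat (\<lambda>p. coeff p m) (M t))) = complex_of_real (coeff (P t) (n * m))"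
      unfolding of_real_hom.hom_det P_def by (subst coeff_det[OF M deg_M]) simp_all
    ultimately show False using z nonsing[OF t, of \<infinity>] q0 by simp
  qed
  have deg_P: "degree (P t) = n * m" if "0 \<le> t" "t \<le> 1" for t
    using degree_det_le[OF M deg_M] P_lead[OF that] unfolding P_def by (meson le_antisym le_degree)
  have "hurwitz (cpoly (P 1))"
  proof (rule hurwitz_homotopy[of "\<lambda>t. cpoly (P t)" "n * m"])
    fix t :: real assume t: "t \<in> {0..1}"
    show "degree (cpoly (P t)) = n * m" using deg_P t by simp
    show "cpoly (P t) \<noteq> 0" using P_lead[of t] t by auto
    fix s assume s: "Re s = 0"
    then have sI: "s = \<i> * complex_of_real (Im s)" by (simp add: complex_eq_iff)
    show "poly (cpoly (P t)) s \<noteq> 0"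
    proof (cases "0 \<le> Im s")
      case True
      then show ?thesis using P_axis[of t "Im s"] t sI by simp
    next
      case False
      have "cnj s = \<i> * complex_of_real (- Im s)" using s by (simp add: complex_eq_iff)
      then have "poly (cpoly (P t)) (cnj s) \<noteq> 0" using P_axis[of t "- Im s"] t False by simp
      then show ?thesis by (simp add: cpoly_cnj)
    qed
  next
    fix k
    have "continuous_on {0..1} (\<lambda>t. complex_of_real (coeff (P t) k))"
      unfolding P_def
    proof (intro continuous_intros continuous_on_coeff_det[OF M])
      fix i j k assume ij: "i < n" "j < n"
      have "continuous_on {0..1} (\<lambda>t. A $$ (i, j) * coeff q k + t * coeff (X i j) k)"
        by (intro continuous_intros)
      then show "continuous_on {0..1} (\<lambda>t. coeff (M t $$ (i, j)) k)"
        using ij by (simp add: M_def)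
    qed
    then show "continuous_on {0..1} (\<lambda>t. coeff (cpoly (P t)) k)" by (simp add: coeff_map_poly)
  next
    show "hurwitz (cpoly (P 0))" unfolding hurwitz_def
    proof (intro allI impI)
      fix s assume z: "poly (cpoly (P 0)) s = 0"
      have "map_mat (\<lambda>p. poly (cpoly p) s) (M 0) = poly (cpoly q) s \<cdot>\<^sub>m map_mat complex_of_real A"
        by (rule eq_matI) (use A in \<open>auto simp: M_def cpoly_mult\<close>)
      moreover have "det (map_mat complex_of_real A) \<noteq> 0"
      proof -
        have "map_mat complex_of_real A + complex_of_real 0 \<cdot>\<^sub>m freq_resp G 0 = map_mat complex_of_real A"
          by (rule eq_matI) (use A Gw[of 0] in auto)
        then show ?thesis using nonsing[of 0 0] by simp
      qed
      ultimately have "poly (cpoly q) s = 0" using z unfolding P_eval by simp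
      then show "Re s < 0" using q by (simp add: hurwitz_def)
    qed
  qed
  then have quot: "RH_quotient (q ^ n) (P 1)"
    using deg_P[of 1] q0 by (simp add: RH_quotient_def degree_power_eq m_def)
  have P1: "P 1 \<noteq> 0" using P_lead[of 1] by auto
  have smult: "to_fract (Polynomial.smult c q) = to_fract q * to_fract [:c:]" for c
    by (simp flip: to_fract_mult)
  have "map_mat to_fract (M 1) = to_fract q \<cdot>\<^sub>m (map_mat tf_const A + G)"
    by (rule eq_matI) (use Gc A X(2) q0 in \<open>auto simp: M_def tf_const_def distrib_left smult\<close>)
  then have "to_fract (P 1) = det (to_fract q \<cdot>\<^sub>m (map_mat tf_const A + G))"
    unfolding P_def by (metis comm_ring_hom.hom_det[OF comm_ring_hom_to_fract])
  also have "\<dots> = to_fract q ^ n * det (map_mat tf_const A + G)"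
    using Gc by simp
  finally have e: "to_fract (P 1) = to_fract q ^ n * det (map_mat tf_const A + G)" .
  then show nz: "det (map_mat tf_const A + G) \<noteq> 0" using P1 by (metis mult_zero_right to_fract_eq_0_iff)
  have "to_fract (q ^ n) = to_fract q ^ n" by (induction n) simp_all
  then have "inverse (det (map_mat tf_const A + G)) = to_fract (q ^ n) / to_fract (P 1)"
    using q0 nz unfolding e by (simp add: inverse_eq_divide)
  then show "inverse (det (map_mat tf_const A + G)) \<in> RH" using RH_quotientI[OF quot] by simp
qed

lemma tf_const_semiring_hom: "semiring_hom tf_const"
  by unfold_locales simp_all

lemma RH_adj_mat:
  assumes A: "A \<in> carrier_mat n n" and "RH_mat A"
  shows "RH_mat (adj_mat A)"
  unfolding RH_mat_def
proof (intro allI impI)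
  fix i j assume "i < dim_row (adj_mat A)" "j < dim_col (adj_mat A)"
  then have ij: "i < n" "j < n" using adj_mat(1)[OF A] by auto
  have D: "mat_delete A j i \<in> carrier_mat (n - 1) (n - 1)" using A by (simp add: mat_delete_def)
  have "A $$ (k, l) \<in> RH" if "k < n" "l < n" for k l using assms that by (simp add: RH_mat_def)
  then have DRH: "mat_delete A j i $$ (k, l) \<in> RH" if "k < n - 1" "l < n - 1" for k l
    using A that by (simp add: mat_delete_def)
  have "det (mat_delete A j i) \<in> RH"
    unfolding det_def'[OF D]
  proof (intro RH_sum RH_mult RH_prod)
    fix \<pi> k assume "\<pi> \<in> {\<pi>. \<pi> permutes {0..<n - 1}}" "k \<in> {0..<n - 1}"
    then show "mat_delete A j i $$ (k, \<pi> k) \<in> RH"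
      using permutes_in_image[of \<pi> "{0..<n - 1}" k] by (intro DRH) auto
  next
    fix \<pi> :: "nat \<Rightarrow> nat"
    show "signof \<pi> \<in> RH" by (cases "sign \<pi> = 1") (auto simp: sign_def)
  qed
  moreover have "(- 1) ^ k \<in> RH" for k by (induction k) auto
  ultimately show "adj_mat A $$ (i, j) \<in> RH"
    using A ij by (simp add: adj_mat_def cofactor_def)
qed

lemma RH_mat_add:
  "A \<in> carrier_mat n m \<Longrightarrow> B \<in> carrier_mat n m \<Longrightarrow> RH_mat A \<Longrightarrow> RH_mat B \<Longrightarrow> RH_mat (A + B)"
  by (simp add: RH_mat_def)

lemma RH_mat_smult: "c \<in> RH \<Longrightarrow> RH_mat A \<Longrightarrow> RH_mat (c \<cdot>\<^sub>m A)"
  by (simp add: RH_mat_def)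

text \<open>Multiplying \<open>1 + A\<^sup>-\<^sup>1 G\<close> by \<open>A\<close> reduces the inverse to that of \<open>A + G\<close>.\<close>

lemma feedback_stable_const_inverse:
  fixes A :: "real mat"
  assumes A: "A \<in> carrier_mat n n" "det A \<noteq> 0" and G: "G \<in> RH_inf n"
    and H: "H = mat_inv (map_mat tf_const A)"
    and nonsing: "\<And>t w. 0 \<le> t \<Longrightarrow> t \<le> 1 \<Longrightarrow> 0 \<le> w \<Longrightarrow>
      det (map_mat complex_of_real A + complex_of_real t \<cdot>\<^sub>m freq_resp G w) \<noteq> 0"
  shows "feedback_stable G H"
proof -
  define At where "At = map_mat tf_const A"
  define Bt where "Bt = map_mat tf_const (inverse (det A) \<cdot>\<^sub>m adj_mat A)"
  define W where "W = At + G"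
  note Ai = det_nonzero_imp_inverse[OF A]
  have Atc: "At \<in> carrier_mat n n" using A by (simp add: At_def)
  have Btc: "Bt \<in> carrier_mat n n" using Ai(1) by (simp add: Bt_def)
  have hom_one: "map_mat tf_const (1\<^sub>m n) = 1\<^sub>m n" by (rule eq_matI) auto
  have AtBt: "At * Bt = 1\<^sub>m n" "Bt * At = 1\<^sub>m n"
    unfolding At_def Bt_def
    using semiring_hom.mat_hom_mult[OF tf_const_semiring_hom A(1) Ai(1)]
      semiring_hom.mat_hom_mult[OF tf_const_semiring_hom Ai(1) A(1)] Ai hom_one by simp_all
  have HBt: "H = Bt" unfolding H At_def[symmetric] by (rule mat_inv_eqI[OF Atc Btc AtBt])
  have Gc: "G \<in> carrier_mat n n" and GRH: "RH_mat G" using G by (auto simp: RH_inf_iff)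
  have Wc: "W \<in> carrier_mat n n" using Gc by (simp add: W_def)
  have WRH: "RH_mat W" unfolding W_def using Atc Gc GRH by (intro RH_mat_add) (auto simp: At_def)
  have d: "det W \<noteq> 0" "inverse (det W) \<in> RH"
    using det_inverse_in_RH[OF A(1) G nonsing] by (simp_all add: W_def At_def)
  define V where "V = inverse (det W) \<cdot>\<^sub>m adj_mat W"
  have V: "V \<in> carrier_mat n n" "W * V = 1\<^sub>m n" "V * W = 1\<^sub>m n"
    using det_nonzero_imp_inverse[OF Wc d(1)] by (simp_all add: V_def)
  have VRH: "RH_mat V" unfolding V_def using d(2) RH_adj_mat[OF Wc WRH] by (rule RH_mat_smult)
  define L where "L = V * At"
  have Lc: "L \<in> carrier_mat n n" using V Atc by (simp add: L_def)
  have LRH: "RH_mat L" unfolding L_def by (rule RH_mat_mult[OF V(1) Atc VRH]) (simp add: At_def)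
  have Hc: "H \<in> carrier_mat n n" using Btc by (simp add: HBt)
  have HRH: "RH_mat H" by (simp add: HBt Bt_def)
  define U where "U = 1\<^sub>m n + H * G"
  have Uc: "U \<in> carrier_mat n n" using Hc Gc by (simp add: U_def)
  have UW: "U = Bt * W"
    unfolding U_def W_def HBt using Btc Atc Gc AtBt by (simp add: mult_add_distrib_mat[of _ n n])
  have BWc: "Bt * W \<in> carrier_mat n n" using Btc Wc by simp
  have "W * L = At"
    unfolding L_def assoc_mult_mat[OF Wc V(1) Atc, symmetric] V(2) using Atc by simp
  then have UL: "U * L = 1\<^sub>m n"
    unfolding UW assoc_mult_mat[OF Btc Wc Lc] using AtBt by simp
  have "At * (Bt * W) = W"
    unfolding assoc_mult_mat[OF Atc Btc Wc, symmetric] AtBt using Wc by simp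
  then have LU: "L * U = 1\<^sub>m n"
    unfolding UW L_def assoc_mult_mat[OF V(1) Atc BWc] using V by simp
  have inv: "invertible_mat U" and UinvL: "mat_inv U = L"
    by (rule invertible_matI[OF Uc Lc UL LU]) (rule mat_inv_eqI[OF Uc Lc UL LU])
  have parts: "L * H \<in> carrier_mat n n" "G * L \<in> carrier_mat n n" "G * L * H \<in> carrier_mat n n"
    using Lc Hc Gc by auto
  have partsRH: "RH_mat (L * H)" "RH_mat (G * L)" "RH_mat (G * L * H)"
    using RH_mat_mult[OF Lc Hc LRH HRH] RH_mat_mult[OF Gc Lc GRH LRH]
      RH_mat_mult[OF parts(2) Hc _ HRH] by auto
  have "four_block_mat L (L * H) (G * L) (G * L * H) \<in> RH_inf (2 * n)"
    unfolding RH_inf_iff RH_mat_def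
    using four_block_carrier_mat[OF Lc parts(3)] Lc parts LRH partsRH
    by (auto simp: RH_mat_def mult_2 simp del: index_mult_mat)
  then show ?thesis
    unfolding feedback_stable_def feedback_def Let_def
    using inv UinvL Gc by (simp add: U_def)
qed

section \<open>Block diagonal matrices and Kronecker products\<close>

lemma sum_lessThan_double:
  fixes h :: "nat \<Rightarrow> 'a::comm_monoid_add"
  shows "(\<Sum>k<2 * N. h k) = (\<Sum>i<N. h (2 * i) + h (2 * i + 1))"
  by (induction N) (simp_all add: add.assoc)

lemma mult_two_by_two_index:
  fixes A B :: "'a::semiring_0 mat"
  assumes "A \<in> carrier_mat 2 2" "B \<in> carrier_mat 2 2" "i < 2" "j < 2"
  shows "(A * B) $$ (i, j) = A $$ (i, 0) * B $$ (0, j) + A $$ (i, 1) * B $$ (1, j)"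
  using assms by (simp add: scalar_prod_def numeral_2_eq_2)

definition block_diag :: "nat \<Rightarrow> (nat \<Rightarrow> 'a::zero mat) \<Rightarrow> 'a mat" where
  "block_diag N f = mat (2 * N) (2 * N)
     (\<lambda>(i, j). if i div 2 = j div 2 then f (i div 2) $$ (i mod 2, j mod 2) else 0)"

lemma block_diag_carrier [simp]: "block_diag N f \<in> carrier_mat (2 * N) (2 * N)"
  by (simp add: block_diag_def)

lemma diag_block_mat_eq_block_diag:
  assumes "\<And>i. i < N \<Longrightarrow> f i \<in> carrier_mat 2 2"
  shows "diag_block_mat (map f [0..<N]) = block_diag N f"
  using assms
proof (induction N)
  case 0
  then show ?case by (auto simp: block_diag_def)
next
  case (Suc N)
  have fN: "f N \<in> carrier_mat 2 2" using Suc.prems by simp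
  have IH: "diag_block_mat (map f [0..<N]) = block_diag N f" using Suc by simp
  have "diag_block_mat (map f [0..<Suc N]) = four_block_mat (block_diag N f) (0\<^sub>m (2 * N) 2) (0\<^sub>m 2 (2 * N)) (f N)"
    using fN IH by (simp add: diag_block_mat_last Let_def block_diag_def)
  also have "\<dots> = block_diag (Suc N) f"
  proof (rule eq_matI)
    fix i j assume "i < dim_row (block_diag (Suc N) f)" "j < dim_col (block_diag (Suc N) f)"
    then have ij: "i < 2 * N + 2" "j < 2 * N + 2" by (simp_all add: block_diag_def)
    have big: "k div 2 = N \<and> k - 2 * N = k mod 2" if "k < 2 * N + 2" "\<not> k < 2 * N" for k
      using that by presburger
    have small: "k div 2 < N" if "k < 2 * N" for k using that by presburger
    show "four_block_mat (block_diag N f) (0\<^sub>m (2 * N) 2) (0\<^sub>m 2 (2 * N)) (f N) $$ (i, j)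
        = block_diag (Suc N) f $$ (i, j)"
    proof (cases "i < 2 * N"; cases "j < 2 * N")
      assume "i < 2 * N" "j < 2 * N"
      then show ?thesis using fN by (simp add: block_diag_def)
    next
      assume a: "i < 2 * N" "\<not> j < 2 * N"
      then have "i div 2 \<noteq> j div 2" using small[of i] big[of j] ij by auto
      then show ?thesis using fN a ij by (simp add: block_diag_def)
    next
      assume a: "\<not> i < 2 * N" "j < 2 * N"
      then have "i div 2 \<noteq> j div 2" using small[of j] big[of i] ij by auto
      then show ?thesis using fN a ij by (simp add: block_diag_def)
    next
      assume a: "\<not> i < 2 * N" "\<not> j < 2 * N"
      then show ?thesis using fN ij big[of i] big[of j] by (simp add: block_diag_def)
    qed
  qed (use fN in \<open>simp_all add: block_diag_def\<close>)
  finally show ?case .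
qed

lemma block_diag_index:
  "i < 2 * N \<Longrightarrow> j < 2 * N \<Longrightarrow>
    block_diag N f $$ (i, j) = (if i div 2 = j div 2 then f (i div 2) $$ (i mod 2, j mod 2) else 0)"
  by (simp add: block_diag_def)

lemma block_diag_mult:
  fixes f g :: "nat \<Rightarrow> 'a::semiring_0 mat"
  assumes f: "\<And>i. i < N \<Longrightarrow> f i \<in> carrier_mat 2 2" and g: "\<And>i. i < N \<Longrightarrow> g i \<in> carrier_mat 2 2"
  shows "block_diag N f * block_diag N g = block_diag N (\<lambda>i. f i * g i)"
proof (rule eq_matI)
  fix i j assume "i < dim_row (block_diag N (\<lambda>i. f i * g i))" "j < dim_col (block_diag N (\<lambda>i. f i * g i))"
  then have ij: "i < 2 * N" "j < 2 * N" by (simp_all add: block_diag_def)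
  have i2: "i div 2 < N" using ij by presburger
  have "(block_diag N f * block_diag N g) $$ (i, j)
      = (\<Sum>k<2 * N. block_diag N f $$ (i, k) * block_diag N g $$ (k, j))"
    using ij by (auto simp: scalar_prod_def block_diag_def atLeast0LessThan intro!: sum.cong)
  also have "\<dots> = (\<Sum>k<N. if k = i div 2 then (if i div 2 = j div 2 then
      f (i div 2) $$ (i mod 2, 0) * g (i div 2) $$ (0, j mod 2) +
      f (i div 2) $$ (i mod 2, 1) * g (i div 2) $$ (1, j mod 2) else 0) else 0)"
    unfolding sum_lessThan_double using ij by (intro sum.cong refl) (auto simp: block_diag_index)
  also have "\<dots> = block_diag N (\<lambda>i. f i * g i) $$ (i, j)"
    using i2 ij mult_two_by_two_index[OF f[OF i2] g[OF i2], of "i mod 2" "j mod 2"]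
    by (cases "i div 2 = j div 2") (simp_all add: block_diag_index del: index_mult_mat)
  finally show "(block_diag N f * block_diag N g) $$ (i, j) = block_diag N (\<lambda>i. f i * g i) $$ (i, j)" .
qed (simp_all add: block_diag_def)

lemma block_diag_one: "block_diag N (\<lambda>i. 1\<^sub>m 2) = (1\<^sub>m (2 * N) :: 'a::{zero,one} mat)"
proof (rule eq_matI)
  fix i j assume "i < dim_row (1\<^sub>m (2 * N) :: 'a mat)" "j < dim_col (1\<^sub>m (2 * N) :: 'a mat)"
  moreover have "i = j \<longleftrightarrow> i div 2 = j div 2 \<and> i mod 2 = j mod 2"
    by (metis div_mult_mod_eq)
  ultimately show "block_diag N (\<lambda>i. 1\<^sub>m 2) $$ (i, j) = (1\<^sub>m (2 * N) :: 'a mat) $$ (i, j)"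
    by (auto simp: block_diag_index)
qed (simp_all add: block_diag_def)

lemma block_diag_cong: "(\<And>i. i < N \<Longrightarrow> f i = g i) \<Longrightarrow> block_diag N f = block_diag N g"
  by (rule eq_matI) (auto simp: block_diag_def)

lemma kron_index:
  assumes "A \<in> carrier_mat n m" "B \<in> carrier_mat 2 2" "i < 2 * n" "j < 2 * m"
  shows "kron A B $$ (i, j) = A $$ (i div 2, j div 2) * B $$ (i mod 2, j mod 2)"
proof -
  have "i < n * 2" "j < m * 2" using assms by linarith+
  then show ?thesis using assms(1,2) unfolding kron_def by (subst index_mat(1)) auto
qed

lemma kron_carrier [simp]:
  assumes "A \<in> carrier_mat n m" "B \<in> carrier_mat 2 2"
  shows "kron A B \<in> carrier_mat (2 * n) (2 * m)"
  unfolding kron_def using assms by (intro carrier_matI) auto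

lemma kron_one_left:
  fixes B :: "'a::semiring_1 mat"
  assumes B: "B \<in> carrier_mat 2 2"
  shows "kron (1\<^sub>m N) B = block_diag N (\<lambda>i. B)"
proof (rule eq_matI)
  note c = kron_carrier[OF one_carrier_mat[of N] B]
  show "dim_row (kron (1\<^sub>m N) B) = dim_row (block_diag N (\<lambda>i. B))"
    "dim_col (kron (1\<^sub>m N) B) = dim_col (block_diag N (\<lambda>i. B))"
    using c by (auto simp: block_diag_def)
  fix i j assume "i < dim_row (block_diag N (\<lambda>i. B))" "j < dim_col (block_diag N (\<lambda>i. B))"
  then have ij: "i < 2 * N" "j < 2 * N" by (simp_all add: block_diag_def)
  then have "i div 2 < N" "j div 2 < N" by presburger+
  then show "kron (1\<^sub>m N) B $$ (i, j) = block_diag N (\<lambda>i. B) $$ (i, j)"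
    unfolding kron_index[OF one_carrier_mat B ij] block_diag_index[OF ij] by simp
qed

lemma kron_mult:
  fixes A B :: "'a::comm_semiring_0 mat"
  assumes A: "A \<in> carrier_mat n m" and C: "C \<in> carrier_mat m l"
    and B: "B \<in> carrier_mat 2 2" and D: "D \<in> carrier_mat 2 2"
  shows "kron A B * kron C D = kron (A * C) (B * D)"
proof (rule eq_matI)
  have AC: "A * C \<in> carrier_mat n l" and BD: "B * D \<in> carrier_mat 2 2" using assms by auto
  note kc = kron_carrier[OF A B] kron_carrier[OF C D] kron_carrier[OF AC BD]
  show "dim_row (kron A B * kron C D) = dim_row (kron (A * C) (B * D))"
    "dim_col (kron A B * kron C D) = dim_col (kron (A * C) (B * D))" using kc by auto
  fix i j assume "i < dim_row (kron (A * C) (B * D))" "j < dim_col (kron (A * C) (B * D))"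
  then have ij: "i < 2 * n" "j < 2 * l" using kc by auto
  have i2: "i div 2 < n" "j div 2 < l" using ij by presburger+
  have "(kron A B * kron C D) $$ (i, j) = (\<Sum>k<2 * m. kron A B $$ (i, k) * kron C D $$ (k, j))"
    using ij kc by (auto simp: scalar_prod_def atLeast0LessThan intro!: sum.cong)
  also have "\<dots> = (\<Sum>k<2 * m. (A $$ (i div 2, k div 2) * B $$ (i mod 2, k mod 2)) *
      (C $$ (k div 2, j div 2) * D $$ (k mod 2, j mod 2)))"
    using ij by (intro sum.cong refl) (simp add: kron_index[OF A B] kron_index[OF C D])
  also have "\<dots> = (\<Sum>k<m. A $$ (i div 2, k) * C $$ (k, j div 2) *
      (B $$ (i mod 2, 0) * D $$ (0, j mod 2) + B $$ (i mod 2, 1) * D $$ (1, j mod 2)))"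
    unfolding sum_lessThan_double by (intro sum.cong refl) (simp, simp add: algebra_simps)
  also have "\<dots> = (\<Sum>k<m. A $$ (i div 2, k) * C $$ (k, j div 2)) * (B * D) $$ (i mod 2, j mod 2)"
    unfolding sum_distrib_right using mult_two_by_two_index[OF B D] by simp
  also have "(\<Sum>k<m. A $$ (i div 2, k) * C $$ (k, j div 2)) = (A * C) $$ (i div 2, j div 2)"
    using A C i2 by (auto simp: scalar_prod_def atLeast0LessThan intro!: sum.cong)
  also have "\<dots> * (B * D) $$ (i mod 2, j mod 2) = kron (A * C) (B * D) $$ (i, j)"
    by (rule kron_index[OF AC BD ij, symmetric])
  finally show "(kron A B * kron C D) $$ (i, j) = kron (A * C) (B * D) $$ (i, j)" .
qed

lemma map_mat_kron_one:
  fixes f :: "'a::semiring_1 \<Rightarrow> 'b::semiring_1"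
  assumes A: "A \<in> carrier_mat n n" and f: "f 0 = 0"
  shows "kron (map_mat f A) (1\<^sub>m 2) = map_mat f (kron A (1\<^sub>m 2))"
proof (rule eq_matI)
  have At: "map_mat f A \<in> carrier_mat n n" using A by simp
  note c = kron_carrier[OF At one_carrier_mat] kron_carrier[OF A one_carrier_mat]
  show "dim_row (kron (map_mat f A) (1\<^sub>m 2)) = dim_row (map_mat f (kron A (1\<^sub>m 2)))"
    "dim_col (kron (map_mat f A) (1\<^sub>m 2)) = dim_col (map_mat f (kron A (1\<^sub>m 2)))"
    using c by auto
  fix i j assume ij0: "i < dim_row (map_mat f (kron A (1\<^sub>m 2)))"
    "j < dim_col (map_mat f (kron A (1\<^sub>m 2)))"
  then have ij: "i < 2 * n" "j < 2 * n" using c by auto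
  then have "i div 2 < n" "j div 2 < n" by presburger+
  then show "kron (map_mat f A) (1\<^sub>m 2) $$ (i, j) = map_mat f (kron A (1\<^sub>m 2)) $$ (i, j)"
    using ij0 A f unfolding kron_index[OF At one_carrier_mat ij]
    by (simp add: kron_index[OF A one_carrier_mat ij])
qed

definition coord :: "'a vec \<Rightarrow> nat \<Rightarrow> nat \<Rightarrow> 'a vec" where
  "coord x N k = vec N (\<lambda>i. x $ (2 * i + k))"

definition block :: "'a vec \<Rightarrow> nat \<Rightarrow> 'a vec" where
  "block x i = vec 2 (\<lambda>k. x $ (2 * i + k))"

lemma coord_carrier [simp]: "coord x N k \<in> carrier_vec N"
  by (simp add: coord_def)

lemma block_carrier [simp]: "block x i \<in> carrier_vec 2"
  by (simp add: block_def)

lemma sum_lessThan_2: "(\<Sum>k<2. h k) = h 0 + h (1::nat)" for h :: "nat \<Rightarrow> 'a::comm_monoid_add"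
  by (simp add: numeral_2_eq_2)

lemma sqn_block:
  assumes "x \<in> carrier_vec (2 * N)"
  shows "sqn x = (\<Sum>i<N. sqn (block x i))"
proof -
  have "sqn x = (\<Sum>k<2 * N. (cmod (x $ k))\<^sup>2)" using assms by (simp only: sqn_def carrier_vecD)
  also have "\<dots> = (\<Sum>i<N. sqn (block x i))"
    unfolding sum_lessThan_double by (simp add: sqn_def block_def sum_lessThan_2)
  finally show ?thesis .
qed

lemma sqn_coord:
  assumes "x \<in> carrier_vec (2 * N)"
  shows "sqn x = sqn (coord x N 0) + sqn (coord x N 1)"
proof -
  have "sqn x = (\<Sum>k<2 * N. (cmod (x $ k))\<^sup>2)" using assms by (simp only: sqn_def carrier_vecD)
  also have "\<dots> = sqn (coord x N 0) + sqn (coord x N 1)"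
    unfolding sum_lessThan_double by (simp add: sqn_def coord_def sum.distrib)
  finally show ?thesis .
qed

lemma block_diag_form:
  fixes f :: "nat \<Rightarrow> complex mat"
  assumes f: "\<And>i. i < N \<Longrightarrow> f i \<in> carrier_mat 2 2" and x: "x \<in> carrier_vec (2 * N)"
  shows "(block_diag N f *\<^sub>v x) \<bullet>c x = (\<Sum>i<N. (f i *\<^sub>v block x i) \<bullet>c block x i)"
proof -
  have e: "(block_diag N f *\<^sub>v x) $ i = (f (i div 2) *\<^sub>v block x (i div 2)) $ (i mod 2)" if i: "i < 2 * N" for i
  proof -
    have i2: "i div 2 < N" using i by presburger
    have "(block_diag N f *\<^sub>v x) $ i = (\<Sum>j<2 * N. block_diag N f $$ (i, j) * x $ j)"
      by (rule mult_mat_vec_nth[OF block_diag_carrier x i])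
    also have "\<dots> = (\<Sum>j<N. if j = i div 2 then f (i div 2) $$ (i mod 2, 0) * x $ (2 * (i div 2)) +
        f (i div 2) $$ (i mod 2, 1) * x $ (2 * (i div 2) + 1) else 0)"
      unfolding sum_lessThan_double using i by (intro sum.cong refl) (auto simp: block_diag_index)
    also have "\<dots> = (f (i div 2) *\<^sub>v block x (i div 2)) $ (i mod 2)"
      using i2 mult_mat_vec_nth[OF f[OF i2] block_carrier, of "i mod 2" x "i div 2"]
      by (simp add: sum_lessThan_2 block_def del: index_mult_mat_vec)
    finally show ?thesis .
  qed
  have "(block_diag N f *\<^sub>v x) \<bullet>c x = (\<Sum>i<2 * N. (block_diag N f *\<^sub>v x) $ i * cnj (x $ i))"
    by (rule cscalar_prod_sum[OF x])
  also have "\<dots> = (\<Sum>i<2 * N. (f (i div 2) *\<^sub>v block x (i div 2)) $ (i mod 2) * cnj (x $ i))"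
    using e by (intro sum.cong refl) (simp del: index_mult_mat_vec)
  also have "\<dots> = (\<Sum>i<N. (f i *\<^sub>v block x i) \<bullet>c block x i)"
    unfolding sum_lessThan_double
    by (intro sum.cong refl, subst cscalar_prod_sum[OF block_carrier])
      (simp add: sum_lessThan_2 block_def del: index_mult_mat_vec)
  finally show ?thesis .
qed

lemma kron_one_form:
  fixes A :: "complex mat"
  assumes A: "A \<in> carrier_mat N N" and x: "x \<in> carrier_vec (2 * N)"
  shows "(kron A (1\<^sub>m 2) *\<^sub>v x) \<bullet>c x =
    (A *\<^sub>v coord x N 0) \<bullet>c coord x N 0 + (A *\<^sub>v coord x N 1) \<bullet>c coord x N 1"
proof -
  have e: "(kron A (1\<^sub>m 2) *\<^sub>v x) $ (2 * i + k) = (A *\<^sub>v coord x N k) $ i" if "i < N" "k < 2" for i k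
  proof -
    have ik: "2 * i + k < 2 * N" "(2 * i + k) div 2 = i" "(2 * i + k) mod 2 = k" using that by auto
    have "(kron A (1\<^sub>m 2) *\<^sub>v x) $ (2 * i + k) = (\<Sum>j<2 * N. kron A (1\<^sub>m 2) $$ (2 * i + k, j) * x $ j)"
      by (rule mult_mat_vec_nth[OF kron_carrier[OF A] x ik(1)]) simp
    also have "\<dots> = (\<Sum>j<2 * N. A $$ (i, j div 2) * 1\<^sub>m 2 $$ (k, j mod 2) * x $ j)"
      using ik by (intro sum.cong refl) (subst kron_index[OF A], auto)
    also have "\<dots> = (\<Sum>j<N. A $$ (i, j) * x $ (2 * j + k))"
      unfolding sum_lessThan_double using that less_2_cases[of k] by (intro sum.cong refl) auto
    also have "\<dots> = (A *\<^sub>v coord x N k) $ i"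
      using mult_mat_vec_nth[OF A coord_carrier that(1), of x k] by (simp add: coord_def del: index_mult_mat_vec)
    finally show ?thesis .
  qed
  have e0: "(kron A (1\<^sub>m 2) *\<^sub>v x) $ (2 * i) = (A *\<^sub>v coord x N 0) $ i"
    and e1: "(kron A (1\<^sub>m 2) *\<^sub>v x) $ (2 * i + 1) = (A *\<^sub>v coord x N 1) $ i" if "i < N" for i
    using e[OF that, of 0] e[OF that, of 1] by simp_all
  have "(kron A (1\<^sub>m 2) *\<^sub>v x) \<bullet>c x = (\<Sum>i<2 * N. (kron A (1\<^sub>m 2) *\<^sub>v x) $ i * cnj (x $ i))"
    by (rule cscalar_prod_sum[OF x])
  also have "\<dots> = (\<Sum>i<N. (A *\<^sub>v coord x N 0) $ i * cnj (x $ (2 * i)) +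
      (A *\<^sub>v coord x N 1) $ i * cnj (x $ (2 * i + 1)))"
    unfolding sum_lessThan_double by (intro sum.cong refl) (simp only: e0 e1 lessThan_iff)
  also have "\<dots> = (A *\<^sub>v coord x N 0) \<bullet>c coord x N 0 + (A *\<^sub>v coord x N 1) \<bullet>c coord x N 1"
    by (subst (1 2) cscalar_prod_sum[OF coord_carrier])
      (simp add: sum.distrib coord_def del: index_mult_mat_vec)
  finally show ?thesis .
qed

section \<open>Rotations and line impedances\<close>

lemma rotation_eq:
  "rotation t = mat 2 2 (\<lambda>(i, j). tf_const (if i = j then cos t else if i = 0 then - sin t else sin t))"
  by (rule eq_matI) (auto simp: rotation_def mat_of_rows_list_def less_2_cases_iff)

lemma rotation_carrier [simp]: "rotation t \<in> carrier_mat 2 2"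
  by (simp add: rotation_eq)

lemma rotation_inverse: "rotation t * rotation (- t) = 1\<^sub>m 2"
proof (rule eq_matI)
  have "cos t * cos t + sin t * sin t = 1"
    using sin_cos_squared_add2[of t] by (simp add: power2_eq_square)
  then have "tf_const (cos t * cos t + sin t * sin t) = tf_const 1" by (rule arg_cong)
  then have c: "tf_const (cos t) * tf_const (cos t) + tf_const (sin t) * tf_const (sin t) = 1"
    by (simp only: tf_const_simps)
  fix i j assume "i < dim_row (1\<^sub>m 2 :: tf mat)" "j < dim_col (1\<^sub>m 2 :: tf mat)"
  then have ij: "i < 2" "j < 2" by auto
  then show "(rotation t * rotation (- t)) $$ (i, j) = 1\<^sub>m 2 $$ (i, j)"
    unfolding mult_two_by_two_index[OF rotation_carrier rotation_carrier ij]
    using c by (auto simp: rotation_eq less_2_cases_iff mult.commute add.commute)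
qed (simp_all add: rotation_eq)

definition impedance :: "tf \<Rightarrow> tf mat" where
  "impedance a = mat_of_rows_list 2 [[a, - 1], [1, a]]"

lemma impedance_eq: "impedance a = mat 2 2 (\<lambda>(i, j). if i = j then a else if i = 0 then - 1 else 1)"
  by (rule eq_matI) (auto simp: impedance_def mat_of_rows_list_def less_2_cases_iff)

lemma impedance_carrier [simp]: "impedance a \<in> carrier_mat 2 2"
  by (simp add: impedance_eq)

lemma rotation_impedance_commute: "rotation t * impedance a = impedance a * rotation t"
proof (rule eq_matI)
  fix i j assume "i < dim_row (impedance a * rotation t)" "j < dim_col (impedance a * rotation t)"
  then have ij: "i < 2" "j < 2" by (auto simp: impedance_eq rotation_eq)
  then show "(rotation t * impedance a) $$ (i, j) = (impedance a * rotation t) $$ (i, j)"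
    unfolding mult_two_by_two_index[OF rotation_carrier impedance_carrier ij]
      mult_two_by_two_index[OF impedance_carrier rotation_carrier ij]
    by (auto simp: rotation_eq impedance_eq less_2_cases_iff mult.commute)
qed (simp_all add: rotation_eq impedance_eq)

lemma line_dynamics_inverse:
  obtains a where "line_dynamics w0 eps \<in> carrier_mat 2 2" "mat_inv (line_dynamics w0 eps) = impedance a"
    "line_dynamics w0 eps * impedance a = 1\<^sub>m 2"
proof -
  define a where "a = tf_s / tf_const w0 + tf_const eps"
  have a: "a = to_fract [:eps, 1 / w0:]"
  proof (cases "w0 = 0")
    case False
    have "tf_s = to_fract [:0, 1 / w0:] * tf_const w0"
      using False by (simp add: tf_s_def tf_const_def flip: to_fract_mult)
    moreover have "tf_const w0 \<noteq> 0" using False by (simp add: tf_const_def)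
    ultimately have "tf_s / tf_const w0 = to_fract [:0, 1 / w0:]" by (rule nonzero_divide_eq_eq[THEN iffD2, rotated])
    then show ?thesis by (simp add: a_def tf_const_def flip: to_fract_add)
  qed (simp add: a_def tf_const_def)
  define d where "d = a * a + 1"
  define p where "p = [:eps, 1 / w0:]"
  have "d = to_fract (p * p + 1)" by (simp add: d_def a p_def[symmetric])
  moreover have "p * p + 1 \<noteq> 0"
  proof
    assume "p * p + 1 = 0"
    then have "poly (p * p + 1) 0 = 0" by (simp only: poly_0)
    then have "eps * eps + 1 = 0" by (simp add: p_def)
    then show False using zero_le_square[of eps] by linarith
  qed
  ultimately have d0: "d \<noteq> 0" by (simp only: to_fract_eq_0_iff not_False_eq_True)
  define Z where "Z = impedance a"
  define W where "W = mat 2 2 (\<lambda>(i, j). (if i = j then a else if i = 0 then 1 else - 1) / d)"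
  have Z: "Z \<in> carrier_mat 2 2" and W: "W \<in> carrier_mat 2 2" by (simp_all add: Z_def W_def)
  have "(a * a + 1) / d = 1" using d0 unfolding d_def by (rule divide_self)
  then have dd: "a * a / d + 1 / d = 1" by (simp only: add_divide_distrib)
  then have dd': "1 / d + a * a / d = 1" by (simp only: add.commute)
  have ZW: "Z * W = 1\<^sub>m 2"
  proof (rule eq_matI)
    fix i j assume "i < dim_row (1\<^sub>m 2 :: tf mat)" "j < dim_col (1\<^sub>m 2 :: tf mat)"
    then have ij: "i < 2" "j < 2" by auto
    then show "(Z * W) $$ (i, j) = 1\<^sub>m 2 $$ (i, j)"
      unfolding mult_two_by_two_index[OF Z W ij]
      using dd dd' by (auto simp: Z_def W_def impedance_eq less_2_cases_iff)
  qed (use Z W in auto)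
  have WZ: "W * Z = 1\<^sub>m 2"
  proof (rule eq_matI)
    fix i j assume "i < dim_row (1\<^sub>m 2 :: tf mat)" "j < dim_col (1\<^sub>m 2 :: tf mat)"
    then have ij: "i < 2" "j < 2" by auto
    then show "(W * Z) $$ (i, j) = 1\<^sub>m 2 $$ (i, j)"
      unfolding mult_two_by_two_index[OF W Z ij]
      using dd dd' by (auto simp: Z_def W_def impedance_eq less_2_cases_iff)
  qed (use Z W in auto)
  have F: "line_dynamics w0 eps = W"
    unfolding line_dynamics_def using mat_inv_eqI[OF Z W ZW WZ] by (simp add: Z_def impedance_def a_def)
  have "mat_inv W = Z" by (rule mat_inv_eqI[OF W Z WZ ZW])
  with that[of a] F W WZ show ?thesis by (simp add: Z_def)
qed

section \<open>Gains and phases\<close>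

lemma finite_eigenvalues:
  fixes A :: "'a::field mat"
  assumes A: "A \<in> carrier_mat n n"
  shows "finite {x. eigenvalue A x}"
proof -
  have "char_poly A \<noteq> 0" using degree_monic_char_poly[OF A] by auto
  then show ?thesis unfolding eigenvalue_root_char_poly[OF A] by (rule poly_roots_finite)
qed

lemma cpoly_of_real: "poly (cpoly p) (complex_of_real x) = complex_of_real (poly p x)"
  by (induction p) auto

lemma eigenvalue_of_real_iff:
  assumes K: "K \<in> carrier_mat n n"
  shows "eigenvalue (map_mat complex_of_real K) (complex_of_real x) \<longleftrightarrow> eigenvalue K x"
proof -
  have Kc: "map_mat complex_of_real K \<in> carrier_mat n n" using K by simp
  show ?thesis
    unfolding eigenvalue_root_char_poly[OF Kc] eigenvalue_root_char_poly[OF K]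
      of_real_hom.char_poly_hom[OF K] cpoly_of_real by simp
qed

lemma mat_adjoint_mult:
  fixes A B :: "complex mat"
  assumes A: "A \<in> carrier_mat n m" and B: "B \<in> carrier_mat m l"
  shows "mat_adjoint (A * B) = mat_adjoint B * mat_adjoint A"
proof (rule eq_matI)
  fix i j assume "i < dim_row (mat_adjoint B * mat_adjoint A)" "j < dim_col (mat_adjoint B * mat_adjoint A)"
  then have ij: "i < l" "j < n" using A B by auto
  then show "mat_adjoint (A * B) $$ (i, j) = (mat_adjoint B * mat_adjoint A) $$ (i, j)"
    using A B by (simp add: scalar_prod_def mult.commute)
qed (use A B in auto)

lemma quad_adjoint_mult:
  assumes A: "A \<in> carrier_mat n m" and x: "x \<in> carrier_vec m"
  shows "quad (mat_adjoint A * A) x = sqn (A *\<^sub>v x)"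
proof -
  have Ax: "A *\<^sub>v x \<in> carrier_vec n" using A x by simp
  have "(mat_adjoint A * A) *\<^sub>v x = mat_adjoint A *\<^sub>v (A *\<^sub>v x)"
    by (rule assoc_mult_mat_vec[OF mat_adjoint_carrier[OF A] A x])
  moreover have "(mat_adjoint A *\<^sub>v (A *\<^sub>v x)) \<bullet>c x = (A *\<^sub>v x) \<bullet>c (A *\<^sub>v x)"
    using cscalar_prod_adjoint[OF mat_adjoint_carrier[OF A] Ax x] by simp
  ultimately show ?thesis by (simp add: quad_def cscalar_prod_self)
qed

lemma unit_vec_sqn_pos: "0 < n \<Longrightarrow> 0 < sqn (unit_vec n 0)"
  by (rule sqn_pos[of _ n]) auto

lemma
  assumes A: "A \<in> carrier_mat n n" and n: "0 < n"
  shows sigma_max_nonneg: "0 \<le> sigma_max A"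
    and sqn_mult_le_sigma_max: "x \<in> carrier_vec n \<Longrightarrow> sqn (A *\<^sub>v x) \<le> (sigma_max A)\<^sup>2 * sqn x"
proof -
  define M where "M = mat_adjoint A * A"
  have M: "M \<in> carrier_mat n n" unfolding M_def using mat_adjoint_carrier[OF A] A by (rule mult_carrier_mat)
  have "mat_adjoint M = M"
    unfolding M_def using mat_adjoint_mult[OF mat_adjoint_carrier[OF A] A] by simp
  then obtain t where t: "eigenvalue M (complex_of_real t)"
    "\<And>x. x \<in> carrier_vec n \<Longrightarrow> quad M x \<le> t * sqn x"
    by (rule hermitian_max_eigenvalue[OF M _ n]) blast
  have le: "sqn (A *\<^sub>v x) \<le> t * sqn x" if "x \<in> carrier_vec n" for x
    using t(2)[OF that] quad_adjoint_mult[OF A that] by (simp add: M_def)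
  have "0 \<le> t * sqn (unit_vec n 0)"
    using le[OF unit_vec_carrier] sqn_nonneg by (rule order_trans[rotated])
  then have t0: "0 \<le> t" using unit_vec_sqn_pos[OF n] by (simp add: zero_le_mult_iff)
  have "singular_values A \<subseteq> (\<lambda>z. sqrt (Re z)) ` {x. eigenvalue M x}"
  proof
    fix x assume "x \<in> singular_values A"
    then have "0 \<le> x" "eigenvalue M (complex_of_real (x\<^sup>2))" by (simp_all add: singular_values_def M_def)
    then show "x \<in> (\<lambda>z. sqrt (Re z)) ` {x. eigenvalue M x}"
      by (intro image_eqI[of _ _ "complex_of_real (x\<^sup>2)"]) (simp_all del: of_real_power)
  qed
  then have fin: "finite (singular_values A)"
    using finite_eigenvalues[OF M] by (rule finite_subset[OF _ finite_imageI])
  have "sqrt t \<in> singular_values A"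
    using t(1) t0 by (simp add: singular_values_def M_def del: of_real_power)
  then have ge: "sqrt t \<le> sigma_max A" unfolding sigma_max_def using fin by (intro Max_ge)
  then show "0 \<le> sigma_max A" using t0 real_sqrt_ge_zero[OF t0] by linarith
  have "t \<le> (sigma_max A)\<^sup>2" using power_mono[OF ge, of 2] t0 by simp
  then show "sqn (A *\<^sub>v x) \<le> (sigma_max A)\<^sup>2 * sqn x" if "x \<in> carrier_vec n"
    using le[OF that] mult_right_mono[OF _ sqn_nonneg[of x]] by (meson order_trans)
qed

lemma norm_form_le_sigma_max:
  assumes A: "A \<in> carrier_mat n n" and n: "0 < n" and s: "sigma_max A \<le> s" "0 < s"
    and x: "x \<in> carrier_vec n"
  shows "cmod ((A *\<^sub>v x) \<bullet>c x) \<le> s * sqn x"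
proof -
  have "(sigma_max A)\<^sup>2 \<le> s\<^sup>2" using s sigma_max_nonneg[OF A n] by (intro power_mono)
  then have "(sigma_max A)\<^sup>2 * sqn x \<le> s\<^sup>2 * sqn x" using sqn_nonneg by (rule mult_right_mono)
  moreover have "2 * s * cmod ((A *\<^sub>v x) \<bullet>c x) \<le> sqn (A *\<^sub>v x) + s\<^sup>2 * sqn x"
    using A x s by (intro norm_cscalar_prod_le[of _ n]) auto
  ultimately have "2 * s * cmod ((A *\<^sub>v x) \<bullet>c x) \<le> 2 * s * (s * sqn x)"
    using sqn_mult_le_sigma_max[OF A n x] by (simp add: power2_eq_square mult.assoc)
  then show ?thesis using s(2) by simp
qed

lemma hermitian_form_real:
  assumes A: "A \<in> carrier_mat n n" and herm: "mat_adjoint A = A" and x: "x \<in> carrier_vec n"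
  shows "(A *\<^sub>v x) \<bullet>c x = complex_of_real (quad A x)"
proof -
  have Ax: "A *\<^sub>v x \<in> carrier_vec n" using A x by simp
  have "(A *\<^sub>v x) \<bullet>c x = cnj ((A *\<^sub>v x) \<bullet>c x)"
    using cscalar_prod_adjoint[OF A x x] cscalar_prod_commute[OF Ax x] herm by simp
  then have "Im ((A *\<^sub>v x) \<bullet>c x) = 0" by (metis cnj.sel(2) equal_neg_zero)
  then show ?thesis by (simp add: quad_def complex_eq_iff)
qed

lemma mat_adjoint_of_real:
  "mat_adjoint (map_mat complex_of_real A) = map_mat complex_of_real (transpose_mat A)"
  by (rule eq_matI) auto

lemma smallest_eigenvalue_le_quad:
  fixes K :: "real mat"
  defines "Kc \<equiv> map_mat complex_of_real K"
  assumes K: "K \<in> carrier_mat n n" and sym: "transpose_mat K = K" and n: "0 < n"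
    and x: "x \<in> carrier_vec n"
  shows "smallest_eigenvalue K * sqn x \<le> quad Kc x"
proof -
  have Kc: "Kc \<in> carrier_mat n n" using K by (simp add: Kc_def)
  have herm: "mat_adjoint Kc = Kc" by (simp add: Kc_def mat_adjoint_of_real sym)
  have M: "- Kc \<in> carrier_mat n n" using Kc by simp
  have neg: "(- Kc) *\<^sub>v v = - (Kc *\<^sub>v v)" if "v \<in> carrier_vec n" for v
    by (rule eq_vecI) (use Kc that in \<open>auto simp: scalar_prod_def sum_negf\<close>)
  have cK: "cnj (Kc $$ (j, i)) = Kc $$ (i, j)" if "i < n" "j < n" for i j
    using arg_cong[OF herm, of "\<lambda>B. B $$ (i, j)"] Kc that by simp
  have "mat_adjoint (- Kc) = - Kc"
    by (rule eq_matI) (use Kc cK in auto)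
  then obtain t where t: "eigenvalue (- Kc) (complex_of_real t)"
    "\<And>x. x \<in> carrier_vec n \<Longrightarrow> quad (- Kc) x \<le> t * sqn x"
    by (rule hermitian_max_eigenvalue[OF M _ n]) blast
  obtain v where v: "v \<in> carrier_vec n" "v \<noteq> 0\<^sub>v n" "(- Kc) *\<^sub>v v = complex_of_real t \<cdot>\<^sub>v v"
    using t(1) Kc by (auto simp: eigenvalue_def eigenvector_def)
  have "Kc *\<^sub>v v = complex_of_real (- t) \<cdot>\<^sub>v v"
  proof (rule eq_vecI)
    fix i assume "i < dim_vec (complex_of_real (- t) \<cdot>\<^sub>v v)"
    then have i: "i < n" using v by simp
    have "(- (Kc *\<^sub>v v)) $ i = (complex_of_real t \<cdot>\<^sub>v v) $ i" using v(3) neg[OF v(1)] by simp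
    then have "- ((Kc *\<^sub>v v) $ i) = complex_of_real t * v $ i"
      using i v(1) Kc by (simp del: index_mult_mat_vec)
    then have "(Kc *\<^sub>v v) $ i = - (complex_of_real t * v $ i)" by (metis minus_minus)
    then show "(Kc *\<^sub>v v) $ i = (complex_of_real (- t) \<cdot>\<^sub>v v) $ i"
      using i v(1) Kc by (simp del: index_mult_mat_vec)
  qed (use Kc v in auto)
  then have "eigenvalue Kc (complex_of_real (- t))"
    using v Kc by (auto simp: eigenvalue_def eigenvector_def)
  then have "eigenvalue K (- t)" using eigenvalue_of_real_iff[OF K] by (simp only: Kc_def)
  then have "smallest_eigenvalue K \<le> - t"
    unfolding smallest_eigenvalue_def using finite_eigenvalues[OF K] by (intro Min_le) auto
  then have "smallest_eigenvalue K * sqn x \<le> - t * sqn x" using sqn_nonneg by (rule mult_right_mono)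
  also have "\<dots> \<le> quad Kc x"
  proof -
    have Kx: "Kc *\<^sub>v x \<in> carrier_vec n" using Kc x by simp
    have "quad (- Kc) x = - quad Kc x"
      unfolding quad_def neg[OF x] using Kx x carrier_matD(1)[OF Kc]
      by (simp add: cscalar_prod_sum[OF x] sum_negf del: index_mult_mat_vec)
    then show ?thesis using t(2)[OF x] by simp
  qed
  finally show ?thesis .
qed

lemma singular_values_pos_def:
  fixes K :: "real mat"
  defines "Kc \<equiv> map_mat complex_of_real K"
  assumes K: "K \<in> carrier_mat n n" and sym: "transpose_mat K = K"
    and pos: "\<And>x. x \<in> carrier_vec n \<Longrightarrow> x \<noteq> 0\<^sub>v n \<Longrightarrow> 0 < quad Kc x"
  shows "singular_values Kc = {x. eigenvalue K x}"
proof -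
  have Kc: "Kc \<in> carrier_mat n n" using K by (simp add: Kc_def)
  have herm: "mat_adjoint Kc = Kc" by (simp add: Kc_def mat_adjoint_of_real sym)
  have quad_eigen: "quad Kc v = c * sqn v" if "v \<in> carrier_vec n" "Kc *\<^sub>v v = complex_of_real c \<cdot>\<^sub>v v" for v c
  proof -
    have "(complex_of_real c \<cdot>\<^sub>v v) \<bullet>c v = complex_of_real c * (v \<bullet>c v)"
      using that(1) by (intro smult_scalar_prod_distrib) auto
    then show ?thesis by (simp add: quad_def that(2) cscalar_prod_self)
  qed
  have ass: "(Kc * Kc) *\<^sub>v v = Kc *\<^sub>v (Kc *\<^sub>v v)" if "v \<in> carrier_vec n" for v
    using Kc Kc that by (rule assoc_mult_mat_vec)
  have "eigenvalue (Kc * Kc) (complex_of_real (x\<^sup>2)) \<longleftrightarrow> eigenvalue Kc (complex_of_real x)" if x: "0 \<le> x" for x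
  proof
    assume "eigenvalue Kc (complex_of_real x)"
    then obtain v where v: "v \<in> carrier_vec n" "v \<noteq> 0\<^sub>v n" "Kc *\<^sub>v v = complex_of_real x \<cdot>\<^sub>v v"
      using Kc by (auto simp: eigenvalue_def eigenvector_def)
    have "(Kc * Kc) *\<^sub>v v = complex_of_real (x\<^sup>2) \<cdot>\<^sub>v v"
      unfolding ass[OF v(1)] v(3) mult_mat_vec[OF Kc v(1)]
      by (simp add: smult_smult_assoc power2_eq_square)
    then show "eigenvalue (Kc * Kc) (complex_of_real (x\<^sup>2))"
      using v Kc by (auto simp: eigenvalue_def eigenvector_def)
  next
    assume "eigenvalue (Kc * Kc) (complex_of_real (x\<^sup>2))"
    then obtain v where v: "v \<in> carrier_vec n" "v \<noteq> 0\<^sub>v n"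
      "Kc *\<^sub>v (Kc *\<^sub>v v) = complex_of_real (x\<^sup>2) \<cdot>\<^sub>v v"
      using Kc ass by (auto simp: eigenvalue_def eigenvector_def)
    have Kv: "Kc *\<^sub>v v \<in> carrier_vec n" using Kc v by simp
    define w where "w = Kc *\<^sub>v v - complex_of_real x \<cdot>\<^sub>v v"
    have w: "w \<in> carrier_vec n" using Kv v by (simp add: w_def)
    have "Kc *\<^sub>v w = complex_of_real (x\<^sup>2) \<cdot>\<^sub>v v - complex_of_real x \<cdot>\<^sub>v (Kc *\<^sub>v v)"
      unfolding w_def using Kc Kv v by (simp add: mult_minus_distrib_mat_vec mult_mat_vec)
    also have "\<dots> = complex_of_real (- x) \<cdot>\<^sub>v w"
      by (rule eq_vecI)
        (use Kv v carrier_matD(1)[OF Kc] in \<open>auto simp: w_def algebra_simps power2_eq_square simp del: index_mult_mat_vec\<close>)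
    finally have "quad Kc w = - x * sqn w" by (rule quad_eigen[OF w])
    then have "\<not> 0 < quad Kc w" using x sqn_nonneg[of w] by (simp add: not_less)
    then have w0: "w = 0\<^sub>v n" using pos[OF w] by blast
    have "Kc *\<^sub>v v = complex_of_real x \<cdot>\<^sub>v v"
    proof (rule eq_vecI)
      fix i assume "i < dim_vec (complex_of_real x \<cdot>\<^sub>v v)"
      then have i: "i < n" using v by simp
      have "w $ i = 0" using w0 i by simp
      then show "(Kc *\<^sub>v v) $ i = (complex_of_real x \<cdot>\<^sub>v v) $ i"
        using i Kv v(1) by (simp add: w_def del: index_mult_mat_vec)
    qed (use Kv v carrier_matD(1)[OF Kc] in simp)
    then show "eigenvalue Kc (complex_of_real x)"
      using v Kc by (auto simp: eigenvalue_def eigenvector_def)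
  qed
  moreover have "0 \<le> x" if ev: "eigenvalue Kc (complex_of_real x)" for x
  proof -
    obtain v where v: "v \<in> carrier_vec n" "v \<noteq> 0\<^sub>v n" "Kc *\<^sub>v v = complex_of_real x \<cdot>\<^sub>v v"
      using ev Kc by (auto simp: eigenvalue_def eigenvector_def)
    have "0 < x * sqn v" using pos[OF v(1,2)] quad_eigen[OF v(1,3)] by simp
    then show ?thesis using sqn_pos[OF v(1,2)] by (simp add: zero_less_mult_iff)
  qed
  ultimately show ?thesis
    using eigenvalue_of_real_iff[OF K]
    unfolding singular_values_def herm by (auto simp: Kc_def simp del: of_real_power)
qed

lemma is_phases_form:
  assumes A: "A \<in> carrier_mat n n" and ph: "is_phases A ph" and x: "x \<in> carrier_vec n"
  obtains y :: "complex vec" where "y \<in> carrier_vec n" "x \<noteq> 0\<^sub>v n \<longrightarrow> y \<noteq> 0\<^sub>v n"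
    "(A *\<^sub>v x) \<bullet>c x = (\<Sum>k<n. cis (ph ! k) * complex_of_real ((cmod (y $ k))\<^sup>2))"
proof -
  obtain T where T: "T \<in> carrier_mat n n" "invertible_mat T"
    and AT: "A = mat_adjoint T * mat_diag n (\<lambda>k. cis (ph ! k)) * T"
    using ph A by (auto simp: is_phases_def)
  define D where "D = mat_diag n (\<lambda>k. cis (ph ! k))"
  have D: "D \<in> carrier_mat n n" by (simp add: D_def)
  define y where "y = T *\<^sub>v x"
  have y: "y \<in> carrier_vec n" using T x by (simp add: y_def)
  have "x = 0\<^sub>v n" if "y = 0\<^sub>v n"
  proof -
    have "mat_inv T *\<^sub>v (T *\<^sub>v x) = x"
      using assoc_mult_mat_vec[OF mat_inv(1)[OF T] T(1) x] mat_inv(3)[OF T] x by simp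
    moreover have "mat_inv T *\<^sub>v 0\<^sub>v n = 0\<^sub>v n"
      by (rule eq_vecI) (use mat_inv(1)[OF T] in auto)
    ultimately show ?thesis using that by (simp add: y_def)
  qed
  moreover have "(A *\<^sub>v x) \<bullet>c x = (\<Sum>k<n. cis (ph ! k) * complex_of_real ((cmod (y $ k))\<^sup>2))"
  proof -
    have Dy: "D *\<^sub>v y \<in> carrier_vec n" using D y by simp
    have TD: "mat_adjoint T * D \<in> carrier_mat n n"
      using mat_adjoint_carrier[OF T(1)] D by (rule mult_carrier_mat)
    have "A *\<^sub>v x = mat_adjoint T *\<^sub>v (D *\<^sub>v y)"
      unfolding AT D_def[symmetric] assoc_mult_mat_vec[OF TD T(1) x] y_def[symmetric]
      by (rule assoc_mult_mat_vec[OF mat_adjoint_carrier[OF T(1)] D y])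
    then have "(A *\<^sub>v x) \<bullet>c x = (D *\<^sub>v y) \<bullet>c y"
      using cscalar_prod_adjoint[OF mat_adjoint_carrier[OF T(1)] Dy x] by (simp add: y_def)
    also have "\<dots> = (\<Sum>k<n. (D *\<^sub>v y) $ k * cnj (y $ k))" by (rule cscalar_prod_sum[OF y])
    also have "\<dots> = (\<Sum>k<n. cis (ph ! k) * complex_of_real ((cmod (y $ k))\<^sup>2))"
    proof (intro sum.cong refl)
      fix k assume "k \<in> {..<n}"
      then have k: "k < n" by simp
      have "(D *\<^sub>v y) $ k = (\<Sum>j<n. if j = k then cis (ph ! k) * y $ k else 0)"
        unfolding mult_mat_vec_nth[OF D y k] using k by (intro sum.cong refl) (simp add: D_def mat_diag_def)
      then have "(D *\<^sub>v y) $ k = cis (ph ! k) * y $ k" using k by simp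
      then show "(D *\<^sub>v y) $ k * cnj (y $ k) = cis (ph ! k) * complex_of_real ((cmod (y $ k))\<^sup>2)"
        by (simp only: complex_norm_square mult.assoc)
    qed
    finally show ?thesis .
  qed
  ultimately show ?thesis using that[OF y] by blast
qed

lemma is_phases_nth:
  assumes "is_phases A ph" "k < dim_row A"
  shows "ph ! k \<le> hd ph" "last ph \<le> ph ! k"
proof -
  have l: "length ph = dim_row A" and s: "sorted_wrt (\<ge>) ph" using assms by (auto simp: is_phases_def)
  then have ne: "ph \<noteq> []" using assms(2) by auto
  show "ph ! k \<le> hd ph"
    using sorted_wrt_nth_less[OF s, of 0 k] assms(2) l ne by (cases "k = 0") (auto simp: hd_conv_nth)
  show "last ph \<le> ph ! k"
    using sorted_wrt_nth_less[OF s, of k "length ph - 1"] assms(2) l ne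
    by (cases "k = length ph - 1") (auto simp: last_conv_nth)
qed

lemma is_phases_rotated_pos:
  assumes A: "A \<in> carrier_mat n n" and ph: "is_phases A ph" and x: "x \<in> carrier_vec n" "x \<noteq> 0\<^sub>v n"
    and a: "hd ph < a + pi / 2" "a - pi / 2 < last ph"
  shows "0 < Re (cis (- a) * ((A *\<^sub>v x) \<bullet>c x))"
proof -
  obtain y :: "complex vec" where y: "y \<in> carrier_vec n" "x \<noteq> 0\<^sub>v n \<longrightarrow> y \<noteq> 0\<^sub>v n"
    "(A *\<^sub>v x) \<bullet>c x = (\<Sum>k<n. cis (ph ! k) * complex_of_real ((cmod (y $ k))\<^sup>2))"
    by (rule is_phases_form[OF A ph x(1)])
  have c: "0 < cos (ph ! k - a)" if "k < n" for k
  proof (rule cos_gt_zero_pi)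
    show "- (pi / 2) < ph ! k - a" "ph ! k - a < pi / 2"
      using is_phases_nth[OF ph, of k] that A a by auto
  qed
  have "\<exists>k<n. y $ k \<noteq> 0"
  proof (rule ccontr)
    assume "\<not> (\<exists>k<n. y $ k \<noteq> 0)"
    then have "y = 0\<^sub>v n" using y(1) by (intro eq_vecI) auto
    with y(2) x(2) show False by simp
  qed
  then obtain k where k: "k < n" "y $ k \<noteq> 0" by blast
  have "Re (cis (- a) * ((A *\<^sub>v x) \<bullet>c x)) = (\<Sum>k<n. Re (cis (- a) * (cis (ph ! k) * complex_of_real ((cmod (y $ k))\<^sup>2))))"
    unfolding y(3) sum_distrib_left Re_sum ..
  also have "\<dots> = (\<Sum>k<n. cos (ph ! k - a) * (cmod (y $ k))\<^sup>2)"
  proof (intro sum.cong refl)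
    fix k
    have e: "cis (- a) * (cis (ph ! k) * complex_of_real ((cmod (y $ k))\<^sup>2))
        = cis (ph ! k - a) * complex_of_real ((cmod (y $ k))\<^sup>2)"
      by (simp only: mult.assoc[symmetric] cis_mult) (simp only: add.commute[of "- a"] diff_conv_add_uminus)
    show "Re (cis (- a) * (cis (ph ! k) * complex_of_real ((cmod (y $ k))\<^sup>2))) = cos (ph ! k - a) * (cmod (y $ k))\<^sup>2"
      unfolding e by (simp del: of_real_power)
  qed
  also have "\<dots> > 0"
    using c k by (intro sum_pos2[of _ k]) (auto simp: less_imp_le intro!: mult_nonneg_nonneg)
  finally show ?thesis .
qed

lemma quad_congruence:
  fixes A T :: "complex mat"
  assumes A: "A \<in> carrier_mat n n" and T: "T \<in> carrier_mat n m" and x: "x \<in> carrier_vec m"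
  shows "((mat_adjoint T * A * T) *\<^sub>v x) \<bullet>c x = (A *\<^sub>v (T *\<^sub>v x)) \<bullet>c (T *\<^sub>v x)"
proof -
  have Tx: "T *\<^sub>v x \<in> carrier_vec n" and ATx: "A *\<^sub>v (T *\<^sub>v x) \<in> carrier_vec n" using A T x by auto
  have TA: "mat_adjoint T * A \<in> carrier_mat m n" using mat_adjoint_carrier[OF T] A by (rule mult_carrier_mat)
  have "(mat_adjoint T * A * T) *\<^sub>v x = mat_adjoint T *\<^sub>v (A *\<^sub>v (T *\<^sub>v x))"
    unfolding assoc_mult_mat_vec[OF TA T x] by (rule assoc_mult_mat_vec[OF mat_adjoint_carrier[OF T] A Tx])
  then show ?thesis using cscalar_prod_adjoint[OF mat_adjoint_carrier[OF T] ATx x] by simp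
qed

section \<open>The reduced grounded Laplacian\<close>

lemma quad_zero: "quad A (0\<^sub>v n) = 0"
  unfolding quad_def cscalar_prod_sum[OF zero_carrier_vec] by simp

lemma grounded_laplacian_carrier [simp]: "grounded_laplacian M b \<in> carrier_mat M M"
  by (simp add: grounded_laplacian_def)

lemma grounded_laplacian_symmetric:
  assumes "\<And>i j. i \<le> M \<Longrightarrow> j \<le> M \<Longrightarrow> i \<noteq> j \<Longrightarrow> b i j = b j i"
  shows "transpose_mat (grounded_laplacian M b) = grounded_laplacian M b"
  by (rule eq_matI) (use assms in \<open>auto simp: grounded_laplacian_def\<close>)

text \<open>With \<open>x\<close> extended by \<open>0\<close> at the grounded node, the form is half the sum of
  \<open>b i j * |x i - x j|\<^sup>2\<close> over all pairs of nodes.\<close>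

lemma grounded_laplacian_psd:
  assumes sym: "\<And>i j. i \<le> M \<Longrightarrow> j \<le> M \<Longrightarrow> i \<noteq> j \<Longrightarrow> b i j = b j i"
    and nonneg: "\<And>i j. i \<le> M \<Longrightarrow> j \<le> M \<Longrightarrow> i \<noteq> j \<Longrightarrow> 0 \<le> b i j"
    and x: "x \<in> carrier_vec M"
  shows "0 \<le> quad (map_mat complex_of_real (grounded_laplacian M b)) x"
proof -
  define c where "c i j = (if i = j then 0 else b i j)" for i j
  define y :: "nat \<Rightarrow> complex" where "y i = (if i < M then x $ i else 0)" for i
  define L where "L = map_mat complex_of_real (grounded_laplacian M b)"
  have L: "L \<in> carrier_mat M M" by (simp add: L_def)
  have csym: "c i j = c j i" if "i \<le> M" "j \<le> M" for i j using sym[OF that] by (auto simp: c_def)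
  have Lij: "L $$ (i, j) = complex_of_real ((if i = j then \<Sum>k\<le>M. c i k else 0) - c i j)" if "i < M" "j < M" for i j
  proof -
    have "(\<Sum>k\<in>{..M} - {i}. b i k) = (\<Sum>k\<le>M. c i k)"
      by (rule sum.mono_neutral_cong_left) (auto simp: c_def)
    moreover have "c i i = 0" "i \<noteq> j \<Longrightarrow> c i j = b i j" by (simp_all add: c_def)
    ultimately show ?thesis using that
      by (cases "i = j") (simp_all add: L_def grounded_laplacian_def del: of_real_sum)
  qed
  have extend: "(\<Sum>i\<le>M. h i) = (\<Sum>i<M. h i)" if "h M = 0" for h :: "nat \<Rightarrow> real"
    using that by (simp add: lessThan_Suc_atMost[symmetric])
  have Re_scale: "Re (complex_of_real r * w) = r * Re w" for r w by simp
  define A where "A = (\<Sum>i\<le>M. \<Sum>j\<le>M. c i j * (cmod (y i))\<^sup>2)"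
  define C where "C = (\<Sum>i\<le>M. \<Sum>j\<le>M. c i j * Re (y j * cnj (y i)))"
  have "quad L x = (\<Sum>i<M. Re ((\<Sum>j<M. L $$ (i, j) * x $ j) * cnj (x $ i)))"
    unfolding quad_def cscalar_prod_sum[OF x] Re_sum
    using L x by (intro sum.cong refl) (simp only: mult_mat_vec_nth[OF L x] lessThan_iff)
  also have "\<dots> = (\<Sum>i<M. (\<Sum>k\<le>M. c i k) * (cmod (y i))\<^sup>2 - (\<Sum>j<M. c i j * Re (y j * cnj (y i))))"
  proof (intro sum.cong refl)
    fix i assume "i \<in> {..<M}"
    then have i: "i < M" by simp
    have "(\<Sum>j<M. L $$ (i, j) * x $ j) = (\<Sum>j<M. (if j = i then complex_of_real (\<Sum>k\<le>M. c i k) * x $ i else 0)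
        - complex_of_real (c i j) * x $ j)"
      using i by (intro sum.cong refl) (simp add: Lij left_diff_distrib)
    also have "\<dots> = complex_of_real (\<Sum>k\<le>M. c i k) * x $ i - (\<Sum>j<M. complex_of_real (c i j) * x $ j)"
      using i by (simp add: sum_subtractf)
    finally have "(\<Sum>j<M. L $$ (i, j) * x $ j) * cnj (x $ i) = complex_of_real (\<Sum>k\<le>M. c i k) * (x $ i * cnj (x $ i))
        - (\<Sum>j<M. complex_of_real (c i j) * (x $ j * cnj (x $ i)))"
      by (simp only: left_diff_distrib sum_distrib_right mult.assoc)
    also have "\<dots> = complex_of_real ((\<Sum>k\<le>M. c i k) * (cmod (x $ i))\<^sup>2)
        - (\<Sum>j<M. complex_of_real (c i j) * (x $ j * cnj (x $ i)))"
      by (simp only: complex_norm_square of_real_mult)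
    finally have e: "(\<Sum>j<M. L $$ (i, j) * x $ j) * cnj (x $ i) = \<dots>" .
    show "Re ((\<Sum>j<M. L $$ (i, j) * x $ j) * cnj (x $ i))
        = (\<Sum>k\<le>M. c i k) * (cmod (y i))\<^sup>2 - (\<Sum>j<M. c i j * Re (y j * cnj (y i)))"
      unfolding e minus_complex.sel Re_complex_of_real Re_sum Re_scale
      using i by (simp add: y_def del: times_complex.sel)
  qed
  also have "\<dots> = A - C"
  proof -
    have "A = (\<Sum>i<M. (\<Sum>k\<le>M. c i k) * (cmod (y i))\<^sup>2)"
      unfolding A_def by (subst extend) (simp_all add: y_def sum_distrib_right)
    moreover have inner: "(\<Sum>j\<le>M. c i j * Re (y j * cnj (y i))) = (\<Sum>j<M. c i j * Re (y j * cnj (y i)))" for i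
      by (rule extend) (simp add: y_def)
    have "C = (\<Sum>i<M. \<Sum>j<M. c i j * Re (y j * cnj (y i)))"
      unfolding C_def inner by (rule extend) (simp add: y_def)
    ultimately show ?thesis by (simp add: sum_subtractf)
  qed
  finally have q: "quad L x = A - C" .
  have "0 \<le> (\<Sum>i\<le>M. \<Sum>j\<le>M. c i j * (cmod (y i - y j))\<^sup>2)"
    using nonneg by (intro sum_nonneg mult_nonneg_nonneg) (auto simp: c_def)
  also have "\<dots> = (\<Sum>i\<le>M. \<Sum>j\<le>M. c i j * (cmod (y i))\<^sup>2 + c i j * (cmod (y j))\<^sup>2 - 2 * (c i j * Re (y j * cnj (y i))))"
  proof (intro sum.cong refl)
    fix i j
    have "(cmod (y i - y j))\<^sup>2 = (cmod (y i))\<^sup>2 + (cmod (y j))\<^sup>2 - 2 * Re (y j * cnj (y i))"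
      unfolding cmod_power2 by (simp add: power2_eq_square algebra_simps)
    then show "c i j * (cmod (y i - y j))\<^sup>2
        = c i j * (cmod (y i))\<^sup>2 + c i j * (cmod (y j))\<^sup>2 - 2 * (c i j * Re (y j * cnj (y i)))"
      by (simp only:) (simp only: distrib_left right_diff_distrib mult.left_commute)
  qed
  also have "\<dots> = A + (\<Sum>i\<le>M. \<Sum>j\<le>M. c i j * (cmod (y j))\<^sup>2) - 2 * C"
    by (simp only: A_def C_def sum.distrib sum_subtractf sum_distrib_left)
  also have "(\<Sum>i\<le>M. \<Sum>j\<le>M. c i j * (cmod (y j))\<^sup>2) = A"
    unfolding A_def by (subst sum.swap) (intro sum.cong refl, simp add: csym)
  finally show ?thesis unfolding q[unfolded L_def] by simp
qed

lemma conjugate_append_vec: "conjugate (u @\<^sub>v v) = conjugate u @\<^sub>v conjugate v"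
  for u v :: "complex vec"
  by (rule eq_vecI) (auto simp: append_vec_def Let_def)

text \<open>The form of a Schur complement at \<open>x\<close> is the form of \<open>A\<close> at \<open>(x, - A4\<^sup>-\<^sup>1 A3 x)\<close>.\<close>

lemma schur_complement_psd:
  fixes A :: "real mat"
  assumes A: "A \<in> carrier_mat M M" and NM: "N \<le> M" and sym: "transpose_mat A = A"
    and nonneg: "\<And>x. x \<in> carrier_vec M \<Longrightarrow> 0 \<le> quad (map_mat complex_of_real A) x"
    and split: "split_block A N N = (A1, A2, A3, A4)" and inv: "invertible_mat A4"
  defines "R \<equiv> A1 - A2 * mat_inv A4 * A3"
  shows "R \<in> carrier_mat N N" "transpose_mat R = R" "psd (map_mat complex_of_real R)"
proof -
  define m where "m = M - N"
  have dims: "dim_row A = N + m" "dim_col A = N + m" using A NM by (auto simp: m_def)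
  note blocks = split_block[OF split dims]
  have A1: "A1 \<in> carrier_mat N N" and A2: "A2 \<in> carrier_mat N m" and A3: "A3 \<in> carrier_mat m N"
    and A4: "A4 \<in> carrier_mat m m" and Ab: "A = four_block_mat A1 A2 A3 A4" using blocks by auto
  have Asym: "A $$ (j, i) = A $$ (i, j)" if "i < N + m" "j < N + m" for i j
    using arg_cong[OF sym, of "\<lambda>B. B $$ (i, j)"] dims that by simp
  have T1: "transpose_mat A1 = A1"
  proof (rule eq_matI)
    fix i j assume "i < dim_row A1" "j < dim_col A1"
    then have "i < N" "j < N" using A1 by auto
    then show "transpose_mat A1 $$ (i, j) = A1 $$ (i, j)"
      using Asym[of i j] A1 A4 unfolding Ab by simp
  qed (use A1 in auto)
  have T2: "transpose_mat A2 = A3"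
  proof (rule eq_matI)
    fix i j assume "i < dim_row A3" "j < dim_col A3"
    then have "i < m" "j < N" using A3 by auto
    then show "transpose_mat A2 $$ (i, j) = A3 $$ (i, j)"
      using Asym[of "N + i" j] A1 A2 A3 A4 unfolding Ab by simp
  qed (use A2 A3 in auto)
  have T4: "transpose_mat A4 = A4"
  proof (rule eq_matI)
    fix i j assume "i < dim_row A4" "j < dim_col A4"
    then have "i < m" "j < m" using A4 by auto
    then show "transpose_mat A4 $$ (i, j) = A4 $$ (i, j)"
      using Asym[of "N + i" "N + j"] A1 A4 unfolding Ab by simp
  qed (use A4 in auto)
  define I where "I = mat_inv A4"
  have I: "I \<in> carrier_mat m m" "A4 * I = 1\<^sub>m m" "I * A4 = 1\<^sub>m m"
    using mat_inv[OF A4 inv] by (simp_all add: I_def)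
  have TI: "transpose_mat I = I"
  proof -
    have "transpose_mat (I * A4) = 1\<^sub>m m" "transpose_mat (A4 * I) = 1\<^sub>m m" unfolding I(2,3) by simp_all
    then have "A4 * transpose_mat I = 1\<^sub>m m" "transpose_mat I * A4 = 1\<^sub>m m"
      unfolding transpose_mult[OF A4 I(1)] transpose_mult[OF I(1) A4] T4 by simp_all
    then have "mat_inv A4 = transpose_mat I" using I(1) by (intro mat_inv_eqI[OF A4]) auto
    then show ?thesis by (simp add: I_def)
  qed
  have A2I: "A2 * I \<in> carrier_mat N m" and A2IA3: "A2 * I * A3 \<in> carrier_mat N N" using A2 I(1) A3 by auto
  show R: "R \<in> carrier_mat N N" unfolding R_def I_def[symmetric] using A2IA3 by (rule minus_carrier_mat)
  show TR: "transpose_mat R = R"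
  proof -
    have T3: "transpose_mat A3 = A2" using T2 by (metis transpose_transpose)
    have "transpose_mat (A2 * I * A3) = A2 * (I * A3)"
      unfolding transpose_mult[OF A2I A3] transpose_mult[OF A2 I(1)] T2 T3 TI ..
    also have "\<dots> = A2 * I * A3" by (rule assoc_mult_mat[OF A2 I(1) A3, symmetric])
    finally show ?thesis unfolding R_def I_def[symmetric] transpose_minus[OF A1 A2IA3] T1 by simp
  qed
  define c where "c = map_mat complex_of_real"
  have cc: "c B \<in> carrier_mat k l \<longleftrightarrow> B \<in> carrier_mat k l" for B k l by (simp add: c_def)
  have cmult: "c (B * D) = c B * c D" if "B \<in> carrier_mat k l" "D \<in> carrier_mat l j" for B D k l j
    unfolding c_def using that by (rule of_real_hom.mat_hom_mult)
  have cA: "c A = four_block_mat (c A1) (c A2) (c A3) (c A4)"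
    unfolding Ab c_def by (rule eq_matI) (use A1 A2 A3 A4 in auto)
  have "0 \<le> quad (c R) x" if x: "x \<in> carrier_vec N" for x
  proof -
    define w where "w = c A3 *\<^sub>v x"
    define u where "u = - (c I *\<^sub>v w)"
    have w: "w \<in> carrier_vec m" using A3 x by (simp add: w_def c_def)
    have Iw: "c I *\<^sub>v w \<in> carrier_vec m" using I(1) w by (simp add: c_def)
    have u: "u \<in> carrier_vec m" using Iw by (simp add: u_def)
    have neg: "B *\<^sub>v (- z) = - (B *\<^sub>v z)" if "B \<in> carrier_mat k l" "z \<in> carrier_vec l" for B :: "complex mat" and z k l
      by (rule eq_vecI) (use that in \<open>auto simp: scalar_prod_def sum_negf\<close>)
    have top: "c A1 *\<^sub>v x + c A2 *\<^sub>v u = c R *\<^sub>v x"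
    proof -
      have cR: "c R = c A1 - c A2 * c I * c A3"
      proof -
        have "c R = c A1 - c (A2 * I * A3)"
          unfolding R_def I_def[symmetric] c_def by (rule eq_matI) (use A1 A2IA3 in \<open>auto simp del: index_mult_mat\<close>)
        then show ?thesis unfolding cmult[OF A2I A3] cmult[OF A2 I(1)] .
      qed
      have c1: "c A1 \<in> carrier_mat N N" "c A2 \<in> carrier_mat N m" "c I \<in> carrier_mat m m" "c A3 \<in> carrier_mat m N"
        using A1 A2 I A3 cc by auto
      have c2: "c A2 * c I \<in> carrier_mat N m" using c1(2,3) by (rule mult_carrier_mat)
      have c3: "c A2 * c I * c A3 \<in> carrier_mat N N" using c2 c1(4) by (rule mult_carrier_mat)
      have "c R *\<^sub>v x = c A1 *\<^sub>v x - (c A2 * c I * c A3) *\<^sub>v x"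
        unfolding cR by (rule minus_mult_distrib_mat_vec[OF c1(1) c3 x])
      also have "(c A2 * c I * c A3) *\<^sub>v x = c A2 *\<^sub>v (c I *\<^sub>v w)"
        unfolding assoc_mult_mat_vec[OF c2 c1(4) x] w_def[symmetric] by (rule assoc_mult_mat_vec[OF c1(2,3) w])
      finally have e: "c R *\<^sub>v x = c A1 *\<^sub>v x - c A2 *\<^sub>v (c I *\<^sub>v w)" .
      show ?thesis unfolding e u_def neg[OF c1(2) Iw]
        by (rule eq_vecI) (use c1 in auto)
    qed
    have bot: "c A3 *\<^sub>v x + c A4 *\<^sub>v u = 0\<^sub>v m"
    proof -
      have c4: "c A4 \<in> carrier_mat m m" "c I \<in> carrier_mat m m" using A4 I cc by auto
      have "c A4 * c I = 1\<^sub>m m" using cmult[OF A4 I(1)] I(2) by (simp add: c_def of_real_hom.mat_hom_one)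
      then have "c A4 *\<^sub>v (c I *\<^sub>v w) = w"
        using assoc_mult_mat_vec[OF c4 w] w by simp
      then have "c A4 *\<^sub>v u = - w" unfolding u_def neg[OF c4(1) Iw] by simp
      then show ?thesis unfolding w_def[symmetric] using w by simp
    qed
    have xu: "x @\<^sub>v u \<in> carrier_vec M" using append_carrier_vec[OF x u] NM by (simp add: m_def)
    have Rx: "c R *\<^sub>v x \<in> carrier_vec N" using R x by (simp add: c_def)
    have "c A *\<^sub>v (x @\<^sub>v u) = (c R *\<^sub>v x) @\<^sub>v 0\<^sub>v m"
      unfolding cA top[symmetric] bot[symmetric]
      using A1 A2 A3 A4 x u by (intro four_block_mat_mult_vec) (simp_all add: c_def)
    then have "(c A *\<^sub>v (x @\<^sub>v u)) \<bullet>c (x @\<^sub>v u) = (c R *\<^sub>v x) \<bullet>c x + 0\<^sub>v m \<bullet>c u"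
      unfolding conjugate_append_vec using Rx x u
      by (simp only: scalar_prod_append[OF Rx zero_carrier_vec carrier_vec_conjugate[OF x] carrier_vec_conjugate[OF u]])
    then have "quad (c A) (x @\<^sub>v u) = quad (c R) x" using u by (simp add: quad_def)
    then show ?thesis using nonneg[OF xu] by (simp add: c_def)
  qed
  then show "psd (map_mat complex_of_real R)"
    using R TR by (simp add: psd_def mat_adjoint_of_real c_def)
qed

section \<open>The multi-converter system\<close>

lemma det_nonzero_of_gain_or_phase:
  fixes K Ep Em :: "complex mat"
  assumes K: "K \<in> carrier_mat N N" and herm: "mat_adjoint K = K"
    and pos: "\<And>x. x \<in> carrier_vec N \<Longrightarrow> x \<noteq> 0\<^sub>v N \<Longrightarrow> 0 < quad K x"
    and gain: "\<And>x. x \<in> carrier_vec N \<Longrightarrow> g * sqn x \<le> quad K x"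
    and Y: "\<And>i. i < N \<Longrightarrow> Y i \<in> carrier_mat 2 2"
    and E: "Em \<in> carrier_mat (2 * N) (2 * N)" "Ep = mat_adjoint Em" "Ep * Em = 1\<^sub>m (2 * N)"
    and cond: "(\<exists>s. 0 < s \<and> s < g \<and> (\<forall>i<N. sigma_max (Y i) \<le> s)) \<or>
      (\<exists>a. 0 \<le> cos a \<and> (\<forall>i<N. \<forall>x\<in>carrier_vec 2. x \<noteq> 0\<^sub>v 2 \<longrightarrow> 0 < Re (cis (- a) * ((Y i *\<^sub>v x) \<bullet>c x))))"
    and t: "0 \<le> t" "t \<le> 1"
  shows "det (kron K (1\<^sub>m 2) + complex_of_real t \<cdot>\<^sub>m (Ep * block_diag N Y * Em)) \<noteq> 0"
proof
  define G where "G = Ep * block_diag N Y * Em"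
  have Ep: "Ep \<in> carrier_mat (2 * N) (2 * N)" using E(1) by (simp add: E(2))
  have G: "G \<in> carrier_mat (2 * N) (2 * N)" unfolding G_def using Ep block_diag_carrier E(1) by (intro mult_carrier_mat)
  have KI: "kron K (1\<^sub>m 2) \<in> carrier_mat (2 * N) (2 * N)" using K by (intro kron_carrier) auto
  assume "det (kron K (1\<^sub>m 2) + complex_of_real t \<cdot>\<^sub>m (Ep * block_diag N Y * Em)) = 0"
  moreover have tG: "complex_of_real t \<cdot>\<^sub>m G \<in> carrier_mat (2 * N) (2 * N)" using G by simp
  moreover have sumc: "kron K (1\<^sub>m 2) + complex_of_real t \<cdot>\<^sub>m G \<in> carrier_mat (2 * N) (2 * N)" using tG by simp
  ultimately obtain v where v: "v \<in> carrier_vec (2 * N)" "v \<noteq> 0\<^sub>v (2 * N)"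
    "(kron K (1\<^sub>m 2) + complex_of_real t \<cdot>\<^sub>m G) *\<^sub>v v = 0\<^sub>v (2 * N)"
    using det_0_iff_vec_prod_zero[OF sumc] by (auto simp: G_def)
  define z where "z = Em *\<^sub>v v"
  have z: "z \<in> carrier_vec (2 * N)" using E(1) v(1) by (simp add: z_def)
  have Gv: "(G *\<^sub>v v) \<bullet>c v = (\<Sum>i<N. (Y i *\<^sub>v block z i) \<bullet>c block z i)"
    unfolding G_def E(2) quad_congruence[OF block_diag_carrier E(1) v(1)] z_def[symmetric]
    by (rule block_diag_form[OF Y z])
  have "quad (mat_adjoint Em * Em) v = sqn v"
    unfolding E(2)[symmetric] E(3) quad_def using v(1) by (simp add: cscalar_prod_self)
  then have sz: "sqn z = sqn v" using quad_adjoint_mult[OF E(1) v(1)] by (simp add: z_def)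
  have Kv: "(kron K (1\<^sub>m 2) *\<^sub>v v) \<bullet>c v = complex_of_real (quad K (coord v N 0) + quad K (coord v N 1))"
    unfolding kron_one_form[OF K v(1)] hermitian_form_real[OF K herm coord_carrier] by simp
  define k where "k = quad K (coord v N 0) + quad K (coord v N 1)"
  define y where "y = (G *\<^sub>v v) \<bullet>c v"
  have "complex_of_real k + complex_of_real t * y = 0"
  proof -
    have KIv: "kron K (1\<^sub>m 2) *\<^sub>v v \<in> carrier_vec (2 * N)" and Gvc: "G *\<^sub>v v \<in> carrier_vec (2 * N)"
      using KI G v(1) by auto
    have "(kron K (1\<^sub>m 2) + complex_of_real t \<cdot>\<^sub>m G) *\<^sub>v v = kron K (1\<^sub>m 2) *\<^sub>v v + complex_of_real t \<cdot>\<^sub>v (G *\<^sub>v v)"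
      unfolding add_mult_distrib_mat_vec[OF KI tG v(1)]
      by (rule arg_cong[of _ _ "(+) _"]) (rule eq_vecI, use G v(1) in auto)
    then have "(kron K (1\<^sub>m 2) *\<^sub>v v + complex_of_real t \<cdot>\<^sub>v (G *\<^sub>v v)) \<bullet>c v = 0\<^sub>v (2 * N) \<bullet>c v" using v(3) by simp
    also have "\<dots> = 0" using v(1) by simp
    also have "(kron K (1\<^sub>m 2) *\<^sub>v v + complex_of_real t \<cdot>\<^sub>v (G *\<^sub>v v)) \<bullet>c v
        = (kron K (1\<^sub>m 2) *\<^sub>v v) \<bullet>c v + complex_of_real t * y"
      using KIv Gvc v(1) unfolding y_def
      by (subst add_scalar_prod_distrib[of _ "2 * N"]) simp_all
    finally show ?thesis unfolding Kv k_def .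
  qed
  then have e: "complex_of_real t * y = - complex_of_real k" by (simp add: add_eq_0_iff)
  have sv: "sqn v = sqn (coord v N 0) + sqn (coord v N 1)" using v(1) by (rule sqn_coord)
  have sv0: "0 < sqn v" using v(1,2) by (rule sqn_pos)
  show False using cond
  proof
    assume "\<exists>s. 0 < s \<and> s < g \<and> (\<forall>i<N. sigma_max (Y i) \<le> s)"
    then obtain s where s: "0 < s" "s < g" "\<And>i. i < N \<Longrightarrow> sigma_max (Y i) \<le> s" by blast
    have "g * sqn v \<le> k" unfolding sv k_def distrib_left by (intro add_mono gain coord_carrier)
    moreover have "k \<le> s * sqn v"
    proof -
      have "k \<le> cmod (complex_of_real k)" by simp
      also have "\<dots> = t * cmod y" using arg_cong[OF e, of cmod] t by (simp add: norm_mult)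
      also have "\<dots> \<le> 1 * cmod y" using t by (intro mult_right_mono) auto
      also have "\<dots> \<le> (\<Sum>i<N. cmod ((Y i *\<^sub>v block z i) \<bullet>c block z i))" unfolding y_def Gv by (simp add: norm_sum)
      also have "\<dots> \<le> (\<Sum>i<N. s * sqn (block z i))"
        using s Y by (intro sum_mono norm_form_le_sigma_max[of _ 2]) auto
      also have "\<dots> = s * sqn v" using sqn_block[OF z] sz by (simp add: sum_distrib_left)
      finally show ?thesis .
    qed
    moreover have "s * sqn v < g * sqn v" using s(2) sv0 by (rule mult_strict_right_mono)
    ultimately show False by linarith
  next
    assume "\<exists>a. 0 \<le> cos a \<and> (\<forall>i<N. \<forall>x\<in>carrier_vec 2. x \<noteq> 0\<^sub>v 2 \<longrightarrow> 0 < Re (cis (- a) * ((Y i *\<^sub>v x) \<bullet>c x)))"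
    then obtain a where a: "0 \<le> cos a"
      "\<And>i x. i < N \<Longrightarrow> x \<in> carrier_vec 2 \<Longrightarrow> x \<noteq> 0\<^sub>v 2 \<Longrightarrow> 0 < Re (cis (- a) * ((Y i *\<^sub>v x) \<bullet>c x))"
      by blast
    have k0: "0 < k"
    proof -
      have q: "0 \<le> quad K (coord v N l)" for l
      proof (cases "coord v N l = 0\<^sub>v N")
        case True
        then show ?thesis by (simp add: quad_zero)
      next
        case False
        then show ?thesis using pos[OF coord_carrier] by (simp add: less_imp_le)
      qed
      have "coord v N 0 \<noteq> 0\<^sub>v N \<or> coord v N 1 \<noteq> 0\<^sub>v N"
      proof (rule ccontr)
        assume "\<not> (coord v N 0 \<noteq> 0\<^sub>v N \<or> coord v N 1 \<noteq> 0\<^sub>v N)"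
        then have "coord v N 0 = 0\<^sub>v N" "coord v N 1 = 0\<^sub>v N" by simp_all
        then have "sqn v = 0" unfolding sv using sqn_eq_0_iff[OF zero_carrier_vec, of N] by simp
        with sv0 show False by simp
      qed
      then show ?thesis
      proof
        assume "coord v N 0 \<noteq> 0\<^sub>v N"
        then show ?thesis using pos[OF coord_carrier] q[of 1] unfolding k_def by (intro add_pos_nonneg)
      next
        assume "coord v N 1 \<noteq> 0\<^sub>v N"
        then show ?thesis using pos[OF coord_carrier] q[of 0] unfolding k_def by (intro add_nonneg_pos)
      qed
    qed
    have f: "0 \<le> Re (cis (- a) * ((Y i *\<^sub>v block z i) \<bullet>c block z i))" if "i < N" for i
    proof (cases "block z i = 0\<^sub>v 2")
      case True
      then show ?thesis using mult_mat_vec_carrier[OF Y[OF that] zero_carrier_vec] by simp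
    next
      case False
      then show ?thesis using a(2)[OF that block_carrier] by (simp add: less_imp_le)
    qed
    obtain i where i: "i < N" "block z i \<noteq> 0\<^sub>v 2"
    proof -
      have "\<exists>i<N. block z i \<noteq> 0\<^sub>v 2"
      proof (rule ccontr)
        assume "\<not> (\<exists>i<N. block z i \<noteq> 0\<^sub>v 2)"
        then have "sqn (block z i) = 0" if "i < N" for i
          using that sqn_eq_0_iff[OF block_carrier, of z i] by blast
        then have "sqn z = 0" unfolding sqn_block[OF z] by (intro sum.neutral) auto
        with sz sv0 show False by simp
      qed
      then show ?thesis using that by blast
    qed
    define r where "r = cis (- a) * y"
    have "r = (\<Sum>i<N. cis (- a) * ((Y i *\<^sub>v block z i) \<bullet>c block z i))"
      unfolding r_def y_def Gv by (rule sum_distrib_left)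
    then have "Re r = (\<Sum>i<N. Re (cis (- a) * ((Y i *\<^sub>v block z i) \<bullet>c block z i)))"
      by (simp only: Re_sum)
    also have "\<dots> > 0"
    proof (rule sum_pos2[of _ i])
      show "0 < Re (cis (- a) * ((Y i *\<^sub>v block z i) \<bullet>c block z i))" by (rule a(2)[OF i(1) block_carrier i(2)])
      show "0 \<le> Re (cis (- a) * ((Y j *\<^sub>v block z j) \<bullet>c block z j))" if "j \<in> {..<N}" for j
        using f[of j] that by simp
    qed (use i in simp_all)
    finally have r0: "0 < Re r" .
    have "complex_of_real t * r = cis (- a) * (complex_of_real t * y)" unfolding r_def by (rule mult.left_commute)
    then have "Re (complex_of_real t * r) = Re (cis (- a) * - complex_of_real k)" unfolding e by simp
    then have "t * Re r = - (k * cos a)" by (simp add: mult.commute)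
    moreover have "t \<noteq> 0" using e k0 by auto
    then have "0 < t * Re r" using t r0 by (intro mult_pos_pos) auto
    ultimately have "0 < - (k * cos a)" by simp
    moreover have "0 \<le> k * cos a" using k0 a(1) by (intro mult_nonneg_nonneg) auto
    ultimately show False by linarith
  qed
qed

lemma mat_diag_eq_one: "(\<And>i. i < n \<Longrightarrow> f i = 1) \<Longrightarrow> mat_diag n f = 1\<^sub>m n"
  by (rule eq_matI) (auto simp: mat_diag_def)

lemma
  fixes R :: "real mat"
  assumes R: "R \<in> carrier_mat N N" and sym: "transpose_mat R = R"
    and psd: "psd (map_mat complex_of_real R)" and inv: "invertible_mat R"
    and S: "\<And>i. i < N \<Longrightarrow> 0 < S i"
  defines "D \<equiv> mat_diag N (\<lambda>i. 1 / sqrt (S i))"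
  shows scaled_symmetric: "transpose_mat (D * R * D) = D * R * D"
    and scaled_det: "det (D * R * D) \<noteq> 0"
    and scaled_pos: "x \<in> carrier_vec N \<Longrightarrow> x \<noteq> 0\<^sub>v N \<Longrightarrow> 0 < quad (map_mat complex_of_real (D * R * D)) x"
    and scaled_eigenvalue: "eigenvalue (mat_inv (mat_diag N S) * R) l \<longleftrightarrow> eigenvalue (D * R * D) l"
proof -
  define E where "E = mat_diag N (\<lambda>i. sqrt (S i))"
  have D: "D \<in> carrier_mat N N" and E: "E \<in> carrier_mat N N" by (simp_all add: D_def E_def)
  have pos: "S i \<noteq> 0" "sqrt (S i) \<noteq> 0" "sqrt (S i) * sqrt (S i) = S i" "\<bar>S i\<bar> = S i" if "i < N" for i using S[OF that] by auto
  have DE: "D * E = 1\<^sub>m N" unfolding D_def E_def mat_diag_diag by (rule mat_diag_eq_one) (simp add: pos)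
  have ED: "E * D = 1\<^sub>m N" unfolding D_def E_def mat_diag_diag by (rule mat_diag_eq_one) (simp add: pos)
  have TD: "transpose_mat D = D" by (rule eq_matI) (auto simp: D_def mat_diag_def)
  have DR: "D * R \<in> carrier_mat N N" using D R by auto
  show "transpose_mat (D * R * D) = D * R * D"
    unfolding transpose_mult[OF DR D] transpose_mult[OF D R] TD sym by (rule assoc_mult_mat[OF D R D, symmetric])
  have detD: "det D \<noteq> 0" by (rule invertible_imp_det_nonzero[OF D invertible_matI[OF D E DE ED]])
  have detR: "det R \<noteq> 0" by (rule invertible_imp_det_nonzero[OF R inv])
  show "det (D * R * D) \<noteq> 0" unfolding det_mult[OF DR D] det_mult[OF D R] using detD detR by simp
  have SDD: "mat_inv (mat_diag N S) = D * D"
  proof (rule mat_inv_eqI)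
    show "mat_diag N S * (D * D) = 1\<^sub>m N"
      unfolding D_def mat_diag_diag by (rule mat_diag_eq_one) (simp add: pos)
    show "D * D * mat_diag N S = 1\<^sub>m N"
      unfolding D_def mat_diag_diag by (rule mat_diag_eq_one) (simp add: pos)
  qed (use D in auto)
  have DRD: "D * R * D \<in> carrier_mat N N" using DR D by (rule mult_carrier_mat)
  have "similar_mat (D * D * R) (D * R * D)"
  proof (rule similar_matI[OF _ DE ED])
    have "D * (D * R * D) * E = D * (D * R * (D * E))"
      unfolding assoc_mult_mat[OF D DRD E] assoc_mult_mat[OF DR D E] ..
    also have "\<dots> = D * D * R" unfolding DE right_mult_one_mat[OF DR] assoc_mult_mat[OF D D R] ..
    finally show "D * D * R = D * (D * R * D) * E" ..
  qed (use D R E DRD in auto)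
  then have "char_poly (D * D * R) = char_poly (D * R * D)" by (rule char_poly_similar)
  moreover have DDR: "D * D * R \<in> carrier_mat N N" using D R by auto
  ultimately show "eigenvalue (mat_inv (mat_diag N S) * R) l \<longleftrightarrow> eigenvalue (D * R * D) l"
    unfolding SDD eigenvalue_root_char_poly[OF DDR] eigenvalue_root_char_poly[OF DRD] by simp
  define c where "c = map_mat complex_of_real"
  have cc: "c D \<in> carrier_mat N N" "c R \<in> carrier_mat N N" "c E \<in> carrier_mat N N"
    using D R E by (simp_all add: c_def)
  have cK: "c (D * R * D) = mat_adjoint (c D) * c R * c D"
    unfolding c_def mat_adjoint_of_real TD of_real_hom.mat_hom_mult[OF DR D] of_real_hom.mat_hom_mult[OF D R] ..
  have "det (c R) \<noteq> 0" unfolding c_def of_real_hom.hom_det using detR by simp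
  then obtain d where d: "0 < d" "\<And>x. x \<in> carrier_vec N \<Longrightarrow> d * sqn x \<le> quad (c R) x"
    using psd_invertible_coercive[OF cc(2) psd[folded c_def]] by blast
  show "0 < quad (map_mat complex_of_real (D * R * D)) x" if x: "x \<in> carrier_vec N" "x \<noteq> 0\<^sub>v N"
  proof -
    have Dx: "c D *\<^sub>v x \<in> carrier_vec N" using cc(1) x(1) by simp
    have "c E * c D = 1\<^sub>m N"
      unfolding c_def of_real_hom.mat_hom_mult[OF E D, symmetric] ED by (rule of_real_hom.mat_hom_one)
    then have EDx: "c E *\<^sub>v (c D *\<^sub>v x) = x" using assoc_mult_mat_vec[OF cc(3,1) x(1)] x(1) by simp
    have "c D *\<^sub>v x \<noteq> 0\<^sub>v N"
    proof
      assume "c D *\<^sub>v x = 0\<^sub>v N"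
      then have "x = c E *\<^sub>v 0\<^sub>v N" using EDx by simp
      also have "\<dots> = 0\<^sub>v N" by (rule eq_vecI) (use cc in auto)
      finally show False using x(2) by blast
    qed
    then have "0 < d * sqn (c D *\<^sub>v x)" using d(1) sqn_pos[OF Dx] by simp
    also have "\<dots> \<le> quad (c R) (c D *\<^sub>v x)" by (rule d(2)[OF Dx])
    also have "\<dots> = quad (c (D * R * D)) x" unfolding quad_def cK quad_congruence[OF cc(2,1) x(1)] ..
    finally show ?thesis by (simp add: c_def)
  qed
qed

lemma rotation_angle_exists:
  fixes p q :: real
  assumes "p < pi" "- pi < q" "p - q < pi"
  obtains a where "0 \<le> cos a" "p < a + pi / 2" "a - pi / 2 < q"
proof -
  define l u where "l = max (p - pi / 2) (- (pi / 2))" and "u = min (q + pi / 2) (pi / 2)"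
  have b: "p - pi / 2 \<le> l" "- (pi / 2) \<le> l" "u \<le> q + pi / 2" "u \<le> pi / 2"
    unfolding l_def u_def by (rule max.cobounded1 max.cobounded2 min.cobounded1 min.cobounded2)+
  have s: "p - pi / 2 < u" "- (pi / 2) \<le> u" "l < q + pi / 2" "l \<le> pi / 2"
    unfolding l_def u_def min_less_iff_conj max_less_iff_conj min.bounded_iff max.bounded_iff
    using assms pi_gt_zero by (intro conjI; linarith)+
  define a where "a = (l + u) / 2"
  have a: "2 * a = l + u" by (simp add: a_def)
  show ?thesis
  proof
    show "0 \<le> cos a" by (rule cos_ge_zero) (use a b s in linarith)+
    show "p < a + pi / 2" using a b s by linarith
    show "a - pi / 2 < q" using a b s by linarith
  qed
qed

lemma phase_condition_imp_half_plane:
  fixes N :: nat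
  assumes N: "1 \<le> N" and Y: "\<And>i. i < N \<Longrightarrow> Y i \<in> carrier_mat 2 2"
    and ph: "\<And>i. i < N \<Longrightarrow> sectorial (Y i) \<Longrightarrow> is_phases (Y i) (ph i)"
    and max: "(MAX i\<in>{..<N}. max_phase (Y i) (ph i)) < ereal pi"
    and min: "(MIN i\<in>{..<N}. min_phase (Y i) (ph i)) > ereal (- pi)"
    and diff: "(MAX i\<in>{..<N}. max_phase (Y i) (ph i)) - (MIN i\<in>{..<N}. min_phase (Y i) (ph i)) < ereal pi"
  shows "\<exists>a. 0 \<le> cos a \<and> (\<forall>i<N. \<forall>x\<in>carrier_vec 2. x \<noteq> 0\<^sub>v 2 \<longrightarrow> 0 < Re (cis (- a) * ((Y i *\<^sub>v x) \<bullet>c x)))"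
proof -
  have fin: "finite {..<N}" "{..<N} \<noteq> {}" using N by (auto simp: lessThan_empty_iff)
  define P Q where "P = (MAX i\<in>{..<N}. max_phase (Y i) (ph i))" and "Q = (MIN i\<in>{..<N}. min_phase (Y i) (ph i))"
  have le_P: "max_phase (Y i) (ph i) \<le> P" if "i < N" for i
    unfolding P_def using that by (intro Max_ge) auto
  have Q_le: "Q \<le> min_phase (Y i) (ph i)" if "i < N" for i
    unfolding Q_def using that by (intro Min_le) auto
  have sec: "sectorial (Y i)" if "i < N" for i
    using le_P[OF that] max unfolding P_def[symmetric] by (auto simp: max_phase_def split: if_splits)
  have "P \<in> (\<lambda>i. max_phase (Y i) (ph i)) ` {..<N}" unfolding P_def using fin by (intro Max_in) auto
  then obtain p where p: "P = ereal p" using sec by (auto simp: max_phase_def)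
  have "Q \<in> (\<lambda>i. min_phase (Y i) (ph i)) ` {..<N}" unfolding Q_def using fin by (intro Min_in) auto
  then obtain q where q: "Q = ereal q" using sec by (auto simp: min_phase_def)
  have "p < pi" "- pi < q" "p - q < pi"
    using max min diff unfolding P_def[symmetric] Q_def[symmetric] p q by simp_all
  then obtain a where a: "0 \<le> cos a" "p < a + pi / 2" "a - pi / 2 < q" by (rule rotation_angle_exists)
  have "0 < Re (cis (- a) * ((Y i *\<^sub>v x) \<bullet>c x))" if i: "i < N" and x: "x \<in> carrier_vec 2" "x \<noteq> 0\<^sub>v 2" for i x
  proof (rule is_phases_rotated_pos[OF Y[OF i] ph[OF i sec[OF i]] x])
    show "hd (ph i) < a + pi / 2" using le_P[OF i] sec[OF i] a(2) by (simp add: max_phase_def p)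
    show "a - pi / 2 < last (ph i)" using Q_le[OF i] sec[OF i] a(3) by (simp add: min_phase_def q)
  qed
  with a(1) show ?thesis by blast
qed

lemma map_mat_block_diag:
  assumes "\<And>i. i < N \<Longrightarrow> B i \<in> carrier_mat 2 2" and f: "f 0 = 0"
  shows "map_mat f (block_diag N B) = block_diag N (\<lambda>i. map_mat f (B i))"
proof (rule eq_matI)
  fix i j assume "i < dim_row (block_diag N (\<lambda>i. map_mat f (B i)))" "j < dim_col (block_diag N (\<lambda>i. map_mat f (B i)))"
  then have ij: "i < 2 * N" "j < 2 * N" by (simp_all add: block_diag_def)
  then have "i div 2 < N" by presburger
  then have "B (i div 2) \<in> carrier_mat 2 2" by (rule assms(1))
  then show "map_mat f (block_diag N B) $$ (i, j) = block_diag N (\<lambda>i. map_mat f (B i)) $$ (i, j)"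
    using ij f by (auto simp: block_diag_def)
qed (simp_all add: block_diag_def)

lemma mat_adjoint_block_diag:
  fixes B :: "nat \<Rightarrow> complex mat"
  assumes "\<And>i. i < N \<Longrightarrow> B i \<in> carrier_mat 2 2"
  shows "mat_adjoint (block_diag N B) = block_diag N (\<lambda>i. mat_adjoint (B i))"
proof (rule eq_matI)
  fix i j assume "i < dim_row (block_diag N (\<lambda>i. mat_adjoint (B i)))" "j < dim_col (block_diag N (\<lambda>i. mat_adjoint (B i)))"
  then have ij: "i < 2 * N" "j < 2 * N" by (simp_all add: block_diag_def)
  then have "i div 2 < N" by presburger
  then have "B (i div 2) \<in> carrier_mat 2 2" by (rule assms(1))
  then show "mat_adjoint (block_diag N B) $$ (i, j) = block_diag N (\<lambda>i. mat_adjoint (B i)) $$ (i, j)"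
    using ij by (auto simp: block_diag_def)
qed (simp_all add: block_diag_def)

lemma tf_at_rotation_adjoint:
  "mat_adjoint (map_mat (tf_at w) (rotation t)) = map_mat (tf_at w) (rotation (- t))"
  by (rule eq_matI) (auto simp: rotation_eq simp del: tf_const_simps)

lemma RH_mat_block_diag:
  assumes "\<And>i. i < N \<Longrightarrow> B i \<in> carrier_mat 2 2" "\<And>i. i < N \<Longrightarrow> RH_mat (B i)"
  shows "RH_mat (block_diag N B)"
  unfolding RH_mat_def
proof (intro allI impI)
  fix i j assume "i < dim_row (block_diag N B)" "j < dim_col (block_diag N B)"
  then have ij: "i < 2 * N" "j < 2 * N" by (simp_all add: block_diag_def)
  then have i2: "i div 2 < N" by presburger
  then have "B (i div 2) $$ (i mod 2, j mod 2) \<in> RH"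
    using assms(1)[OF i2] assms(2)[OF i2] by (simp add: RH_mat_def)
  then show "block_diag N B $$ (i, j) \<in> RH"
    unfolding block_diag_index[OF ij] by (cases "i div 2 = j div 2") simp_all
qed

lemma RH_mat_rotation: "RH_mat (rotation t)"
  by (simp add: RH_mat_def rotation_eq del: tf_const_simps)

lemma freq_resp_rotated_block_diag:
  assumes B: "\<And>i. i < N \<Longrightarrow> B i \<in> carrier_mat 2 2"
    and G: "G = block_diag N (\<lambda>i. rotation (\<theta> i)) * block_diag N B * block_diag N (\<lambda>i. rotation (- \<theta> i))"
    and RH: "RH_mat G"
  defines "Em w \<equiv> block_diag N (\<lambda>i. map_mat (tf_at w) (rotation (- \<theta> i)))"
  shows "freq_resp G w = mat_adjoint (Em w) * block_diag N (\<lambda>i. freq_resp (B i) w) * Em w"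
    and "mat_adjoint (Em w) * Em w = 1\<^sub>m (2 * N)"
proof -
  define P where "P = block_diag N (\<lambda>i. rotation (\<theta> i))"
  define Q where "Q = block_diag N (\<lambda>i. rotation (- \<theta> i))"
  define D where "D = block_diag N B"
  have P: "P \<in> carrier_mat (2 * N) (2 * N)" and Q: "Q \<in> carrier_mat (2 * N) (2 * N)"
    and D: "D \<in> carrier_mat (2 * N) (2 * N)" by (simp_all add: P_def Q_def D_def)
  have PRH: "RH_mat P" and QRH: "RH_mat Q"
    unfolding P_def Q_def by (intro RH_mat_block_diag rotation_carrier RH_mat_rotation)+
  have PQ: "P * Q = 1\<^sub>m (2 * N)"
    unfolding P_def Q_def by (subst block_diag_mult) (simp_all add: rotation_inverse block_diag_one)
  have QP: "Q * P = 1\<^sub>m (2 * N)"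
  proof -
    have "rotation (- \<theta> i) * rotation (\<theta> i) = 1\<^sub>m 2" for i using rotation_inverse[of "- \<theta> i"] by simp
    then show ?thesis unfolding P_def Q_def by (subst block_diag_mult) (simp_all add: block_diag_one)
  qed
  have G': "G = P * D * Q" by (simp add: G P_def Q_def D_def)
  have PD: "P * D \<in> carrier_mat (2 * N) (2 * N)" using P D by (rule mult_carrier_mat)
  have Gc: "G \<in> carrier_mat (2 * N) (2 * N)" unfolding G' using PD Q by (rule mult_carrier_mat)
  have QG: "Q * G \<in> carrier_mat (2 * N) (2 * N)" using Q Gc by (rule mult_carrier_mat)
  have "Q * G = D * Q"
  proof -
    have "Q * G = Q * (P * (D * Q))" unfolding G' assoc_mult_mat[OF P D Q] ..
    also have "\<dots> = Q * P * (D * Q)" using assoc_mult_mat[OF Q P mult_carrier_mat[OF D Q]] by simp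
    also have "\<dots> = D * Q" unfolding QP using left_mult_one_mat[OF mult_carrier_mat[OF D Q]] .
    finally show ?thesis .
  qed
  then have "Q * G * P = D"
    using assoc_mult_mat[OF D Q P] QP D by simp
  then have DRH: "RH_mat D"
    using RH_mat_mult[OF QG P RH_mat_mult[OF Q Gc QRH RH] PRH] by simp
  have Em: "Em w = map_mat (tf_at w) Q"
    unfolding Em_def Q_def by (rule map_mat_block_diag[symmetric]) simp_all
  have Ep: "mat_adjoint (Em w) = map_mat (tf_at w) P"
  proof -
    have "mat_adjoint (Em w) = block_diag N (\<lambda>i. map_mat (tf_at w) (rotation (\<theta> i)))"
      unfolding Em_def by (subst mat_adjoint_block_diag) (simp_all add: tf_at_rotation_adjoint)
    also have "\<dots> = map_mat (tf_at w) P"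
      unfolding P_def by (rule map_mat_block_diag[symmetric]) simp_all
    finally show ?thesis .
  qed
  have one: "map_mat (tf_at w) (1\<^sub>m (2 * N)) = 1\<^sub>m (2 * N)" by (rule eq_matI) auto
  show "mat_adjoint (Em w) * Em w = 1\<^sub>m (2 * N)"
    unfolding Ep unfolding Em tf_at_mat_mult[OF P Q PRH QRH, symmetric] PQ one ..
  have "block_diag N (\<lambda>i. freq_resp (B i) w) = map_mat (tf_at w) D"
    unfolding D_def freq_resp_eq by (rule map_mat_block_diag[symmetric]) (simp_all add: B)
  then show "freq_resp G w = mat_adjoint (Em w) * block_diag N (\<lambda>i. freq_resp (B i) w) * Em w"
    unfolding freq_resp_eq[of G] unfolding G' Ep unfolding Em
    using tf_at_mat_mult[OF PD Q RH_mat_mult[OF P D PRH DRH] QRH] tf_at_mat_mult[OF P D PRH DRH] by simp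
qed

lemma scaled_grid_eq:
  assumes K: "R \<in> carrier_mat N N" "D \<in> carrier_mat N N"
    and F: "F \<in> carrier_mat 2 2" "Z \<in> carrier_mat 2 2" "F * Z = 1\<^sub>m 2"
  shows "kron (map_mat tf_const D) (1\<^sub>m 2) * kron (map_mat tf_const R) F * kron (map_mat tf_const D) Z
    = map_mat tf_const (kron (D * R * D) (1\<^sub>m 2))"
proof -
  define c where "c = map_mat tf_const"
  have c: "c D \<in> carrier_mat N N" "c R \<in> carrier_mat N N" using K by (simp_all add: c_def)
  have DR: "D * R \<in> carrier_mat N N" using K by auto
  have cDR: "c D * c R \<in> carrier_mat N N" using c by (rule mult_carrier_mat)
  have I2: "1\<^sub>m 2 * F = F" using F(1) by simp
  have "c D * c R * c D = c (D * R * D)"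
    unfolding c_def semiring_hom.mat_hom_mult[OF tf_const_semiring_hom DR K(2)]
      semiring_hom.mat_hom_mult[OF tf_const_semiring_hom K(2,1)] ..
  then have "kron (c D) (1\<^sub>m 2) * kron (c R) F * kron (c D) Z = kron (c (D * R * D)) (1\<^sub>m 2)"
    unfolding kron_mult[OF c one_carrier_mat F(1)] I2 kron_mult[OF cDR c(1) F(1,2)] F(3) by simp
  also have "\<dots> = c (kron (D * R * D) (1\<^sub>m 2))"
    unfolding c_def using mult_carrier_mat[OF DR K(2)] by (rule map_mat_kron_one) simp
  finally show ?thesis unfolding c_def .
qed

lemma rotated_admittance_eq:
  assumes YC: "\<And>i. i < N \<Longrightarrow> YC i \<in> carrier_mat 2 2"
  shows "diag_block_mat (map (\<lambda>i. rotation (\<theta> i)) [0..<N]) * diag_block_mat (map YC [0..<N])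
      * diag_block_mat (map (\<lambda>i. rotation (- \<theta> i)) [0..<N]) * kron (1\<^sub>m N) (impedance a)
    = block_diag N (\<lambda>i. rotation (\<theta> i)) * block_diag N (\<lambda>i. YC i * impedance a)
      * block_diag N (\<lambda>i. rotation (- \<theta> i))"
proof -
  let ?P = "\<lambda>i. rotation (\<theta> i)" and ?Q = "\<lambda>i. rotation (- \<theta> i)" and ?Z = "impedance a"
  have c: "?P i \<in> carrier_mat 2 2" "?Q i \<in> carrier_mat 2 2" "?Z \<in> carrier_mat 2 2" for i by simp_all
  have m: "A \<in> carrier_mat 2 2 \<Longrightarrow> B \<in> carrier_mat 2 2 \<Longrightarrow> A * B \<in> carrier_mat 2 2" for A B :: "tf mat"
    by (rule mult_carrier_mat)
  have e: "?P i * YC i * ?Q i * ?Z = ?P i * (YC i * ?Z) * ?Q i" if i: "i < N" for i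
  proof -
    note y = YC[OF i]
    have "?P i * YC i * ?Q i * ?Z = ?P i * YC i * (?Q i * ?Z)"
      by (rule assoc_mult_mat[OF m[OF c(1) y] c(2,3)])
    also have "\<dots> = ?P i * YC i * ?Z * ?Q i"
      unfolding rotation_impedance_commute by (rule assoc_mult_mat[OF m[OF c(1) y] c(3,2), symmetric])
    also have "?P i * YC i * ?Z = ?P i * (YC i * ?Z)" by (rule assoc_mult_mat[OF c(1) y c(3)])
    finally show ?thesis .
  qed
  have "block_diag N ?P * block_diag N YC * block_diag N ?Q * block_diag N (\<lambda>i. ?Z)
      = block_diag N (\<lambda>i. ?P i * YC i * ?Q i * ?Z)"
    by (subst block_diag_mult, (simp add: YC)+, subst block_diag_mult, (simp add: YC m)+,
        subst block_diag_mult, (simp add: YC m)+)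
  also have "\<dots> = block_diag N (\<lambda>i. ?P i * (YC i * ?Z) * ?Q i)" by (rule block_diag_cong) (rule e)
  also have "\<dots> = block_diag N ?P * block_diag N (\<lambda>i. YC i * ?Z) * block_diag N ?Q"
    by (subst block_diag_mult, (simp add: YC m)+, subst block_diag_mult, (simp add: YC m)+)
  finally show ?thesis
    using diag_block_mat_eq_block_diag[of N YC] diag_block_mat_eq_block_diag[of N ?P]
      diag_block_mat_eq_block_diag[of N ?Q] YC
    by (simp add: kron_one_left)
qed

theorem mainTheorem2:
  fixes N M :: nat
    and YC :: "nat \<Rightarrow> tf mat"
    and S \<theta> :: "nat \<Rightarrow> real"
    and b :: "nat \<Rightarrow> nat \<Rightarrow> real"
    and \<omega>0 \<epsilon> gSCR :: real
    and B1 B2 B3 B4 Br Sinv Ssqrtinv :: "real mat"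
    and F Ygrid Ygrid' YCN Eplus Eminus G H :: "tf mat"
    and YC' :: "nat \<Rightarrow> tf mat"
    and ph :: "nat \<Rightarrow> ereal \<Rightarrow> real list"
  assumes N: "1 \<le> N" and M: "N \<le> M"
    and YC: "\<And>i. i < N \<Longrightarrow> YC i \<in> carrier_mat 2 2"
    and S: "\<And>i. i < N \<Longrightarrow> 0 < S i"
    and b_sym: "\<And>i j. i \<le> M \<Longrightarrow> j \<le> M \<Longrightarrow> i \<noteq> j \<Longrightarrow> b i j = b j i"
    and b_nonneg: "\<And>i j. i \<le> M \<Longrightarrow> j \<le> M \<Longrightarrow> i \<noteq> j \<Longrightarrow> 0 \<le> b i j"
    and \<omega>0: "0 < \<omega>0" and \<epsilon>: "0 \<le> \<epsilon>"
    and partition: "split_block (grounded_laplacian M b) N N = (B1, B2, B3, B4)"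
    and B4_inv: "invertible_mat B4"
    and Br: "Br = B1 - B2 * mat_inv B4 * B3"
    and Br_inv: "invertible_mat Br"
    and F: "F = line_dynamics \<omega>0 \<epsilon>"
    and Sinv: "Sinv = mat_inv (mat_diag N S)"
    and Ssqrtinv: "Ssqrtinv = mat_diag N (\<lambda>i. 1 / sqrt (S i))"
    and Ygrid: "Ygrid = kron (map_mat tf_const Br) F"
    and Ygrid': "Ygrid' = kron (map_mat tf_const Ssqrtinv) (1\<^sub>m 2) * Ygrid *
                          kron (map_mat tf_const Ssqrtinv) (mat_inv F)"
    and YCN: "YCN = diag_block_mat (map YC [0..<N])"
    and Eplus: "Eplus = diag_block_mat (map (\<lambda>i. rotation (\<theta> i)) [0..<N])"
    and Eminus: "Eminus = diag_block_mat (map (\<lambda>i. rotation (- \<theta> i)) [0..<N])"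
    and YC': "\<And>i. i < N \<Longrightarrow> YC' i = YC i * mat_inv F"
    and gSCR: "gSCR = smallest_eigenvalue (Sinv * Br)"
    and G: "G = Eplus * YCN * Eminus * kron (1\<^sub>m N) (mat_inv F)"
    and H: "H = mat_inv Ygrid'"
    and G_stable: "G \<in> RH_inf (2 * N)"
    and H_stable: "H \<in> RH_inf (2 * N)"
    and ph: "\<And>i \<omega>. i < N \<Longrightarrow> 0 \<le> \<omega> \<Longrightarrow> sectorial (freq_resp (YC' i) \<omega>) \<Longrightarrow>
                     is_phases (freq_resp (YC' i) \<omega>) (ph i \<omega>)"
    and gain_or_phase: "\<And>\<omega>. 0 \<le> \<omega> \<Longrightarrow>
       (MAX i\<in>{..<N}. sigma_max (freq_resp (YC' i) \<omega>)) < gSCR \<or>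
       ((MAX i\<in>{..<N}. max_phase (freq_resp (YC' i) \<omega>) (ph i \<omega>)) < ereal pi \<and>
        (MIN i\<in>{..<N}. min_phase (freq_resp (YC' i) \<omega>) (ph i \<omega>)) > ereal (- pi) \<and>
        (MAX i\<in>{..<N}. max_phase (freq_resp (YC' i) \<omega>) (ph i \<omega>)) -
        (MIN i\<in>{..<N}. min_phase (freq_resp (YC' i) \<omega>) (ph i \<omega>)) < ereal pi)"
  shows "gSCR = sigma_min (map_mat complex_of_real (Ssqrtinv * Br * Ssqrtinv)) \<and>
         feedback_stable G H"
proof -
  note schur = schur_complement_psd[OF grounded_laplacian_carrier M grounded_laplacian_symmetric[OF b_sym]
      grounded_laplacian_psd[OF b_sym b_nonneg] partition B4_inv, folded Br]
  define K where "K = Ssqrtinv * Br * Ssqrtinv"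
  define Kc where "Kc = map_mat complex_of_real K"
  note scaled = schur Br_inv S
  have D: "Ssqrtinv \<in> carrier_mat N N" by (simp add: Ssqrtinv)
  have K: "K \<in> carrier_mat N N" unfolding K_def using D schur(1) by auto
  have Ksym: "transpose_mat K = K" and Kdet: "det K \<noteq> 0"
    unfolding K_def Ssqrtinv using scaled_symmetric[OF scaled] scaled_det[OF scaled] by auto
  have Kpos: "0 < quad Kc x" if "x \<in> carrier_vec N" "x \<noteq> 0\<^sub>v N" for x
    unfolding Kc_def K_def Ssqrtinv using scaled_pos[OF scaled] that by auto
  have "{x. eigenvalue (Sinv * Br) x} = {x. eigenvalue K x}"
    unfolding Sinv K_def Ssqrtinv using scaled_eigenvalue[OF scaled] by auto
  then have g: "gSCR = smallest_eigenvalue K" unfolding gSCR smallest_eigenvalue_def by simp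
  have sv: "singular_values Kc = {x. eigenvalue K x}"
    unfolding Kc_def using Kpos[unfolded Kc_def] by (intro singular_values_pos_def[OF K Ksym]) auto
  have part1: "gSCR = sigma_min (map_mat complex_of_real (Ssqrtinv * Br * Ssqrtinv))"
    unfolding g K_def[symmetric] Kc_def[symmetric] sigma_min_def sv smallest_eigenvalue_def ..
  have N0: "0 < N" using N by simp
  have Kc: "Kc \<in> carrier_mat N N" and herm: "mat_adjoint Kc = Kc"
    using K by (simp_all add: Kc_def mat_adjoint_of_real Ksym)
  have Kgain: "gSCR * sqn x \<le> quad Kc x" if "x \<in> carrier_vec N" for x
    unfolding g Kc_def using K Ksym N0 that by (rule smallest_eigenvalue_le_quad)
  obtain a where Fc: "F \<in> carrier_mat 2 2" and Finv: "mat_inv F = impedance a" and FZ: "F * impedance a = 1\<^sub>m 2"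
    unfolding F by (rule line_dynamics_inverse)
  define A where "A = kron K (1\<^sub>m 2)"
  have A: "A \<in> carrier_mat (2 * N) (2 * N)" unfolding A_def using K by (intro kron_carrier) auto
  have Adet: "det A \<noteq> 0"
  proof -
    note i = det_nonzero_imp_inverse[OF K Kdet]
    let ?B = "kron (inverse (det K) \<cdot>\<^sub>m adj_mat K) (1\<^sub>m 2)"
    have B: "?B \<in> carrier_mat (2 * N) (2 * N)" using i(1) by (intro kron_carrier) auto
    have one: "kron (1\<^sub>m N) (1\<^sub>m 2) = (1\<^sub>m (2 * N) :: real mat)"
      by (simp add: kron_one_left block_diag_one)
    have "A * ?B = 1\<^sub>m (2 * N)" "?B * A = 1\<^sub>m (2 * N)"
      unfolding A_def kron_mult[OF K i(1) one_carrier_mat one_carrier_mat]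
        kron_mult[OF i(1) K one_carrier_mat one_carrier_mat] i(2,3) by (simp_all add: one)
    then show ?thesis using invertible_imp_det_nonzero[OF A invertible_matI[OF A B]] by blast
  qed
  have "Ygrid' = map_mat tf_const A"
    unfolding Ygrid' Ygrid Finv A_def K_def using schur(1) D Fc impedance_carrier FZ by (rule scaled_grid_eq)
  then have HA: "H = mat_inv (map_mat tf_const A)" by (simp add: H)
  have Geq: "G = block_diag N (\<lambda>i. rotation (\<theta> i)) * block_diag N (\<lambda>i. YC i * impedance a)
      * block_diag N (\<lambda>i. rotation (- \<theta> i))"
    unfolding G Eplus YCN Eminus Finv using YC by (rule rotated_admittance_eq)
  have GRH: "RH_mat G" using G_stable by (simp add: RH_inf_iff)
  have YCZ: "YC i * impedance a \<in> carrier_mat 2 2" if "i < N" for i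
    using YC[OF that] impedance_carrier by (rule mult_carrier_mat)
  have "feedback_stable G H"
  proof (rule feedback_stable_const_inverse[OF A Adet G_stable HA])
    fix t :: real and w :: ereal
    assume t: "0 \<le> t" "t \<le> 1" and w: "0 \<le> w"
    define Y where "Y i = freq_resp (YC i * impedance a) w" for i
    define Em where "Em = block_diag N (\<lambda>i. map_mat (tf_at w) (rotation (- \<theta> i)))"
    have resp: "freq_resp G w = mat_adjoint Em * block_diag N Y * Em"
      unfolding Em_def Y_def by (rule freq_resp_rotated_block_diag(1)[OF YCZ Geq GRH])
    have Em_unitary: "mat_adjoint Em * Em = 1\<^sub>m (2 * N)"
      unfolding Em_def by (rule freq_resp_rotated_block_diag(2)[OF YCZ Geq GRH])
    have Y: "Y i \<in> carrier_mat 2 2" if "i < N" for i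
      using YCZ[OF that] by (simp add: Y_def freq_resp_eq)
    have YY: "freq_resp (YC' i) w = Y i" if "i < N" for i
      unfolding Y_def YC'[OF that] Finv ..
    have cong: "(\<lambda>i. f (freq_resp (YC' i) w) (ph i w)) ` {..<N} = (\<lambda>i. f (Y i) (ph i w)) ` {..<N}"
      for f :: "complex mat \<Rightarrow> real list \<Rightarrow> 'b"
      by (rule image_cong) (simp_all add: YY)
    have cond: "(\<exists>s. 0 < s \<and> s < gSCR \<and> (\<forall>i<N. sigma_max (Y i) \<le> s)) \<or>
      (\<exists>a. 0 \<le> cos a \<and> (\<forall>i<N. \<forall>x\<in>carrier_vec 2. x \<noteq> 0\<^sub>v 2 \<longrightarrow> 0 < Re (cis (- a) * ((Y i *\<^sub>v x) \<bullet>c x))))"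
      using gain_or_phase[OF w]
    proof
      assume lt: "(MAX i\<in>{..<N}. sigma_max (freq_resp (YC' i) w)) < gSCR"
      define m where "m = (MAX i\<in>{..<N}. sigma_max (freq_resp (YC' i) w))"
      have le: "sigma_max (Y i) \<le> m" if "i < N" for i
        unfolding m_def YY[OF that, symmetric] using that by (intro Max_ge) auto
      have "0 \<le> m" using sigma_max_nonneg[OF Y[OF N0]] le[OF N0] by simp
      moreover obtain s where s: "m < s" "s < gSCR"
        using dense[OF lt] unfolding m_def by blast
      ultimately have "0 < s \<and> s < gSCR \<and> (\<forall>i<N. sigma_max (Y i) \<le> s)"
        using le by (meson le_less_trans less_imp_le order_trans)
      then show ?thesis by blast
    next
      assume p: "(MAX i\<in>{..<N}. max_phase (freq_resp (YC' i) w) (ph i w)) < ereal pi \<and>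
        (MIN i\<in>{..<N}. min_phase (freq_resp (YC' i) w) (ph i w)) > ereal (- pi) \<and>
        (MAX i\<in>{..<N}. max_phase (freq_resp (YC' i) w) (ph i w)) -
        (MIN i\<in>{..<N}. min_phase (freq_resp (YC' i) w) (ph i w)) < ereal pi"
      have "\<exists>a. 0 \<le> cos a \<and> (\<forall>i<N. \<forall>x\<in>carrier_vec 2. x \<noteq> 0\<^sub>v 2 \<longrightarrow> 0 < Re (cis (- a) * ((Y i *\<^sub>v x) \<bullet>c x)))"
      proof (rule phase_condition_imp_half_plane[OF N Y])
        show "is_phases (Y i) (ph i w)" if "i < N" "sectorial (Y i)" for i
          using ph[OF that(1) w] that(2) by (simp add: YY[OF that(1)])
      qed (use p[unfolded cong] in blast)+
      then show ?thesis ..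
    qed
    have Emc: "Em \<in> carrier_mat (2 * N) (2 * N)" by (simp add: Em_def)
    have "map_mat complex_of_real A = kron Kc (1\<^sub>m 2)"
      unfolding A_def Kc_def by (rule map_mat_kron_one[OF K, symmetric]) simp
    then show "det (map_mat complex_of_real A + complex_of_real t \<cdot>\<^sub>m freq_resp G w) \<noteq> 0"
      unfolding resp
      using det_nonzero_of_gain_or_phase[OF Kc herm Kpos Kgain Y Emc refl Em_unitary cond t] by simp
  qed
  with part1 show ?thesis ..
qed

end
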